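(* If $E$ is a graph and $K$ is a field, then every graded ideal of $L_K(E)$ is isomorphic (as a $K$-algebra) to a Leavitt path algebra, i.e. to $L_K(F)$ for some graph $F$.
   Context: A graph $E=(E^0,E^1,r,s)$ consists of a set $E^0$ of vertices, a set $E^1$ of edges, and maps $r,s:E^1\to E^0$ (range and source). A vertex $v$ is regular if $0<|s^{-1}(v)|<\infty$; $E^0_{\mathrm{reg}}$ is the set of regular vertices. The Leavitt path algebra $L_K(E)$ is the free associative $K$-algebra generated by a set $\{v:v\in E^0\}$ of pairwise orthogonal idempotents together with a set $\{e,e^*:e\in E^1\}$ of elements, modulo the ideal generated by the relations: (1) $s(e)e=er(e)=e$ for all $e\in E^1$; (2) $r(e)e^*=e^*s(e)=e^*$ for all $e\in E^1$; (3) $e^*f=\delta_{e,f}\,r(e)$ for all $e,f\in E^1$; (4) $v=\sum_{\{e\in E^1:s(e)=v\}}ee^*$ for all $v\in E^0_{\mathrm{reg}}$. (Algebras are not assumed unital.) $L_K(E)$ is $\mathbb{Z}$-graded with vertices in degree $0$, each $e\in E^1$ in degree $1$ and each $e^*$ in degree $-1$. A two-sided ideal is graded if it is the direct sum of its intersections with the homogeneous components of $L_K(E)$. *)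

theory Defs
  imports
    "Graph_Theory.Digraph"
    "HOL-Algebra.QuotRing"
    "HOL-Algebra.Module"
    "HOL-Library.Poly_Mapping"
begin

section \<open>Not necessarily unital algebras over a field\<close>

text \<open>
  The scalars range over a type \<open>'k\<close> of class \<open>field\<close>. An algebra is an HOL-Algebra \<open>module\<close>
  record, which supplies a carrier, addition, multiplication and scalar multiplication.
  Algebras need not have a unit: the field \<open>one\<close> of these records is never used, and it need
  not belong to the carrier.
\<close>

definition algebra_ideal :: "('k::field, 'a) module \<Rightarrow> 'a set \<Rightarrow> bool" where
  "algebra_ideal A I \<longleftrightarrow>
     additive_subgroup I A \<and>
     (\<forall>c. \<forall>x\<in>I. c \<odot>\<^bsub>A\<^esub> x \<in> I) \<and>
     (\<forall>a\<in>carrier A. \<forall>x\<in>I. a \<otimes>\<^bsub>A\<^esub> x \<in> I \<and> x \<otimes>\<^bsub>A\<^esub> a \<in> I)"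

definition generated_ideal :: "('k::field, 'a) module \<Rightarrow> 'a set \<Rightarrow> 'a set" where
  "generated_ideal A S = \<Inter>{I. algebra_ideal A I \<and> S \<subseteq> I}"

definition quotient_algebra :: "('k::field, 'a) module \<Rightarrow> 'a set \<Rightarrow> ('k, 'a set) module" where
  "quotient_algebra A I =
     \<lparr>carrier = carrier (A Quot I),
      mult = mult (A Quot I),
      one = one (A Quot I),
      zero = zero (A Quot I),
      add = add (A Quot I),
      smult = (\<lambda>c X. \<Union>x\<in>X. I +>\<^bsub>A\<^esub> (c \<odot>\<^bsub>A\<^esub> x))\<rparr>"

definition algebra_iso :: "('k::field, 'a) module \<Rightarrow> ('k, 'b) module \<Rightarrow> bool" where
  "algebra_iso A B \<longleftrightarrow>
     (\<exists>\<phi>. bij_betw \<phi> (carrier A) (carrier B) \<and>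
          (\<forall>x\<in>carrier A. \<forall>y\<in>carrier A. \<phi> (x \<oplus>\<^bsub>A\<^esub> y) = \<phi> x \<oplus>\<^bsub>B\<^esub> \<phi> y) \<and>
          (\<forall>x\<in>carrier A. \<forall>y\<in>carrier A. \<phi> (x \<otimes>\<^bsub>A\<^esub> y) = \<phi> x \<otimes>\<^bsub>B\<^esub> \<phi> y) \<and>
          (\<forall>c. \<forall>x\<in>carrier A. \<phi> (c \<odot>\<^bsub>A\<^esub> x) = c \<odot>\<^bsub>B\<^esub> \<phi> x))"

text \<open>
  \<open>I\<close> is the internal direct sum of the \<open>M n\<close>: the canonical map from the external direct sum
  (families with finitely many nonzero members) to \<open>I\<close> is bijective.
\<close>

definition direct_sum_of :: "('k::field, 'a) module \<Rightarrow> (int \<Rightarrow> 'a set) \<Rightarrow> 'a set \<Rightarrow> bool" where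
  "direct_sum_of A M I \<longleftrightarrow>
     bij_betw (\<lambda>f. \<Oplus>\<^bsub>A\<^esub>n\<in>{n. f n \<noteq> \<zero>\<^bsub>A\<^esub>}. f n)
       {f. (\<forall>n. f n \<in> M n) \<and> finite {n. f n \<noteq> \<zero>\<^bsub>A\<^esub>}} I"


section \<open>Free associative algebras\<close>

text \<open>
  Words form a monoid under concatenation. It is written additively so that \<open>*\<close> on finitely
  supported functions \<open>'g list \<Rightarrow>\<^sub>0 'k\<close> is the convolution product, i.e. the multiplication of
  noncommutative polynomials.
\<close>

instantiation list :: (type) monoid_add
begin

definition zero_list :: "'a list" where "0 = []"
definition plus_list :: "'a list \<Rightarrow> 'a list \<Rightarrow> 'a list" where "xs + ys = xs @ ys"

instance by standard (simp_all add: zero_list_def plus_list_def)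

end

text \<open>The free algebra is not unital: its elements have no constant term.\<close>

definition free_algebra :: "'g set \<Rightarrow> ('k::field, 'g list \<Rightarrow>\<^sub>0 'k) module" where
  "free_algebra X =
     \<lparr>carrier = {p. \<forall>w\<in>Poly_Mapping.keys p. w \<noteq> [] \<and> set w \<subseteq> X},
      mult = (*),
      one = 1,
      zero = 0,
      add = (+),
      smult = (\<lambda>c p. Poly_Mapping.single [] c * p)\<rparr>"


section \<open>Leavitt path algebras\<close>

text \<open>
  A graph is a \<open>wf_digraph\<close> \<open>E\<close>, with \<open>verts E\<close>, \<open>arcs E\<close>, \<open>tail E\<close>, \<open>head E\<close> in the roles of
  \<open>E\<^sup>0\<close>, \<open>E\<^sup>1\<close>, source, range. Loops, multiple edges and infinitely many vertices or edges are
  allowed.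
\<close>

definition regular_verts :: "('v, 'e) pre_digraph \<Rightarrow> 'v set" where
  "regular_verts E = {v \<in> verts E. out_arcs E v \<noteq> {} \<and> finite (out_arcs E v)}"

text \<open>\<open>Ghost e\<close> stands for \<open>e\<^sup>*\<close>.\<close>

datatype ('v, 'e) lpa_gen = Vertex 'v | Edge 'e | Ghost 'e

definition lpa_gens :: "('v, 'e) pre_digraph \<Rightarrow> ('v, 'e) lpa_gen set" where
  "lpa_gens E = Vertex ` verts E \<union> Edge ` arcs E \<union> Ghost ` arcs E"

abbreviation vx :: "'v \<Rightarrow> (('v, 'e) lpa_gen list \<Rightarrow>\<^sub>0 'k::field)" where
  "vx v \<equiv> Poly_Mapping.single [Vertex v] 1"

abbreviation ed :: "'e \<Rightarrow> (('v, 'e) lpa_gen list \<Rightarrow>\<^sub>0 'k::field)" where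
  "ed e \<equiv> Poly_Mapping.single [Edge e] 1"

abbreviation gh :: "'e \<Rightarrow> (('v, 'e) lpa_gen list \<Rightarrow>\<^sub>0 'k::field)" where
  "gh e \<equiv> Poly_Mapping.single [Ghost e] 1"

definition lpa_relators ::
  "('v, 'e) pre_digraph \<Rightarrow> (('v, 'e) lpa_gen list \<Rightarrow>\<^sub>0 'k::field) set" where
  "lpa_relators E =
     {vx v * vx w - (if v = w then vx v else 0) |v w. v \<in> verts E \<and> w \<in> verts E}
   \<union> {vx (tail E e) * ed e - ed e |e. e \<in> arcs E}
   \<union> {ed e * vx (head E e) - ed e |e. e \<in> arcs E}
   \<union> {vx (head E e) * gh e - gh e |e. e \<in> arcs E}
   \<union> {gh e * vx (tail E e) - gh e |e. e \<in> arcs E}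
   \<union> {gh e * ed f - (if e = f then vx (head E e) else 0) |e f. e \<in> arcs E \<and> f \<in> arcs E}
   \<union> {vx v - (\<Sum>e\<in>out_arcs E v. ed e * gh e) |v. v \<in> regular_verts E}"

definition lpa_ideal ::
  "('v, 'e) pre_digraph \<Rightarrow> (('v, 'e) lpa_gen list \<Rightarrow>\<^sub>0 'k::field) set" where
  "lpa_ideal E = generated_ideal (free_algebra (lpa_gens E)) (lpa_relators E)"

definition leavitt_path_algebra ::
  "('v, 'e) pre_digraph \<Rightarrow> ('k::field, (('v, 'e) lpa_gen list \<Rightarrow>\<^sub>0 'k) set) module" where
  "leavitt_path_algebra E = quotient_algebra (free_algebra (lpa_gens E)) (lpa_ideal E)"


section \<open>Grading\<close>

fun gen_degree :: "('v, 'e) lpa_gen \<Rightarrow> int" where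
  "gen_degree (Vertex v) = 0"
| "gen_degree (Edge e) = 1"
| "gen_degree (Ghost e) = -1"

definition word_degree :: "('v, 'e) lpa_gen list \<Rightarrow> int" where
  "word_degree w = (\<Sum>g\<leftarrow>w. gen_degree g)"

definition lpa_component ::
  "('v, 'e) pre_digraph \<Rightarrow> int \<Rightarrow> (('v, 'e) lpa_gen list \<Rightarrow>\<^sub>0 'k::field) set set" where
  "lpa_component E n =
     {lpa_ideal E +>\<^bsub>free_algebra (lpa_gens E)\<^esub> p |p.
        p \<in> carrier (free_algebra (lpa_gens E)) \<and>
        (\<forall>w\<in>Poly_Mapping.keys p. word_degree w = n)}"

definition graded_ideal ::
  "('v, 'e) pre_digraph \<Rightarrow> (('v, 'e) lpa_gen list \<Rightarrow>\<^sub>0 'k::field) set set \<Rightarrow> bool" where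
  "graded_ideal E I \<longleftrightarrow>
     algebra_ideal (leavitt_path_algebra E) I \<and>
     direct_sum_of (leavitt_path_algebra E) (\<lambda>n. I \<inter> lpa_component E n) I"

end

theory Submission
  imports Defs "Graph_Theory.Arc_Walk"
begin

text \<open>
  Let \<open>H\<close> be the set of vertices in the graded ideal and, for a vertex \<open>w\<close>, let \<open>q w\<close> be \<open>w\<close> minus
  the sum of \<open>e e\<^sup>*\<close> over the edges from \<open>w\<close> that do not end in \<open>H\<close>. Let \<open>W\<close> consist of \<open>H\<close> and of
  those infinite emitters \<open>w\<close> for which this sum is finite and \<open>q w\<close> lies in the ideal. A homogeneous
  element \<open>x\<close> of the ideal is a combination of elements \<open>\<alpha> q w \<beta>\<^sup>*\<close> with \<open>w \<in> W\<close>, by induction on the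
  length of the ghost paths in \<open>x\<close>: the elements \<open>x e\<close> have shorter ghost paths, and what remains of
  \<open>x\<close> after subtracting finitely many \<open>x e e\<^sup>*\<close> is a combination of real paths times
  \<open>u - \<Sum> e e\<^sup>*\<close>, where distinct paths of the same weight can be told apart.

  Hence the ideal is the image of the Leavitt path algebra of the hedgehog graph of Ruiz and
  Tomforde. The same reduction, applied to the kernel of that map with the length of quills as
  weight, shows that the kernel is zero because it contains no vertex. The computations take place
  in rings of linear operators that represent the quotient algebras faithfully.
\<close>


section \<open>Evaluation of noncommutative polynomials\<close>

text \<open>Three obstacles shape the proof. Without a unit, the algebras are cosets over a carrier;
  a faithful image in a type of class \<open>ring_1\<close> makes equational reasoning possible.
  Next, the vertices of the ideal do not generate it: at an infinite emitter no relation writes the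
  vertex as a sum over its edges, so \<open>q w\<close> may lie in the ideal although it does not
  come from \<open>H\<close>. Finally, the map from the hedgehog algebra sends the edge of a quill
  \<alpha> to an element of degree \<open>length \<alpha>\<close>, so it does not respect the
  grading in which every hedgehog edge has degree 1. The reduction is therefore carried out for an
  arbitrary positive weight on edges. Positivity keeps paths apart: of two distinct paths with equal
  weight neither is a prefix of the other, so the ghost of one annihilates the other. To see that no
  vertex of the hedgehog is killed, it must be known that vertices of a Leavitt path algebra are
  nonzero, which takes a concrete representation.\<close>

lemma poly_mapping_monomial_sum:
  fixes p :: "'b \<Rightarrow>\<^sub>0 'k::comm_monoid_add"
  shows "p = (\<Sum>w\<in>Poly_Mapping.keys p. Poly_Mapping.single w (Poly_Mapping.lookup p w))"
proof (rule poly_mapping_eqI)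
  fix k
  have "(\<Sum>w\<in>Poly_Mapping.keys p. Poly_Mapping.lookup (Poly_Mapping.single w (Poly_Mapping.lookup p w)) k)
      = (\<Sum>w\<in>Poly_Mapping.keys p. if w = k then Poly_Mapping.lookup p k else 0)"
    by (intro sum.cong) (auto simp: lookup_single when_def)
  also have "\<dots> = Poly_Mapping.lookup p k"
    by (simp add: in_keys_iff)
  finally show "Poly_Mapping.lookup p k = Poly_Mapping.lookup
      (\<Sum>w\<in>Poly_Mapping.keys p. Poly_Mapping.single w (Poly_Mapping.lookup p w)) k"
    by (simp add: lookup_sum)
qed

lemma poly_mapping_monomial_induct [case_names zero add]:
  fixes p :: "'b \<Rightarrow>\<^sub>0 'k::comm_monoid_add"
  assumes "P 0"
    and "\<And>w c q. w \<in> Poly_Mapping.keys p \<Longrightarrow> P q \<Longrightarrow> P (Poly_Mapping.single w c + q)"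
  shows "P p"
proof -
  have "P (\<Sum>w\<in>W. Poly_Mapping.single w (Poly_Mapping.lookup p w))"
    if "finite W" "W \<subseteq> Poly_Mapping.keys p" for W
    using that by (induction W) (auto simp: assms)
  from this[of "Poly_Mapping.keys p"] show ?thesis
    using poly_mapping_monomial_sum[of p] by simp
qed

text \<open>A K-algebra structure on a unital ring, given by a homomorphism from the field to the
  centre. Elements live in a type of class \<open>ring_1\<close>, so calculations carry no carrier
  conditions.\<close>

locale central_scalars =
  fixes sc :: "'k::field \<Rightarrow> 'a::ring_1"
  assumes sc_0 [simp]: "sc 0 = 0"
    and sc_1 [simp]: "sc 1 = 1"
    and sc_add: "sc (a + b) = sc a + sc b"
    and sc_mult: "sc (a * b) = sc a * sc b"
    and sc_commute: "sc c * x = x * sc c"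
begin

lemma sc_uminus: "sc (- a) = - sc a"
  using sc_add[of a "- a"] by (simp add: eq_neg_iff_add_eq_0 add.commute)

lemma sc_left_commute: "x * (sc c * y) = sc c * (x * y)"
  by (metis mult.assoc sc_commute)

lemma sc_inverse_left: "c \<noteq> 0 \<Longrightarrow> sc (inverse c) * (sc c * x) = x"
  by (simp add: mult.assoc[symmetric] sc_mult[symmetric])

definition ev :: "('g \<Rightarrow> 'a) \<Rightarrow> ('g list \<Rightarrow>\<^sub>0 'k) \<Rightarrow> 'a" where
  "ev g p = (\<Sum>w\<in>Poly_Mapping.keys p. sc (Poly_Mapping.lookup p w) * prod_list (map g w))"

lemma ev_superset:
  assumes "finite W" "Poly_Mapping.keys p \<subseteq> W"
  shows "ev g p = (\<Sum>w\<in>W. sc (Poly_Mapping.lookup p w) * prod_list (map g w))"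
  unfolding ev_def using assms by (intro sum.mono_neutral_left) (auto simp: in_keys_iff)

lemma ev_0 [simp]: "ev g 0 = 0"
  by (simp add: ev_def)

lemma ev_single [simp]: "ev g (Poly_Mapping.single w c) = sc c * prod_list (map g w)"
  by (subst ev_superset[of "{w}"]) auto

lemma ev_add: "ev g (p + q) = ev g p + ev g q"
proof -
  let ?W = "Poly_Mapping.keys p \<union> Poly_Mapping.keys q"
  have "ev g (p + q) = (\<Sum>w\<in>?W. sc (Poly_Mapping.lookup (p + q) w) * prod_list (map g w))"
    using keys_add[of p q] by (intro ev_superset) auto
  also have "\<dots> = ev g p + ev g q"
    by (subst (1 2) ev_superset[of ?W]) (auto simp: lookup_add sc_add distrib_right sum.distrib)
  finally show ?thesis .
qed

lemma ev_uminus: "ev g (- p) = - ev g p"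
  using ev_add[of g p "- p"] by (simp add: eq_neg_iff_add_eq_0 add.commute)

lemma ev_diff: "ev g (p - q) = ev g p - ev g q"
  using ev_add[of g p "- q"] by (simp add: ev_uminus)

lemma ev_sum: "ev g (sum f A) = (\<Sum>a\<in>A. ev g (f a))"
  by (induction A rule: infinite_finite_induct) (auto simp: ev_add)

lemma ev_mult: "ev g (p * q) = ev g p * ev g q"
proof -
  have single: "ev g (Poly_Mapping.single w c * q) = sc c * prod_list (map g w) * ev g q" for w c
  proof (induction q rule: poly_mapping_monomial_induct)
    case (add v d q)
    have "sc (c * d) * (prod_list (map g w) * prod_list (map g v))
        = sc c * prod_list (map g w) * (sc d * prod_list (map g v))"
      by (metis mult.assoc sc_mult sc_left_commute)
    with add show ?case
      by (simp add: distrib_left mult_single plus_list_def ev_add)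
  qed simp
  show ?thesis
    by (induction p rule: poly_mapping_monomial_induct)
      (simp_all add: distrib_right ev_add single)
qed

text \<open>Universal property: letters and scalars generate the polynomials. The condition on
  constants is what makes the ring homomorphism K-linear.\<close>

lemma ev_unique:
  assumes "\<And>p q. h (p + q) = h p + h q" "\<And>p q. h (p * q) = h p * h q" "h 1 = 1"
    and "\<And>c. h (Poly_Mapping.single [] c) = sc c"
  shows "h p = ev (\<lambda>x. h (Poly_Mapping.single [x] 1)) p"
proof -
  have h0: "h 0 = 0"
    using assms(1)[of 0 0] by simp
  define g where "g = (\<lambda>x. h (Poly_Mapping.single [x] 1))"
  have word: "h (Poly_Mapping.single w 1) = prod_list (map g w)" for w
  proof (induction w)
    case Nil
    then show ?case using assms(4)[of 1] by simp
  next
    case (Cons x w)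
    have "Poly_Mapping.single (x # w) 1 = Poly_Mapping.single [x] 1 * (Poly_Mapping.single w 1 :: _ \<Rightarrow>\<^sub>0 'k)"
      by (simp add: mult_single plus_list_def)
    with Cons show ?case by (simp add: assms(2) g_def)
  qed
  have single: "h (Poly_Mapping.single w c) = ev g (Poly_Mapping.single w c)" for w c
  proof -
    have "h (Poly_Mapping.single [] c * Poly_Mapping.single w 1) = sc c * prod_list (map g w)"
      by (simp only: assms(2,4) word)
    then show ?thesis by (simp add: mult_single plus_list_def)
  qed
  show ?thesis unfolding g_def[symmetric]
    by (induction p rule: poly_mapping_monomial_induct) (simp_all only: h0 assms(1) ev_add ev_0 single)
qed

end

lemma single_Nil_commute:
  "Poly_Mapping.single [] c * p = p * Poly_Mapping.single [] (c :: 'k::field)"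
  by (induction p rule: poly_mapping_monomial_induct)
    (simp_all add: distrib_left distrib_right mult_single plus_list_def mult.commute)

interpretation poly_scalars: central_scalars "Poly_Mapping.single [] :: 'k::field \<Rightarrow> 'g list \<Rightarrow>\<^sub>0 'k"
  by standard
    (simp_all add: single_add mult_single single_Nil_commute zero_list_def[symmetric]
      del: single_one flip: single_one, simp_all add: zero_list_def plus_list_def single_Nil_commute)

text \<open>A concatenation is empty only if both words are. Hence acting by the constant term is a
  representation, which is used below on the subspace \<open>V\<close>.\<close>

lemma lookup_Nil_mult:
  "Poly_Mapping.lookup (p * q) [] = Poly_Mapping.lookup p [] * Poly_Mapping.lookup q []"
  for p q :: "'g list \<Rightarrow>\<^sub>0 'k::field"
proof -
  have single: "Poly_Mapping.lookup (Poly_Mapping.single w c * q) []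
      = Poly_Mapping.lookup (Poly_Mapping.single w c) [] * Poly_Mapping.lookup q []" for w c
    by (induction q rule: poly_mapping_monomial_induct)
      (auto simp: distrib_left mult_single plus_list_def lookup_add lookup_single when_def)
  show ?thesis
    by (induction p rule: poly_mapping_monomial_induct)
      (auto simp: distrib_right lookup_add single)
qed


section \<open>Rings of linear operators\<close>

abbreviation scale :: "'k::field \<Rightarrow> ('b \<Rightarrow>\<^sub>0 'k) \<Rightarrow> ('b \<Rightarrow>\<^sub>0 'k)" where
  "scale c \<equiv> Poly_Mapping.map ((*) c)"

lemma lookup_scale [simp]: "Poly_Mapping.lookup (scale c p) b = c * Poly_Mapping.lookup p b"
  by (simp add: map.rep_eq when_def)

lemma scale_eq_mult: "scale c p = Poly_Mapping.single [] c * p"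
  by (simp add: mult_map_scale_conv_mult zero_list_def)

interpretation pm: vector_space scale
  by standard (auto intro!: poly_mapping_eqI simp: lookup_add algebra_simps)

text \<open>Linear endomorphisms of the space with basis \<open>'b\<close> form a type of class
  \<open>ring_1\<close> that is large enough to hold a faithful image of a quotient of the free
  algebra.\<close>

typedef (overloaded) ('b, 'k::field) linop =
  "{f :: ('b \<Rightarrow>\<^sub>0 'k) \<Rightarrow> ('b \<Rightarrow>\<^sub>0 'k). (\<forall>x y. f (x + y) = f x + f y) \<and> (\<forall>c x. f (scale c x) = scale c (f x))}"
  morphisms app Linop
  by (rule exI[of _ "\<lambda>x. x"]) simp

setup_lifting type_definition_linop

instantiation linop :: (type, field) ring_1
begin

lift_definition zero_linop :: "('a, 'b) linop" is "\<lambda>x. 0" by (simp add: pm.scale_zero_right)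
lift_definition one_linop :: "('a, 'b) linop" is "\<lambda>x. x" by simp
lift_definition plus_linop :: "('a, 'b) linop \<Rightarrow> ('a, 'b) linop \<Rightarrow> ('a, 'b) linop" is "\<lambda>f g x. f x + g x"
  by (simp add: algebra_simps pm.scale_right_distrib)
lift_definition uminus_linop :: "('a, 'b) linop \<Rightarrow> ('a, 'b) linop" is "\<lambda>f x. - f x"
  by (simp add: pm.scale_minus_right)
lift_definition minus_linop :: "('a, 'b) linop \<Rightarrow> ('a, 'b) linop \<Rightarrow> ('a, 'b) linop" is "\<lambda>f g x. f x - g x"
  by (simp add: algebra_simps pm.scale_right_diff_distrib)
lift_definition times_linop :: "('a, 'b) linop \<Rightarrow> ('a, 'b) linop \<Rightarrow> ('a, 'b) linop" is "\<lambda>f g x. f (g x)"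
  by simp

instance
proof
  show "(0 :: ('a, 'b) linop) \<noteq> 1"
  proof
    assume "(0 :: ('a, 'b) linop) = 1"
    then have "app (0 :: ('a, 'b) linop) (Poly_Mapping.single undefined 1) = app 1 (Poly_Mapping.single undefined 1)"
      by simp
    then have "Poly_Mapping.lookup (Poly_Mapping.single undefined (1 :: 'b)) (undefined :: 'a)
        = Poly_Mapping.lookup (0 :: 'a \<Rightarrow>\<^sub>0 'b) undefined"
      by (simp only: zero_linop.rep_eq one_linop.rep_eq)
    then show False by simp
  qed
qed (transfer; simp add: algebra_simps fun_eq_iff)+

end

lift_definition scalar_op :: "'k \<Rightarrow> ('b, 'k::field) linop" is scale
  by (simp add: pm.scale_right_distrib mult.commute)

interpretation linop: central_scalars scalar_op
  by standard (transfer; simp add: pm.scale_left_distrib fun_eq_iff)+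

lemma linop_eqI: "(\<And>x. app f x = app g x) \<Longrightarrow> f = g"
  by (simp add: app_inject[symmetric] fun_eq_iff)

section \<open>Quotients of the free algebra\<close>

text \<open>A basis of \<open>V\<close> is extended to the whole space; its members are sent to 0
  and the additional basis vectors are fixed. The complement depends on this choice.\<close>

lemma (in vector_space) subspace_kernel_of_projection:
  assumes "subspace V"
  obtains \<pi> where "\<And>x y. \<pi> (x + y) = \<pi> x + \<pi> y" "\<And>c x. \<pi> (scale c x) = scale c (\<pi> x)"
    "\<And>x. \<pi> (\<pi> x) = \<pi> x" "\<And>x. \<pi> x = 0 \<longleftrightarrow> x \<in> V"
proof -
  interpret vector_space_pair scale scale ..
  obtain B where B: "B \<subseteq> V" "independent B" "V \<subseteq> span B"
    using maximal_independent_subset by blast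
  have spB: "span B = V"
    using B assms by (metis span_eq_iff span_mono subset_antisym)
  define C where "C = extend_basis B"
  have C: "B \<subseteq> C" "independent C" "span C = UNIV"
    using B by (auto simp: C_def extend_basis_superset independent_extend_basis)
  obtain \<pi> where lin: "Vector_Spaces.linear scale scale \<pi>" and \<pi>: "\<And>b. b \<in> C \<Longrightarrow> \<pi> b = (if b \<in> B then 0 else b)"
    using linear_independent_extend[OF C(2), of "\<lambda>b. if b \<in> B then 0 else b"] by auto
  have \<pi>B: "\<pi> x = 0" if "x \<in> span B" for x
    by (rule linear_eq_0_on_span[OF lin _ that]) (use \<pi> C(1) in auto)
  have \<pi>C: "\<pi> x = x" if "x \<in> span (C - B)" for x
    using linear_eq_on_span[OF lin module_hom_id _ that] \<pi> by (auto simp: id_def)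
  have decomp: "\<exists>x1 x2. x = x1 + x2 \<and> x1 \<in> span B \<and> x2 \<in> span (C - B)" for x
  proof -
    have "x \<in> span (B \<union> (C - B))"
      using C by (simp add: Un_absorb1)
    then show ?thesis unfolding span_Un by auto
  qed
  show thesis
  proof
    show "\<pi> (x + y) = \<pi> x + \<pi> y" for x y
      using lin by (rule linear_add)
    show "\<pi> (scale c x) = scale c (\<pi> x)" for c x
      using lin by (rule linear_scale)
    show "\<pi> (\<pi> x) = \<pi> x" for x
      using decomp[of x] by (auto simp: linear_add[OF lin] \<pi>B \<pi>C)
    show "\<pi> x = 0 \<longleftrightarrow> x \<in> V" for x
      using decomp[of x] spB \<pi>B by (auto simp: linear_add[OF lin] \<pi>C)
  qed
qed

text \<open>
  The endomorphism attached to \<open>p\<close> is left multiplication on a complement of \<open>V\<close>. On \<open>V\<close> itself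
  it is multiplication by the constant term, which makes the representation unital.
\<close>

lemma ideal_kernel_of_representation:
  fixes V :: "('g list \<Rightarrow>\<^sub>0 'k::field) set"
  assumes V0: "0 \<in> V" and V_add: "\<And>x y. x \<in> V \<Longrightarrow> y \<in> V \<Longrightarrow> x + y \<in> V"
    and ideal: "\<And>a x. x \<in> V \<Longrightarrow> a * x \<in> V" "\<And>a x. x \<in> V \<Longrightarrow> x * a \<in> V"
    and const: "\<And>x. x \<in> V \<Longrightarrow> Poly_Mapping.lookup x [] = 0"
  obtains \<psi> :: "('g list \<Rightarrow>\<^sub>0 'k) \<Rightarrow> ('g list, 'k) linop"
  where "\<And>p q. \<psi> (p + q) = \<psi> p + \<psi> q" "\<And>p q. \<psi> (p * q) = \<psi> p * \<psi> q" "\<psi> 1 = 1"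
    "\<And>c. \<psi> (Poly_Mapping.single [] c) = scalar_op c"
    "\<And>p. \<psi> p = 0 \<longleftrightarrow> p \<in> V"
proof -
  have "pm.subspace V"
    by (auto intro!: pm.subspaceI V0 V_add simp: scale_eq_mult ideal)
  then obtain \<pi> where \<pi>: "\<And>x y. \<pi> (x + y) = \<pi> x + \<pi> y" "\<And>c x. \<pi> (scale c x) = scale c (\<pi> x)"
    "\<And>x. \<pi> (\<pi> x) = \<pi> x" "\<And>x. \<pi> x = 0 \<longleftrightarrow> x \<in> V"
    using pm.subspace_kernel_of_projection by blast
  have \<pi>_diff: "\<pi> (x - y) = \<pi> x - \<pi> y" for x y
    using \<pi>(1)[of "x - y" y] by (simp add: algebra_simps)
  have "x - \<pi> x \<in> V" for x
    by (simp add: \<pi>(3) \<pi>_diff flip: \<pi>(4))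
  \<comment> \<open>Replacing \<open>x\<close> by its component in the complement changes
    \<open>a * x\<close> only by an element of the left ideal \<open>V\<close>.\<close>
  then have \<pi>_mult: "\<pi> (a * \<pi> x) = \<pi> (a * x)" for a x
    using ideal(1)[of "x - \<pi> x" a] by (simp add: right_diff_distrib \<pi>_diff flip: \<pi>(4))
  define F where "F p x = \<pi> (p * \<pi> x) + scale (Poly_Mapping.lookup p []) (x - \<pi> x)" for p x
  have scale_comm: "scale c (p * x) = p * scale c x" for c and p x :: "'g list \<Rightarrow>\<^sub>0 'k"
    by (simp add: scale_eq_mult poly_scalars.sc_left_commute)
  define \<psi> where "\<psi> p = Linop (F p)" for p
  have app: "app (\<psi> p) = F p" for p
    unfolding \<psi>_def
    by (rule Linop_inverse)
      (auto simp: F_def \<pi> pm.scale_right_distrib pm.scale_right_diff_distrib algebra_simps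
        scale_comm[symmetric] mult.commute)
  have \<pi>F: "\<pi> (F p x) = \<pi> (p * \<pi> x)" for p x
    by (simp add: F_def \<pi> \<pi>_diff)
  show thesis
  proof
    show "\<psi> (p + q) = \<psi> p + \<psi> q" for p q
      by (rule linop_eqI)
        (simp add: app plus_linop.rep_eq F_def distrib_right \<pi> lookup_add pm.scale_left_distrib)
    show "\<psi> (p * q) = \<psi> p * \<psi> q" for p q
    proof (rule linop_eqI)
      fix x
      have "F p (F q x) = \<pi> (p * \<pi> (F q x)) + scale (Poly_Mapping.lookup p []) (F q x - \<pi> (F q x))"
        by (simp add: F_def)
      also have "F q x - \<pi> (F q x) = scale (Poly_Mapping.lookup q []) (x - \<pi> x)"
        unfolding \<pi>F by (simp add: F_def)
      finally have 1: "F p (F q x) = \<pi> (p * \<pi> (F q x)) +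
          scale (Poly_Mapping.lookup p []) (scale (Poly_Mapping.lookup q []) (x - \<pi> x))" .
      have "\<pi> (p * \<pi> (F q x)) = \<pi> (p * \<pi> (q * \<pi> x))"
        by (simp only: \<pi>F)
      also have "\<dots> = \<pi> (p * (q * x))"
        by (simp only: \<pi>_mult)
      also have "\<dots> = \<pi> (p * q * \<pi> x)"
        by (simp only: \<pi>_mult) (simp only: mult.assoc)
      finally have 2: "\<pi> (p * \<pi> (F q x)) = \<pi> (p * q * \<pi> x)" .
      show "app (\<psi> (p * q)) x = app (\<psi> p * \<psi> q) x"
        by (simp only: app times_linop.rep_eq lookup_Nil_mult pm.scale_scale 1 2 F_def[of "p * q"])
    qed
    show single: "\<psi> (Poly_Mapping.single [] c) = scalar_op c" for c
      by (rule linop_eqI)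
        (simp add: app F_def scalar_op.rep_eq \<pi> pm.scale_right_diff_distrib flip: scale_eq_mult)
    show "\<psi> 1 = 1"
      using single[of 1] by simp
    show "\<psi> p = 0 \<longleftrightarrow> p \<in> V" for p
    proof
      assume "\<psi> p = 0"
      \<comment> \<open>The polynomial 1 detects the kernel, because \<open>F p 1\<close> projects
        to \<open>\<pi> p\<close>.\<close>
      then have "\<pi> (F p 1) = \<pi> 0"
        by (metis app zero_linop.rep_eq)
      then show "p \<in> V"
        by (simp add: \<pi>F \<pi>_mult \<pi>(4)[THEN iffD2, OF V0] \<pi>(4))
    next
      assume p: "p \<in> V"
      show "\<psi> p = 0"
        by (rule linop_eqI)
          (simp add: app F_def zero_linop.rep_eq const[OF p] \<pi>(4) ideal[OF p] V0)
    qed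
  qed
qed

lemma free_algebra_simps [simp]:
  "carrier (free_algebra X) = {p. \<forall>w\<in>Poly_Mapping.keys p. w \<noteq> [] \<and> set w \<subseteq> X}"
  "x \<otimes>\<^bsub>free_algebra X\<^esub> y = x * y"
  "x \<oplus>\<^bsub>free_algebra X\<^esub> y = x + y"
  "\<zero>\<^bsub>free_algebra X\<^esub> = 0"
  "c \<odot>\<^bsub>free_algebra X\<^esub> x = Poly_Mapping.single [] c * x"
  by (simp_all add: free_algebra_def)

lemma keys_scale_subset: "Poly_Mapping.keys (Poly_Mapping.single [] c * p) \<subseteq> Poly_Mapping.keys p"
  for p :: "'g list \<Rightarrow>\<^sub>0 'k::field"
  by (auto simp: in_keys_iff simp flip: scale_eq_mult)

lemma keys_uminus: "Poly_Mapping.keys (- p) = Poly_Mapping.keys p"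
  for p :: "'b \<Rightarrow>\<^sub>0 'k::ab_group_add"
  by (auto simp: in_keys_iff)

lemma free_algebra_carrier_closed:
  fixes p q :: "'g list \<Rightarrow>\<^sub>0 'k::field"
  assumes "p \<in> carrier (free_algebra X)"
  shows "q \<in> carrier (free_algebra X) \<Longrightarrow> p + q \<in> carrier (free_algebra X)"
    "q \<in> carrier (free_algebra X) \<Longrightarrow> p * q \<in> carrier (free_algebra X)"
    "Poly_Mapping.single [] c * p \<in> carrier (free_algebra X)"
    "- p \<in> carrier (free_algebra X)"
    "q \<in> carrier (free_algebra X) \<Longrightarrow> p - q \<in> carrier (free_algebra X)"
proof -
  show add: "p + q \<in> carrier (free_algebra X)" if "q \<in> carrier (free_algebra X)" for q
    using assms that keys_add[of p q] by fastforce
  show "p * q \<in> carrier (free_algebra X)" if "q \<in> carrier (free_algebra X)"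
    using assms that keys_mult[of p q] by (fastforce simp: plus_list_def)
  show "Poly_Mapping.single [] c * p \<in> carrier (free_algebra X)"
    using assms keys_scale_subset[of c p] by auto
  show "- p \<in> carrier (free_algebra X)"
    using assms by (simp add: keys_uminus)
  show "p - q \<in> carrier (free_algebra X)" if "q \<in> carrier (free_algebra X)"
    unfolding diff_conv_add_uminus by (rule add) (use that keys_uminus[of q] in simp)
qed

lemma abelian_group_free_algebra: "abelian_group (free_algebra X :: ('k::field, 'g list \<Rightarrow>\<^sub>0 'k) module)"
proof (rule abelian_groupI)
  fix x :: "'g list \<Rightarrow>\<^sub>0 'k"
  assume "x \<in> carrier (free_algebra X)"
  then show "\<exists>y\<in>carrier (free_algebra X). y \<oplus>\<^bsub>free_algebra X\<^esub> x = \<zero>\<^bsub>free_algebra X\<^esub>"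
    by (intro bexI[of _ "- x"] free_algebra_carrier_closed) auto
next
  fix x y :: "'g list \<Rightarrow>\<^sub>0 'k"
  assume "x \<in> carrier (free_algebra X)" "y \<in> carrier (free_algebra X)"
  then show "x \<oplus>\<^bsub>free_algebra X\<^esub> y \<in> carrier (free_algebra X)"
    unfolding free_algebra_simps(3) by (rule free_algebra_carrier_closed)
qed (simp_all add: algebra_simps)

lemma a_inv_free_algebra:
  fixes x :: "'g list \<Rightarrow>\<^sub>0 'k::field"
  assumes "x \<in> carrier (free_algebra X)"
  shows "\<ominus>\<^bsub>free_algebra X\<^esub> x = - x"
  using assms free_algebra_carrier_closed(4)[OF assms]
  by (intro abelian_group.minus_equality[OF abelian_group_free_algebra]) simp_all

lemma algebra_ideal_free_algebra_iff:
  "algebra_ideal (free_algebra X) I \<longleftrightarrow>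
     I \<subseteq> carrier (free_algebra X) \<and> 0 \<in> I \<and> (\<forall>x\<in>I. \<forall>y\<in>I. x + y \<in> I) \<and>
     (\<forall>c. \<forall>x\<in>I. Poly_Mapping.single [] c * x \<in> I) \<and>
     (\<forall>a\<in>carrier (free_algebra X). \<forall>x\<in>I. a * x \<in> I \<and> x * a \<in> I)"
  (is "?A \<longleftrightarrow> ?B")
  for I :: "('g list \<Rightarrow>\<^sub>0 'k::field) set"
proof
  assume A: ?A
  then have "additive_subgroup I (free_algebra X)"
    by (simp add: algebra_ideal_def)
  then have "I \<subseteq> carrier (free_algebra X)" "0 \<in> I" "\<forall>x\<in>I. \<forall>y\<in>I. x + y \<in> I"
    using additive_subgroup.a_subset additive_subgroup.zero_closed additive_subgroup.a_closed
    by (metis, metis free_algebra_simps(4), metis free_algebra_simps(3))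
  with A show ?B
    by (simp add: algebra_ideal_def del: free_algebra_simps(1))
next
  assume B: ?B
  have "- x \<in> I" if "x \<in> I" for x
  proof -
    have "Poly_Mapping.single [] (- 1) * x \<in> I"
      using B that by blast
    then show ?thesis
      by (simp add: poly_scalars.sc_uminus)
  qed
  then have "a_inv (free_algebra X) x \<in> I" if "x \<in> I" for x
    using a_inv_free_algebra that B by (metis subsetD)
  then have "additive_subgroup I (free_algebra X)"
    using B by (auto intro!: additive_subgroup.intro subgroup.intro simp: a_inv_def simp del: free_algebra_simps(1))
  with B show ?A
    by (simp add: algebra_ideal_def del: free_algebra_simps(1))
qed

lemma generated_ideal:
  fixes S :: "('g list \<Rightarrow>\<^sub>0 'k::field) set"
  assumes "S \<subseteq> carrier (free_algebra X)"
  shows "algebra_ideal (free_algebra X) (generated_ideal (free_algebra X) S)"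
    and "S \<subseteq> generated_ideal (free_algebra X) S"
proof -
  have "algebra_ideal (free_algebra X) (carrier (free_algebra X) :: ('g list \<Rightarrow>\<^sub>0 'k) set)"
    unfolding algebra_ideal_free_algebra_iff
    by (intro conjI ballI allI subset_refl free_algebra_carrier_closed; (assumption | simp))
  then have "generated_ideal (free_algebra X) S \<subseteq> carrier (free_algebra X)"
    using assms unfolding generated_ideal_def by blast
  then show "algebra_ideal (free_algebra X) (generated_ideal (free_algebra X) S)"
    unfolding algebra_ideal_free_algebra_iff
    by (auto simp: generated_ideal_def algebra_ideal_free_algebra_iff simp del: free_algebra_simps(1))
  show "S \<subseteq> generated_ideal (free_algebra X) S"
    by (auto simp: generated_ideal_def)
qed

lemma generated_ideal_least:
  "algebra_ideal A I \<Longrightarrow> S \<subseteq> I \<Longrightarrow> generated_ideal A S \<subseteq> I"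
  by (auto simp: generated_ideal_def)

text \<open>The definition asks for a map out of \<open>A\<close>, while the natural map starts at
  the presented algebra \<open>B\<close>. Closure of \<open>B\<close> under the operations is what
  turns the equations for \<open>f\<close> into equations for its inverse.\<close>

lemma algebra_isoI:
  assumes "bij_betw f (carrier B) (carrier A)"
    and "\<And>x y. x \<in> carrier B \<Longrightarrow> y \<in> carrier B \<Longrightarrow> x \<oplus>\<^bsub>B\<^esub> y \<in> carrier B \<and> f (x \<oplus>\<^bsub>B\<^esub> y) = f x \<oplus>\<^bsub>A\<^esub> f y"
    and "\<And>x y. x \<in> carrier B \<Longrightarrow> y \<in> carrier B \<Longrightarrow> x \<otimes>\<^bsub>B\<^esub> y \<in> carrier B \<and> f (x \<otimes>\<^bsub>B\<^esub> y) = f x \<otimes>\<^bsub>A\<^esub> f y"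
    and "\<And>c x. x \<in> carrier B \<Longrightarrow> c \<odot>\<^bsub>B\<^esub> x \<in> carrier B \<and> f (c \<odot>\<^bsub>B\<^esub> x) = c \<odot>\<^bsub>A\<^esub> f x"
  shows "algebra_iso A B"
proof -
  let ?g = "the_inv_into (carrier B) f"
  have inj: "inj_on f (carrier B)" and im: "f ` carrier B = carrier A"
    using assms(1) by (auto simp: bij_betw_def)
  have g: "?g x \<in> carrier B" "f (?g x) = x" if "x \<in> carrier A" for x
    using that inj im by (auto intro: the_inv_into_into f_the_inv_into_f)
  have gf: "?g x = y" if "f y = x" "y \<in> carrier B" for x y
    using that inj by (auto intro: the_inv_into_f_f)
  have "bij_betw ?g (carrier A) (carrier B)"
    using assms(1) by (rule bij_betw_the_inv_into)
  then show ?thesis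
    unfolding algebra_iso_def by (intro exI[of _ ?g]) (auto intro!: gf simp: assms g)
qed

section \<open>Cosets modulo an ideal of the free algebra, and their faithful representation\<close>

locale free_quotient =
  fixes X :: "'g set" and R :: "('g list \<Rightarrow>\<^sub>0 'k::field) set"
  assumes ideal: "algebra_ideal (free_algebra X) R"
begin

abbreviation A :: "('k, 'g list \<Rightarrow>\<^sub>0 'k) module" where "A \<equiv> free_algebra X"
abbreviation Q :: "('k, ('g list \<Rightarrow>\<^sub>0 'k) set) module" where "Q \<equiv> quotient_algebra A R"
abbreviation cls :: "('g list \<Rightarrow>\<^sub>0 'k) \<Rightarrow> ('g list \<Rightarrow>\<^sub>0 'k) set" where "cls p \<equiv> R +>\<^bsub>A\<^esub> p"

lemmas R = ideal[unfolded algebra_ideal_free_algebra_iff]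

lemma R_carrier: "x \<in> R \<Longrightarrow> x \<in> carrier A"
  using R by blast

lemma R_0: "0 \<in> R"
  using R by blast

lemma R_add: "x \<in> R \<Longrightarrow> y \<in> R \<Longrightarrow> x + y \<in> R"
  using R by blast

lemma R_scale: "x \<in> R \<Longrightarrow> Poly_Mapping.single [] c * x \<in> R"
  using R by blast

lemma R_mult: "x \<in> R \<Longrightarrow> a \<in> carrier A \<Longrightarrow> a * x \<in> R" "x \<in> R \<Longrightarrow> a \<in> carrier A \<Longrightarrow> x * a \<in> R"
  using R by blast+

lemma R_uminus: "x \<in> R \<Longrightarrow> - x \<in> R"
  using R_scale[of x "- 1"] by (simp add: poly_scalars.sc_uminus)

lemma R_diff: "x \<in> R \<Longrightarrow> y \<in> R \<Longrightarrow> x - y \<in> R"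
  using R_add[of x "- y"] R_uminus[of y] by simp

lemma cls_eq: "cls p = {q. q - p \<in> R}"
  by (auto simp: a_r_coset_def' intro: bexI[of _ "_ - p"])

lemma cls_eq_iff: "cls p = cls q \<longleftrightarrow> p - q \<in> R"
proof
  assume "cls p = cls q"
  then have "p \<in> cls q" using R_0 by (simp add: cls_eq set_eq_iff) (metis diff_self)
  then show "p - q \<in> R" by (simp add: cls_eq)
next
  assume pq: "p - q \<in> R"
  have "x - p \<in> R \<longleftrightarrow> x - q \<in> R" for x
    using R_add[OF _ pq, of "x - p"] R_diff[OF _ pq, of "x - q"] by auto
  then show "cls p = cls q"
    by (simp add: cls_eq)
qed

lemma quotient_carrier: "carrier Q = cls ` carrier A"
  by (auto simp: quotient_algebra_def FactRing_def A_RCOSETS_def' simp del: free_algebra_simps(1))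

lemma quotient_zero: "\<zero>\<^bsub>Q\<^esub> = cls 0"
  by (simp add: quotient_algebra_def FactRing_def cls_eq)

lemma quotient_add: "cls p \<oplus>\<^bsub>Q\<^esub> cls q = cls (p + q)"
proof -
  have "x - (p + q) \<in> R \<longleftrightarrow> (\<exists>a b. a - p \<in> R \<and> b - q \<in> R \<and> x = a + b)" for x
  proof
    assume "x - (p + q) \<in> R"
    then have "(x - q) - p \<in> R" "q - q \<in> R" "x = (x - q) + q"
      using R_0 by (simp_all add: algebra_simps)
    then show "\<exists>a b. a - p \<in> R \<and> b - q \<in> R \<and> x = a + b"
      by blast
  next
    assume "\<exists>a b. a - p \<in> R \<and> b - q \<in> R \<and> x = a + b"
    then obtain a b where "a - p \<in> R" "b - q \<in> R" "x = a + b" by blast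
    then show "x - (p + q) \<in> R"
      using R_add[of "a - p" "b - q"] by (simp add: algebra_simps)
  qed
  then have "cls (p + q) = {a + b |a b. a - p \<in> R \<and> b - q \<in> R}"
    unfolding cls_eq by blast
  moreover have "cls p \<oplus>\<^bsub>Q\<^esub> cls q = {a + b |a b. a \<in> cls p \<and> b \<in> cls q}"
    by (auto simp add: quotient_algebra_def FactRing_def set_add_def' simp del: free_algebra_simps(1))
  ultimately show ?thesis
    unfolding cls_eq by simp
qed

lemma quotient_mult:
  assumes "p \<in> carrier A" "q \<in> carrier A"
  shows "cls p \<otimes>\<^bsub>Q\<^esub> cls q = cls (p * q)"
proof -
  have "cls (a * b) = cls (p * q)" if "a - p \<in> R" "b - q \<in> R" for a b
  proof -
    have a: "a \<in> carrier A"
      using free_algebra_carrier_closed(1)[OF R_carrier[OF that(1)] assms(1)] by simp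
    have "a * b - p * q = a * (b - q) + (a - p) * q"
      by (simp add: algebra_simps)
    then show ?thesis
      unfolding cls_eq_iff using R_add R_mult that a assms by metis
  qed
  moreover have "p \<in> cls p" "q \<in> cls q"
    using R_0 by (simp_all add: cls_eq)
  moreover have "cls p \<otimes>\<^bsub>Q\<^esub> cls q = (\<Union>a\<in>cls p. \<Union>b\<in>cls q. cls (a * b))"
    by (simp add: quotient_algebra_def FactRing_def rcoset_mult_def del: free_algebra_simps(1))
  moreover have "a - p \<in> R" "b - q \<in> R" if "a \<in> cls p" "b \<in> cls q" for a b
    using that by (simp_all add: cls_eq)
  ultimately show ?thesis by blast
qed

lemma quotient_smult: "c \<odot>\<^bsub>Q\<^esub> cls p = cls (Poly_Mapping.single [] c * p)"
proof -
  have "cls (Poly_Mapping.single [] c * x) = cls (Poly_Mapping.single [] c * p)" if "x - p \<in> R" for x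
    using R_scale[OF that, of c] by (simp add: cls_eq_iff right_diff_distrib)
  moreover have "p \<in> cls p"
    using R_0 by (simp add: cls_eq)
  moreover have "c \<odot>\<^bsub>Q\<^esub> cls p = (\<Union>x\<in>cls p. cls (Poly_Mapping.single [] c * x))"
    by (simp add: quotient_algebra_def del: free_algebra_simps(1))
  moreover have "x - p \<in> R" if "x \<in> cls p" for x
    using that by (simp add: cls_eq)
  ultimately show ?thesis by blast
qed

text \<open>Turns the \<open>finsum\<close> in the definition of a direct sum into a sum of
  polynomials.\<close>

lemma quotient_finsum:
  assumes "finite N" "\<And>n. n \<in> N \<Longrightarrow> g n \<in> carrier A"
  shows "(\<Oplus>\<^bsub>Q\<^esub>n\<in>N. cls (g n)) = cls (\<Sum>n\<in>N. g n)"
proof -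
  interpret abelian_monoid Q
  proof (rule abelian_monoidI)
    fix x y z
    assume "x \<in> carrier Q" "y \<in> carrier Q" "z \<in> carrier Q"
    then obtain p q r where "x = cls p" "y = cls q" "z = cls r"
      by (auto simp: quotient_carrier)
    then show "(x \<oplus>\<^bsub>Q\<^esub> y) \<oplus>\<^bsub>Q\<^esub> z = x \<oplus>\<^bsub>Q\<^esub> (y \<oplus>\<^bsub>Q\<^esub> z)"
      by (simp add: quotient_add add.assoc)
  qed (auto simp: quotient_carrier quotient_zero quotient_add add.commute simp del: free_algebra_simps(1)
        intro!: imageI free_algebra_carrier_closed(1), simp)
  show ?thesis
    using assms
  proof (induction N)
    case (insert n N)
    then have "(\<lambda>n. cls (g n)) \<in> N \<rightarrow> carrier Q" "cls (g n) \<in> carrier Q"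
      by (auto simp: quotient_carrier simp del: free_algebra_simps(1))
    moreover have "(\<Oplus>\<^bsub>Q\<^esub>n\<in>N. cls (g n)) = cls (\<Sum>n\<in>N. g n)"
      using insert by blast
    ultimately show ?case
      using insert.hyps by (simp add: quotient_add)
  qed (simp add: quotient_zero)
qed

text \<open>\<open>R\<close> absorbs only polynomials over \<open>X\<close>, whereas a
  representation of the whole polynomial ring needs an ideal of that ring. The preimage of
  \<open>R\<close> under this retraction is one.\<close>

definition retract :: "('g list \<Rightarrow>\<^sub>0 'k) \<Rightarrow> ('g list \<Rightarrow>\<^sub>0 'k)" where
  "retract = poly_scalars.ev (\<lambda>g. if g \<in> X then Poly_Mapping.single [g] 1 else 0)"

lemma retract_single:
  "retract (Poly_Mapping.single w c) = (if set w \<subseteq> X then Poly_Mapping.single w c else 0)"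
proof -
  have "prod_list (map (\<lambda>g. if g \<in> X then Poly_Mapping.single [g] (1 :: 'k) else 0) w)
      = (if set w \<subseteq> X then Poly_Mapping.single w 1 else 0)"
    by (induction w) (auto simp: mult_single plus_list_def)
  then show ?thesis
    by (simp add: retract_def mult_single plus_list_def)
qed

lemma retract_carrier: "p \<in> carrier A \<Longrightarrow> retract p = p"
proof -
  assume p: "p \<in> carrier A"
  have "retract p = (\<Sum>w\<in>Poly_Mapping.keys p. retract (Poly_Mapping.single w (Poly_Mapping.lookup p w)))"
    by (subst poly_mapping_monomial_sum[of p]) (simp add: retract_def poly_scalars.ev_sum del: poly_scalars.ev_single)
  also have "\<dots> = (\<Sum>w\<in>Poly_Mapping.keys p. Poly_Mapping.single w (Poly_Mapping.lookup p w))"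
    using p by (intro sum.cong) (auto simp: retract_single)
  finally show ?thesis
    using poly_mapping_monomial_sum[of p] by simp
qed

lemma retract_in_carrier:
  "retract p - Poly_Mapping.single [] (Poly_Mapping.lookup p []) \<in> carrier A"
proof (induction p rule: poly_mapping_monomial_induct)
  case zero
  then show ?case by (simp add: retract_def)
next
  case (add w c q)
  have "retract (Poly_Mapping.single w c) - Poly_Mapping.single [] (Poly_Mapping.lookup (Poly_Mapping.single w c) [])
      \<in> carrier A"
    by (auto simp: retract_single lookup_single when_def keys_uminus)
  from free_algebra_carrier_closed(1)[OF this add(2)] show ?case
    by (simp add: retract_def poly_scalars.ev_add lookup_add single_add algebra_simps del: poly_scalars.ev_single)
qed

lemma representation_exists:
  "\<exists>\<psi> :: ('g list \<Rightarrow>\<^sub>0 'k) \<Rightarrow> ('g list, 'k) linop.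
     (\<forall>p q. \<psi> (p + q) = \<psi> p + \<psi> q) \<and> (\<forall>p q. \<psi> (p * q) = \<psi> p * \<psi> q) \<and> \<psi> 1 = 1 \<and>
     (\<forall>c. \<psi> (Poly_Mapping.single [] c) = scalar_op c) \<and> (\<forall>p\<in>carrier A. \<psi> p = 0 \<longleftrightarrow> p \<in> R)"
proof -
  let ?V = "{p. retract p \<in> R}"
  \<comment> \<open>A retracted multiplier is a constant plus an element of the carrier, which has
    no constants; \<open>R\<close> absorbs both.\<close>
  have mult: "b * x \<in> R" "x * b \<in> R" if x: "x \<in> R" and b: "b = retract a" for a b x
  proof -
    define b' where "b' = b - Poly_Mapping.single [] (Poly_Mapping.lookup a [])"
    have b': "b' \<in> carrier A" "b = b' + Poly_Mapping.single [] (Poly_Mapping.lookup a [])"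
      using retract_in_carrier[of a] by (auto simp: b'_def b simp del: free_algebra_simps(1))
    have "x * Poly_Mapping.single [] (Poly_Mapping.lookup a []) \<in> R"
      using R_scale[OF x] by (simp add: single_Nil_commute)
    then show "b * x \<in> R" "x * b \<in> R"
      unfolding b'(2) distrib_left distrib_right by (auto intro!: R_add R_mult(1)[OF x b'(1)] R_mult(2)[OF x b'(1)] R_scale[OF x])
  qed
  obtain \<psi> :: "('g list \<Rightarrow>\<^sub>0 'k) \<Rightarrow> ('g list, 'k) linop"
    where "\<And>p q. \<psi> (p + q) = \<psi> p + \<psi> q" "\<And>p q. \<psi> (p * q) = \<psi> p * \<psi> q" "\<psi> 1 = 1"
      "\<And>c. \<psi> (Poly_Mapping.single [] c) = scalar_op c" "\<And>p. \<psi> p = 0 \<longleftrightarrow> p \<in> ?V"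
  proof (rule ideal_kernel_of_representation[of ?V])
    show "Poly_Mapping.lookup x [] = 0" if "x \<in> ?V" for x
    proof -
      have "Poly_Mapping.lookup (retract x) [] = 0"
        using that R_carrier[of "retract x"] by (auto simp: in_keys_iff)
      moreover have "Poly_Mapping.lookup (retract x - Poly_Mapping.single [] (Poly_Mapping.lookup x [])) [] = 0"
        using retract_in_carrier[of x] by (auto simp: in_keys_iff)
      ultimately show ?thesis
        by (simp add: lookup_minus)
    qed
  qed (auto simp: retract_def poly_scalars.ev_add poly_scalars.ev_mult R_0 R_add
        intro: mult[unfolded retract_def, OF _ refl])
  then show ?thesis
    using retract_carrier by (intro exI[of _ \<psi>]) (simp del: free_algebra_simps(1))
qed

text \<open>The complement behind the representation is not canonical, so one representation is
  fixed by choice. Equality in the quotient becomes equality of operators.\<close>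

definition rep :: "('g list \<Rightarrow>\<^sub>0 'k) \<Rightarrow> ('g list, 'k) linop" where
  "rep = (SOME \<psi>. (\<forall>p q. \<psi> (p + q) = \<psi> p + \<psi> q) \<and> (\<forall>p q. \<psi> (p * q) = \<psi> p * \<psi> q) \<and> \<psi> 1 = 1 \<and>
     (\<forall>c. \<psi> (Poly_Mapping.single [] c) = scalar_op c) \<and> (\<forall>p\<in>carrier A. \<psi> p = 0 \<longleftrightarrow> p \<in> R))"

lemma rep_add: "rep (p + q) = rep p + rep q"
  and rep_mult: "rep (p * q) = rep p * rep q"
  and rep_scalar: "rep (Poly_Mapping.single [] c) = scalar_op c"
  and rep_1: "rep 1 = 1"
  and rep_eq_0_iff: "p \<in> carrier A \<Longrightarrow> rep p = 0 \<longleftrightarrow> p \<in> R"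
  using someI_ex[OF representation_exists] unfolding rep_def[symmetric] by blast+

lemma rep_eq_ev: "rep p = linop.ev (\<lambda>g. rep (Poly_Mapping.single [g] 1)) p"
  by (rule linop.ev_unique) (simp_all add: rep_add rep_mult rep_1 rep_scalar)

lemma rep_0: "rep 0 = 0"
  using rep_add[of 0 0] by simp

lemma rep_uminus: "rep (- p) = - rep p"
  using rep_add[of p "- p"] by (simp add: rep_0 eq_neg_iff_add_eq_0 add.commute)

lemma rep_diff: "rep (p - q) = rep p - rep q"
  using rep_add[of p "- q"] by (simp add: rep_uminus)

lemma rep_sum: "rep (sum f N) = (\<Sum>n\<in>N. rep (f n))"
  by (induction N rule: infinite_finite_induct) (auto simp: rep_add rep_0)

lemma rep_eq_iff: "p \<in> carrier A \<Longrightarrow> q \<in> carrier A \<Longrightarrow> rep p = rep q \<longleftrightarrow> cls p = cls q"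
  using rep_eq_0_iff[OF free_algebra_carrier_closed(5)] by (auto simp: rep_diff cls_eq_iff)

end

section \<open>Leavitt families\<close>

lemma relator_carrier:
  assumes "wf_digraph E"
  shows "lpa_relators E \<subseteq> carrier (free_algebra (lpa_gens E) :: ('k::field, _) module)"
proof -
  interpret wf_digraph E by fact
  let ?A = "free_algebra (lpa_gens E) :: ('k, _) module"
  have gens [intro]: "v \<in> verts E \<Longrightarrow> vx v \<in> carrier ?A" "e \<in> arcs E \<Longrightarrow> ed e \<in> carrier ?A"
    "e \<in> arcs E \<Longrightarrow> gh e \<in> carrier ?A" for v e
    by (auto simp: lpa_gens_def)
  have zero: "0 \<in> carrier ?A"
    by simp
  have sum: "(\<Sum>e\<in>N. ed e * gh e) \<in> carrier ?A" if "N \<subseteq> arcs E" for N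
    using that by (induction N rule: infinite_finite_induct)
      (auto simp del: free_algebra_simps(1) simp: zero intro!: free_algebra_carrier_closed)
  show ?thesis
    unfolding lpa_relators_def
    by (auto simp del: free_algebra_simps(1) simp: zero regular_verts_def intro!: free_algebra_carrier_closed sum)
qed

text \<open>A family satisfying the relations is the same as a homomorphism out of the Leavitt path
  algebra. It is instantiated by the algebra itself, by operators on boundary paths and by the
  hedgehog elements inside the ideal.\<close>

locale leavitt_family = wf_digraph E + central_scalars sc
  for E :: "('v, 'e) pre_digraph" and sc :: "'k::field \<Rightarrow> 'a::ring_1" +
  fixes P :: "'v \<Rightarrow> 'a" and S T :: "'e \<Rightarrow> 'a"
  assumes PP: "v \<in> verts E \<Longrightarrow> w \<in> verts E \<Longrightarrow> P v * P w = (if v = w then P v else 0)"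
    and PS [simp]: "e \<in> arcs E \<Longrightarrow> P (tail E e) * S e = S e"
    and SP [simp]: "e \<in> arcs E \<Longrightarrow> S e * P (head E e) = S e"
    and PT [simp]: "e \<in> arcs E \<Longrightarrow> P (head E e) * T e = T e"
    and TP [simp]: "e \<in> arcs E \<Longrightarrow> T e * P (tail E e) = T e"
    and TS: "e \<in> arcs E \<Longrightarrow> f \<in> arcs E \<Longrightarrow> T e * S f = (if e = f then P (head E e) else 0)"
    and CK: "v \<in> regular_verts E \<Longrightarrow> P v = (\<Sum>e\<in>out_arcs E v. S e * T e)"
begin

primrec gen :: "('v, 'e) lpa_gen \<Rightarrow> 'a" where
  "gen (Vertex v) = P v"
| "gen (Edge e) = S e"
| "gen (Ghost e) = T e"

lemma ev_gen_lpa_ideal: "p \<in> lpa_ideal E \<Longrightarrow> ev gen p = 0"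
proof -
  let ?A = "free_algebra (lpa_gens E) :: ('k, _) module"
  let ?I = "{p \<in> carrier ?A. ev gen p = 0}"
  have "algebra_ideal ?A ?I"
    unfolding algebra_ideal_free_algebra_iff
    by (auto intro!: free_algebra_carrier_closed simp: ev_add ev_mult simp del: free_algebra_simps(1)) simp
  moreover have "ev gen r = 0" if "r \<in> lpa_relators E" for r
    using that unfolding lpa_relators_def
    by (auto simp: ev_diff ev_mult ev_sum PP TS simp flip: CK)
  then have "lpa_relators E \<subseteq> ?I"
    using relator_carrier[OF wf_digraph] by blast
  ultimately have "lpa_ideal E \<subseteq> ?I"
    unfolding lpa_ideal_def by (rule generated_ideal_least)
  then show "p \<in> lpa_ideal E \<Longrightarrow> ev gen p = 0" by blast
qed

end

text \<open>\<open>scalar_type\<close> pins down the field of scalars, which the type of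
  \<open>E\<close> does not determine.\<close>

locale leavitt_algebra = wf_digraph E for E :: "('v, 'e) pre_digraph" +
  fixes scalar_type :: "'k::field itself"
begin

sublocale free_quotient "lpa_gens E" "lpa_ideal E :: (('v, 'e) lpa_gen list \<Rightarrow>\<^sub>0 'k) set"
  by unfold_locales
    (auto simp: lpa_ideal_def intro!: generated_ideal relator_carrier wf_digraph)

lemma relators_subset: "lpa_relators E \<subseteq> (lpa_ideal E :: (('v, 'e) lpa_gen list \<Rightarrow>\<^sub>0 'k) set)"
  unfolding lpa_ideal_def by (intro generated_ideal relator_carrier wf_digraph)

lemma rep_relation:
  assumes "p - q \<in> lpa_relators E"
  shows "rep p = rep q"
proof -
  have "rep (p - q) = 0"
    using assms relators_subset rep_eq_0_iff R_carrier by blast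
  then show ?thesis by (simp add: rep_diff)
qed

sublocale leavitt_family E "scalar_op :: 'k \<Rightarrow> _" "\<lambda>v. rep (vx v)" "\<lambda>e. rep (ed e)" "\<lambda>e. rep (gh e)"
proof
  fix v w e f
  show "rep (vx v) * rep (vx w) = (if v = w then rep (vx v) else 0)" if "v \<in> verts E" "w \<in> verts E"
  proof -
    have "rep (vx v * vx w) = rep (if v = w then vx v else 0)"
      by (rule rep_relation) (use that in \<open>unfold lpa_relators_def, blast\<close>)
    then show ?thesis by (auto simp: rep_mult rep_0)
  qed
  show "rep (gh e) * rep (ed f) = (if e = f then rep (vx (head E e)) else 0)" if "e \<in> arcs E" "f \<in> arcs E"
  proof -
    have "rep (gh e * ed f) = rep (if e = f then vx (head E e) else 0)"
      by (rule rep_relation) (use that in \<open>unfold lpa_relators_def, blast\<close>)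
    then show ?thesis by (auto simp: rep_mult rep_0)
  qed
  show "rep (vx v) = (\<Sum>e\<in>out_arcs E v. rep (ed e) * rep (gh e))" if "v \<in> regular_verts E"
  proof -
    have "rep (vx v) = rep (\<Sum>e\<in>out_arcs E v. ed e * gh e)"
      by (rule rep_relation) (use that in \<open>unfold lpa_relators_def, blast\<close>)
    then show ?thesis by (auto simp: rep_mult rep_sum)
  qed
  assume e: "e \<in> arcs E"
  show "rep (vx (tail E e)) * rep (ed e) = rep (ed e)"
    unfolding rep_mult[symmetric] by (rule rep_relation) (use e in \<open>unfold lpa_relators_def, blast\<close>)
  show "rep (ed e) * rep (vx (head E e)) = rep (ed e)"
    unfolding rep_mult[symmetric] by (rule rep_relation) (use e in \<open>unfold lpa_relators_def, blast\<close>)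
  show "rep (vx (head E e)) * rep (gh e) = rep (gh e)"
    unfolding rep_mult[symmetric] by (rule rep_relation) (use e in \<open>unfold lpa_relators_def, blast\<close>)
  show "rep (gh e) * rep (vx (tail E e)) = rep (gh e)"
    unfolding rep_mult[symmetric] by (rule rep_relation) (use e in \<open>unfold lpa_relators_def, blast\<close>)
qed

lemma rep_eq_ev_gen: "rep p = linop.ev gen p"
proof -
  have "(\<lambda>g. rep (Poly_Mapping.single [g] 1)) = gen"
    by (rule ext) (case_tac g; simp)
  with rep_eq_ev[of p] show ?thesis by simp
qed

lemma leavitt_path_algebra_eq: "leavitt_path_algebra E = Q"
  by (simp add: leavitt_path_algebra_def)

end

section \<open>Homogeneous components\<close>

lift_definition restrict_keys :: "'b set \<Rightarrow> ('b \<Rightarrow>\<^sub>0 'k::zero) \<Rightarrow> ('b \<Rightarrow>\<^sub>0 'k)" is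
  "\<lambda>B p b. if b \<in> B then p b else 0"
  by (auto elim: finite_subset[rotated])

lemma lookup_restrict_keys: "Poly_Mapping.lookup (restrict_keys B p) b = (if b \<in> B then Poly_Mapping.lookup p b else 0)"
  by transfer simp

lemma restrict_keys_0 [simp]: "restrict_keys B 0 = 0"
  by (rule poly_mapping_eqI) (simp add: lookup_restrict_keys)

lemma restrict_keys_add: "restrict_keys B (p + q) = restrict_keys B p + restrict_keys B q"
  for p :: "'b \<Rightarrow>\<^sub>0 'k::comm_monoid_add"
  by (rule poly_mapping_eqI) (simp add: lookup_restrict_keys lookup_add)

lemma restrict_keys_sum: "restrict_keys B (sum f N) = (\<Sum>n\<in>N. restrict_keys B (f n))"
  for f :: "_ \<Rightarrow> 'b \<Rightarrow>\<^sub>0 'k::comm_monoid_add"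
  by (induction N rule: infinite_finite_induct) (auto simp: restrict_keys_add)

lemma keys_restrict_keys: "Poly_Mapping.keys (restrict_keys B p) = Poly_Mapping.keys p \<inter> B"
  by (auto simp: in_keys_iff lookup_restrict_keys split: if_splits)

lemma restrict_keys_id: "Poly_Mapping.keys p \<subseteq> B \<Longrightarrow> restrict_keys B p = p"
  by (rule poly_mapping_eqI) (auto simp: lookup_restrict_keys in_keys_iff)

lemma restrict_keys_disjoint: "Poly_Mapping.keys p \<inter> B = {} \<Longrightarrow> restrict_keys B p = 0"
  by (rule poly_mapping_eqI) (auto simp: lookup_restrict_keys in_keys_iff)

lemma restrict_keys_carrier:
  "p \<in> carrier (free_algebra X) \<Longrightarrow> restrict_keys B p \<in> carrier (free_algebra X)"
  for p :: "'g list \<Rightarrow>\<^sub>0 'k::field"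
  by (auto simp: keys_restrict_keys)

text \<open>The classifying function \<open>f\<close> is arbitrary because the hedgehog algebra is
  graded by the length of quills and not by \<open>word_degree\<close>.\<close>

lemma sum_restrict_keys:
  fixes p :: "'b \<Rightarrow>\<^sub>0 'k::comm_monoid_add"
  shows "p = (\<Sum>d\<in>f ` Poly_Mapping.keys p. restrict_keys {b. f b = d} p)"
proof (rule poly_mapping_eqI)
  fix k
  have "(\<Sum>d\<in>f ` Poly_Mapping.keys p. Poly_Mapping.lookup (restrict_keys {b. f b = d} p) k)
      = (\<Sum>d\<in>f ` Poly_Mapping.keys p. if d = f k then Poly_Mapping.lookup p k else 0)"
    by (intro sum.cong) (auto simp: lookup_restrict_keys)
  also have "\<dots> = Poly_Mapping.lookup p k"
    by (auto simp: in_keys_iff)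
  finally show "Poly_Mapping.lookup p k =
      Poly_Mapping.lookup (\<Sum>d\<in>f ` Poly_Mapping.keys p. restrict_keys {b. f b = d} p) k"
    by (simp add: lookup_sum)
qed

lemma word_degree_simps [simp]:
  "word_degree [] = 0" "word_degree (g # w) = gen_degree g + word_degree w"
  "word_degree (v @ w) = word_degree v + word_degree w"
  by (simp_all add: word_degree_def)

definition homogeneous :: "int \<Rightarrow> (('v, 'e) lpa_gen list \<Rightarrow>\<^sub>0 'k::field) \<Rightarrow> bool" where
  "homogeneous d p \<longleftrightarrow> (\<forall>w\<in>Poly_Mapping.keys p. word_degree w = d)"

abbreviation degree_part :: "int \<Rightarrow> (('v, 'e) lpa_gen list \<Rightarrow>\<^sub>0 'k::field) \<Rightarrow> (('v, 'e) lpa_gen list \<Rightarrow>\<^sub>0 'k)" where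
  "degree_part d \<equiv> restrict_keys {w. word_degree w = d}"

lemma degree_part_homogeneous: "homogeneous n p \<Longrightarrow> degree_part d p = (if d = n then p else 0)"
  by (auto simp: homogeneous_def intro!: restrict_keys_id restrict_keys_disjoint)

lemma homogeneous_0 [simp]: "homogeneous d 0"
  by (simp add: homogeneous_def)

lemma homogeneous_single: "word_degree w = d \<Longrightarrow> homogeneous d (Poly_Mapping.single w c)"
  by (simp add: homogeneous_def)

lemma homogeneous_add: "homogeneous d p \<Longrightarrow> homogeneous d q \<Longrightarrow> homogeneous d (p + q)"
  using keys_add[of p q] by (auto simp: homogeneous_def)

lemma homogeneous_diff: "homogeneous d p \<Longrightarrow> homogeneous d q \<Longrightarrow> homogeneous d (p - q)"
  using homogeneous_add[of d p "- q"] by (simp add: homogeneous_def keys_uminus)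

lemma homogeneous_sum: "(\<And>n. n \<in> N \<Longrightarrow> homogeneous d (f n)) \<Longrightarrow> homogeneous d (sum f N)"
  by (induction N rule: infinite_finite_induct) (auto intro: homogeneous_add)

lemma homogeneous_mult: "homogeneous a p \<Longrightarrow> homogeneous b q \<Longrightarrow> homogeneous (a + b) (p * q)"
  using keys_mult[of p q] by (fastforce simp: homogeneous_def plus_list_def)

lemma degree_part_single_mult:
  "degree_part d (Poly_Mapping.single w c * q) = Poly_Mapping.single w c * degree_part (d - word_degree w) q"
proof (induction q rule: poly_mapping_monomial_induct)
  case (add v b q)
  have "degree_part d (Poly_Mapping.single (w @ v) (c * b))
      = Poly_Mapping.single w c * degree_part (d - word_degree w) (Poly_Mapping.single v b)"
    by (simp add: degree_part_homogeneous[OF homogeneous_single[OF refl]] mult_single plus_list_def)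
  with add show ?case
    by (simp add: distrib_left restrict_keys_add mult_single plus_list_def)
qed simp

lemma degree_part_mult_single:
  "degree_part d (q * Poly_Mapping.single w c) = degree_part (d - word_degree w) q * Poly_Mapping.single w c"
proof (induction q rule: poly_mapping_monomial_induct)
  case (add v b q)
  have "degree_part d (Poly_Mapping.single (v @ w) (b * c))
      = degree_part (d - word_degree w) (Poly_Mapping.single v b) * Poly_Mapping.single w c"
    by (simp add: degree_part_homogeneous[OF homogeneous_single[OF refl]] mult_single plus_list_def)
  with add show ?case
    by (simp add: distrib_right restrict_keys_add mult_single plus_list_def)
qed simp

lemma relator_homogeneous: "r \<in> lpa_relators E \<Longrightarrow> \<exists>d. homogeneous d r"
  unfolding lpa_relators_def mult_single plus_list_def
  by (elim UnE CollectE exE conjE; hypsubst; rule exI)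
    (rule homogeneous_diff, rule homogeneous_single, simp, auto intro!: homogeneous_sum homogeneous_single)+

context leavitt_algebra
begin

text \<open>The relators are homogeneous, and the polynomials all of whose homogeneous parts lie in
  the ideal again form an ideal. This is what makes the grading of the quotient direct.\<close>

lemma degree_part_lpa_ideal:
  assumes "p \<in> (lpa_ideal E :: (('v, 'e) lpa_gen list \<Rightarrow>\<^sub>0 'k) set)"
  shows "degree_part d p \<in> lpa_ideal E"
proof -
  let ?I = "{p. \<forall>d. degree_part d p \<in> (lpa_ideal E :: (('v, 'e) lpa_gen list \<Rightarrow>\<^sub>0 'k) set)} \<inter> carrier A"
  have mult: "degree_part d (a * x) \<in> lpa_ideal E \<and> degree_part d (x * a) \<in> lpa_ideal E"
    if "\<And>d. degree_part d x \<in> lpa_ideal E" "a \<in> carrier A" for a x d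
  proof (induction a rule: poly_mapping_monomial_induct)
    case (add w c q)
    then have "Poly_Mapping.single w c \<in> carrier A"
      using that(2) by auto
    then have "Poly_Mapping.single w c * degree_part e x \<in> lpa_ideal E"
      "degree_part e x * Poly_Mapping.single w c \<in> lpa_ideal E" for e
      using R_mult that(1) by blast+
    with add show ?case
      by (auto simp: distrib_left distrib_right restrict_keys_add degree_part_mult_single degree_part_single_mult
          intro!: R_add)
  qed (simp add: R_0)
  have scale: "degree_part d (Poly_Mapping.single [] c * x) \<in> lpa_ideal E"
    if "\<And>d. degree_part d x \<in> lpa_ideal E" for d c and x :: "('v, 'e) lpa_gen list \<Rightarrow>\<^sub>0 'k"
    using that by (simp add: degree_part_single_mult R_scale)
  have "algebra_ideal A ?I"
    unfolding algebra_ideal_free_algebra_iff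
    by (auto simp: restrict_keys_add R_0 R_add mult scale simp del: free_algebra_simps(1)
        intro!: free_algebra_carrier_closed) simp
  moreover have "lpa_relators E \<subseteq> ?I"
  proof
    fix r :: "('v, 'e) lpa_gen list \<Rightarrow>\<^sub>0 'k"
    assume r: "r \<in> lpa_relators E"
    then obtain n where "homogeneous n r"
      using relator_homogeneous by blast
    moreover have "r \<in> lpa_ideal E" "r \<in> carrier A"
      using r relators_subset R_carrier by blast+
    ultimately show "r \<in> ?I"
      by (simp add: degree_part_homogeneous R_0 del: free_algebra_simps(1))
  qed
  ultimately have "lpa_ideal E \<subseteq> ?I"
    unfolding lpa_ideal_def by (rule generated_ideal_least)
  with assms show ?thesis by blast
qed

end

section \<open>Vertices are nonzero\<close>

lemma app_0 [simp]: "app f 0 = 0"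
  using app[of f] by (metis (mono_tags, lifting) add_cancel_right_right mem_Collect_eq)

lemma app_add: "app f (x + y) = app f x + app f y"
  using app[of f] by blast

lemma app_scale: "app f (scale c x) = scale c (app f x)"
  using app[of f] by blast

lemma app_linop_sum: "app (sum F N) x = (\<Sum>n\<in>N. app (F n) x)"
  by (induction N rule: infinite_finite_induct) (auto simp: zero_linop.rep_eq plus_linop.rep_eq)

lemma linop_eq_on_basis:
  fixes f g :: "('b, 'k::field) linop"
  assumes "\<And>b. app f (Poly_Mapping.single b 1) = app g (Poly_Mapping.single b 1)"
  shows "f = g"
proof (rule linop_eqI)
  fix x
  have single: "Poly_Mapping.single b c = scale c (Poly_Mapping.single b 1)" for b and c :: 'k
    by (rule poly_mapping_eqI) (simp add: lookup_single when_def)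
  show "app f x = app g x"
  proof (induction x rule: poly_mapping_monomial_induct)
    case (add b c q)
    have "app f (Poly_Mapping.single b c) = app g (Poly_Mapping.single b c)"
      using single[of b c] by (metis app_scale assms)
    with add show ?case by (simp add: app_add)
  qed simp
qed

definition partial_map_fun :: "('b \<Rightarrow> 'b option) \<Rightarrow> ('b \<Rightarrow>\<^sub>0 'k::field) \<Rightarrow> ('b \<Rightarrow>\<^sub>0 'k)" where
  "partial_map_fun h p =
     (\<Sum>b\<in>Poly_Mapping.keys p. case h b of None \<Rightarrow> 0 | Some c \<Rightarrow> Poly_Mapping.single c (Poly_Mapping.lookup p b))"

lemma partial_map_fun_superset:
  assumes "finite W" "Poly_Mapping.keys p \<subseteq> W"
  shows "partial_map_fun h p =
     (\<Sum>b\<in>W. case h b of None \<Rightarrow> 0 | Some c \<Rightarrow> Poly_Mapping.single c (Poly_Mapping.lookup p b))"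
  unfolding partial_map_fun_def using assms
  by (intro sum.mono_neutral_left) (auto simp: in_keys_iff split: option.splits)

lift_definition partial_map_op :: "('b \<Rightarrow> 'b option) \<Rightarrow> ('b, 'k::field) linop" is partial_map_fun
proof (intro conjI allI)
  fix h :: "'b \<Rightarrow> 'b option" and x y :: "'b \<Rightarrow>\<^sub>0 'k" and c :: 'k
  let ?W = "Poly_Mapping.keys x \<union> Poly_Mapping.keys y"
  have "partial_map_fun h (x + y)
      = (\<Sum>b\<in>?W. case h b of None \<Rightarrow> 0 | Some c \<Rightarrow> Poly_Mapping.single c (Poly_Mapping.lookup (x + y) b))"
    using keys_add[of x y] by (intro partial_map_fun_superset) auto
  also have "\<dots> = partial_map_fun h x + partial_map_fun h y"
    by (subst (1 2) partial_map_fun_superset[of ?W])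
      (auto simp: lookup_add single_add sum.distrib[symmetric] intro!: sum.cong split: option.splits)
  finally show "partial_map_fun h (x + y) = partial_map_fun h x + partial_map_fun h y" .
  have "partial_map_fun h (scale c x) = (\<Sum>b\<in>Poly_Mapping.keys x.
      case h b of None \<Rightarrow> 0 | Some d \<Rightarrow> Poly_Mapping.single d (Poly_Mapping.lookup (scale c x) b))"
    by (intro partial_map_fun_superset) (auto simp: in_keys_iff)
  also have "\<dots> = scale c (partial_map_fun h x)"
    unfolding partial_map_fun_def pm.scale_sum_right
    by (intro sum.cong) (auto split: option.splits intro!: poly_mapping_eqI simp: lookup_single when_def)
  finally show "partial_map_fun h (scale c x) = scale c (partial_map_fun h x)" .
qed

lemma app_partial_map_op [simp]:
  "app (partial_map_op h) (Poly_Mapping.single b c) = (case h b of None \<Rightarrow> 0 | Some d \<Rightarrow> Poly_Mapping.single d c)"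
  unfolding partial_map_op.rep_eq
  by (subst partial_map_fun_superset[of "{b}"]) (auto split: option.split)

context wf_digraph
begin

text \<open>
  A sequence \<open>g\<close> records at time \<open>n\<close> the current vertex and the edge that is taken next. The entry
  \<open>None\<close> marks a path that has stopped, which is allowed only at a vertex that is not regular.
\<close>

definition boundary :: "(nat \<Rightarrow> 'a \<times> 'b option) set" where
  "boundary = {g. \<forall>n. case g n of
      (u, None) \<Rightarrow> u \<in> verts G \<and> u \<notin> regular_verts G
    | (u, Some e) \<Rightarrow> e \<in> arcs G \<and> tail G e = u \<and> fst (g (Suc n)) = head G e}"

text \<open>A regular vertex is left along a chosen edge and at any other vertex the path stops, so
  the walk never gets stuck. After a stop, \<open>stp\<close> repeats the entry.\<close>

lemma boundary_exists:
  assumes "v \<in> verts G"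
  obtains g where "g \<in> boundary" "fst (g 0) = v"
proof -
  define ch where "ch u = (if u \<in> regular_verts G then Some (SOME e. e \<in> out_arcs G u) else None)" for u
  have ch: "e \<in> arcs G" "tail G e = u" if "ch u = Some e" for e u
  proof -
    have "e \<in> out_arcs G u"
      using that some_in_eq[of "out_arcs G u"] by (auto simp: ch_def regular_verts_def split: if_splits)
    then show "e \<in> arcs G" "tail G e = u" by auto
  qed
  have ch_None: "u \<notin> regular_verts G" if "ch u = None" for u
    using that by (auto simp: ch_def split: if_splits)
  define stp where "stp = (\<lambda>(u, x). case x of None \<Rightarrow> (u :: 'a, None) | Some e \<Rightarrow> (head G e, ch (head G e)))"
  define g where "g n = (stp ^^ n) (v, ch v)" for n
  have g0: "g 0 = (v, ch v)" and gSuc: "g (Suc n) = stp (g n)" for n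
    by (simp_all add: g_def)
  have inv: "fst (g n) \<in> verts G \<and> snd (g n) = ch (fst (g n))" for n
    by (induction n) (use assms ch in \<open>auto simp: g0 gSuc stp_def split: option.splits prod.splits\<close>)
  have "g \<in> boundary"
    unfolding boundary_def
  proof (intro CollectI allI)
    fix n
    obtain u o' where "g n = (u, o')" by force
    with inv[of n] gSuc[of n] ch ch_None
    show "case g n of (u, None) \<Rightarrow> u \<in> verts G \<and> u \<notin> regular_verts G
      | (u, Some e) \<Rightarrow> e \<in> arcs G \<and> tail G e = u \<and> fst (g (Suc n)) = head G e"
      by (auto simp: stp_def split: option.splits)
  qed
  with that g0 show thesis by simp
qed

lemma boundary_shift: "g \<in> boundary \<Longrightarrow> (\<lambda>n. g (Suc n)) \<in> boundary"
  by (auto simp: boundary_def)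

lemma boundary_extend:
  "g \<in> boundary \<Longrightarrow> e \<in> arcs G \<Longrightarrow> fst (g 0) = head G e \<Longrightarrow> case_nat (tail G e, Some e) g \<in> boundary"
  by (auto simp: boundary_def split: nat.splits)

lemma boundary_step:
  assumes "g \<in> boundary" "snd (g 0) = Some e"
  shows "e \<in> arcs G" "fst (g 0) = tail G e" "fst (g (Suc 0)) = head G e"
proof -
  have "case g 0 of (u, None) \<Rightarrow> u \<in> verts G \<and> u \<notin> regular_verts G
      | (u, Some e) \<Rightarrow> e \<in> arcs G \<and> tail G e = u \<and> fst (g (Suc 0)) = head G e"
    using assms(1) by (simp add: boundary_def)
  then show "e \<in> arcs G" "fst (g 0) = tail G e" "fst (g (Suc 0)) = head G e"
    using assms(2) by (cases "g 0"; simp)+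
qed

lemma boundary_stop:
  assumes "g \<in> boundary" "snd (g 0) = None"
  shows "fst (g 0) \<notin> regular_verts G"
proof -
  have "case g 0 of (u, None) \<Rightarrow> u \<in> verts G \<and> u \<notin> regular_verts G
      | (u, Some e) \<Rightarrow> e \<in> arcs G \<and> tail G e = u \<and> fst (g (Suc 0)) = head G e"
    using assms(1) by (simp add: boundary_def)
  then show ?thesis
    using assms(2) by (cases "g 0") simp
qed

definition boundary_vertex :: "'a \<Rightarrow> (nat \<Rightarrow> 'a \<times> 'b option) \<Rightarrow> (nat \<Rightarrow> 'a \<times> 'b option) option" where
  "boundary_vertex v g = (if g \<in> boundary \<and> fst (g 0) = v then Some g else None)"

definition boundary_edge :: "'b \<Rightarrow> (nat \<Rightarrow> 'a \<times> 'b option) \<Rightarrow> (nat \<Rightarrow> 'a \<times> 'b option) option" where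
  "boundary_edge e g = (if g \<in> boundary \<and> fst (g 0) = head G e then Some (case_nat (tail G e, Some e) g) else None)"

definition boundary_ghost :: "'b \<Rightarrow> (nat \<Rightarrow> 'a \<times> 'b option) \<Rightarrow> (nat \<Rightarrow> 'a \<times> 'b option) option" where
  "boundary_ghost e g = (if g \<in> boundary \<and> snd (g 0) = Some e then Some (\<lambda>n. g (Suc n)) else None)"

lemmas boundary_ops = boundary_vertex_def boundary_edge_def boundary_ghost_def

text \<open>Vertices act as projections, edges prepend and ghosts remove the first edge. Paths that
  stop at a regular vertex are excluded because the relation there forces every basis element
  starting at that vertex to begin with exactly one edge.\<close>

lemma boundary_family:
  "leavitt_family G (scalar_op :: 'k::field \<Rightarrow> _) (\<lambda>v. partial_map_op (boundary_vertex v))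
    (\<lambda>e. partial_map_op (boundary_edge e)) (\<lambda>e. partial_map_op (boundary_ghost e))"
proof
  fix v w e f
  note [simp] = times_linop.rep_eq zero_linop.rep_eq
  show "partial_map_op (boundary_vertex v) * partial_map_op (boundary_vertex w)
      = (if v = w then partial_map_op (boundary_vertex v) else (0 :: (_, 'k) linop))"
    by (rule linop_eq_on_basis) (auto simp: boundary_ops)
  show "partial_map_op (boundary_vertex v) =
      (\<Sum>e\<in>out_arcs G v. partial_map_op (boundary_edge e) * (partial_map_op (boundary_ghost e) :: (_, 'k) linop))"
    if v: "v \<in> regular_verts G"
  proof (rule linop_eq_on_basis)
    fix g :: "nat \<Rightarrow> 'a \<times> 'b option"
    let ?g = "Poly_Mapping.single g (1 :: 'k)"
    have summand: "app (partial_map_op (boundary_edge e) * partial_map_op (boundary_ghost e)) ?g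
        = (if g \<in> boundary \<and> snd (g 0) = Some e then ?g else 0)" for e
    proof (cases "g \<in> boundary \<and> snd (g 0) = Some e")
      case True
      then have "case_nat (tail G e, Some e) (\<lambda>n. g (Suc n)) = g"
        using boundary_step[of g e] by (auto simp: fun_eq_iff prod_eq_iff split: nat.splits)
      then show ?thesis
        using True boundary_step[of g e] boundary_shift[of g] by (auto simp: boundary_ops)
    qed (auto simp: boundary_ops)
    show "app (partial_map_op (boundary_vertex v)) ?g =
        app (\<Sum>e\<in>out_arcs G v. partial_map_op (boundary_edge e) * partial_map_op (boundary_ghost e)) ?g"
    \<comment> \<open>Only the edge recorded at time 0 contributes to the sum. If there is none,
      \<open>g\<close> is not a boundary path starting at the regular vertex \<open>v\<close>, and
      both sides vanish.\<close>
    proof (cases "\<exists>e. g \<in> boundary \<and> snd (g 0) = Some e \<and> fst (g 0) = v")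
      case True
      then obtain e where e: "g \<in> boundary" "snd (g 0) = Some e" "fst (g 0) = v" by blast
      then have "e \<in> out_arcs G v"
        using boundary_step[of g e] by auto
      moreover have "finite (out_arcs G v)"
        using v by (simp add: regular_verts_def)
      moreover have "(if g \<in> boundary \<and> snd (g 0) = Some e' then ?g else 0) = (if e' = e then ?g else 0)" for e'
        using e by auto
      ultimately show ?thesis
        using e by (simp only: app_linop_sum summand sum.delta) (simp add: boundary_ops)
    next
      case False
      then have "\<not> (g \<in> boundary \<and> fst (g 0) = v)"
        using boundary_stop[of g] v by (cases "snd (g 0)") auto
      moreover have "\<not> (g \<in> boundary \<and> snd (g 0) = Some e)" if "e \<in> out_arcs G v" for e
        using that False boundary_step[of g e] by auto
      then have "app (\<Sum>e\<in>out_arcs G v. partial_map_op (boundary_edge e) * partial_map_op (boundary_ghost e)) ?g = 0"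
        unfolding app_linop_sum by (intro sum.neutral ballI) (auto simp only: summand if_False)
      ultimately show ?thesis
        by (auto simp: boundary_ops)
    qed
  qed
  assume e: "e \<in> arcs G"
  show "partial_map_op (boundary_vertex (tail G e)) * partial_map_op (boundary_edge e) =
      (partial_map_op (boundary_edge e) :: (_, 'k) linop)"
    by (rule linop_eq_on_basis) (use e boundary_extend in \<open>auto simp: boundary_ops\<close>)
  show "partial_map_op (boundary_edge e) * partial_map_op (boundary_vertex (head G e)) =
      (partial_map_op (boundary_edge e) :: (_, 'k) linop)"
    by (rule linop_eq_on_basis) (auto simp: boundary_ops)
  show "partial_map_op (boundary_vertex (head G e)) * partial_map_op (boundary_ghost e) =
      (partial_map_op (boundary_ghost e) :: (_, 'k) linop)"
    by (rule linop_eq_on_basis) (use boundary_shift boundary_step in \<open>auto simp: boundary_ops\<close>)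
  show "partial_map_op (boundary_ghost e) * partial_map_op (boundary_vertex (tail G e)) =
      (partial_map_op (boundary_ghost e) :: (_, 'k) linop)"
    by (rule linop_eq_on_basis) (use boundary_step in \<open>auto simp: boundary_ops\<close>)
  assume f: "f \<in> arcs G"
  show "partial_map_op (boundary_ghost e) * partial_map_op (boundary_edge f) =
      (if e = f then partial_map_op (boundary_vertex (head G e)) else (0 :: (_, 'k) linop))"
    by (rule linop_eq_on_basis) (use f boundary_extend in \<open>auto simp: boundary_ops\<close>)
qed

text \<open>In the representation on boundary paths, a vertex fixes each boundary path that starts
  there, and one exists.\<close>

lemma vertex_notin_lpa_ideal:
  assumes v: "v \<in> verts G"
  shows "vx v \<notin> (lpa_ideal G :: (('a, 'b) lpa_gen list \<Rightarrow>\<^sub>0 'k::field) set)"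
proof
  interpret leavitt_family G "scalar_op :: 'k \<Rightarrow> _" "\<lambda>v. partial_map_op (boundary_vertex v)"
    "\<lambda>e. partial_map_op (boundary_edge e)" "\<lambda>e. partial_map_op (boundary_ghost e)"
    by (rule boundary_family)
  obtain g where g: "g \<in> boundary" "fst (g 0) = v"
    using v by (rule boundary_exists)
  assume "vx v \<in> (lpa_ideal G :: (('a, 'b) lpa_gen list \<Rightarrow>\<^sub>0 'k) set)"
  then have "partial_map_op (boundary_vertex v) = (0 :: (_, 'k) linop)"
    using ev_gen_lpa_ideal by fastforce
  then have "app (partial_map_op (boundary_vertex v) :: (_, 'k) linop) (Poly_Mapping.single g 1) = 0"
    by (simp add: zero_linop.rep_eq)
  then have "Poly_Mapping.single g (1 :: 'k) = 0"
    using g by (simp add: boundary_ops)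
  then have "Poly_Mapping.lookup (Poly_Mapping.single g (1 :: 'k)) g = Poly_Mapping.lookup 0 g"
    by (simp only:)
  then show False by simp
qed

end

section \<open>Reduction of homogeneous elements\<close>

inductive_set (in central_scalars) lspan :: "'a set \<Rightarrow> 'a set" for M where
  zero: "0 \<in> lspan M"
| step: "m \<in> M \<Longrightarrow> y \<in> lspan M \<Longrightarrow> sc c * m + y \<in> lspan M"

context central_scalars
begin

lemma lspan_add: "x \<in> lspan M \<Longrightarrow> y \<in> lspan M \<Longrightarrow> x + y \<in> lspan M"
  by (induction x rule: lspan.induct) (auto simp: add.assoc intro: lspan.step)

lemma lspan_base: "m \<in> M \<Longrightarrow> m \<in> lspan M"
  using lspan.step[of m M 0 1] by (simp add: lspan.zero)

lemma lspan_scale: "x \<in> lspan M \<Longrightarrow> sc c * x \<in> lspan M"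
proof (induction x rule: lspan.induct)
  case (step m y d)
  then show ?case
    using lspan.step[of m M "sc c * y" "c * d"] by (simp add: distrib_left sc_mult mult.assoc)
qed (simp add: lspan.zero)

lemma lspan_uminus: "x \<in> lspan M \<Longrightarrow> - x \<in> lspan M"
  using lspan_scale[of x M "- 1"] by (simp add: sc_uminus)

lemma lspan_diff: "x \<in> lspan M \<Longrightarrow> y \<in> lspan M \<Longrightarrow> x - y \<in> lspan M"
  using lspan_add[of x M "- y"] lspan_uminus[of y M] by simp

lemma lspan_sum: "(\<And>n. n \<in> N \<Longrightarrow> f n \<in> lspan M) \<Longrightarrow> sum f N \<in> lspan M"
  by (induction N rule: infinite_finite_induct) (auto intro: lspan_add lspan.zero)

lemma lspan_mult_right:
  assumes "x \<in> lspan M" "\<And>m. m \<in> M \<Longrightarrow> m * a \<in> lspan M'"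
  shows "x * a \<in> lspan M'"
  using assms(1)
proof (induction x rule: lspan.induct)
  case (step m y c)
  then show ?case
    using lspan_add[OF lspan_scale[OF assms(2)]] by (simp add: distrib_right mult.assoc)
qed (simp add: lspan.zero)

lemma lspan_mult_left:
  assumes "x \<in> lspan M" "\<And>m. m \<in> M \<Longrightarrow> a * m \<in> lspan M'"
  shows "a * x \<in> lspan M'"
  using assms(1)
proof (induction x rule: lspan.induct)
  case (step m y c)
  then show ?case
    using lspan_add[OF lspan_scale[OF assms(2)]] by (simp add: distrib_left sc_left_commute)
qed (simp add: lspan.zero)

lemma lspan_subset:
  assumes "x \<in> lspan M" "\<And>m. m \<in> M \<Longrightarrow> m \<in> lspan M'"
  shows "x \<in> lspan M'"
  using lspan_mult_right[OF assms(1), of 1 M'] assms(2) by simp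

end

lemma (in wf_digraph) awalk_append_ex: "awalk u (p @ q) v \<longleftrightarrow> (\<exists>w. awalk u p w \<and> awalk w q v)"
  by (auto dest: awlast_of_awalk)

section \<open>Products of real paths, ghost paths and gap projections\<close>

context leavitt_family
begin

text \<open>The empty path evaluates to 1, which need not come from the Leavitt path algebra. Path
  monomials therefore carry an explicit vertex factor in the middle.\<close>

abbreviation SS :: "'e list \<Rightarrow> 'a" where "SS \<alpha> \<equiv> prod_list (map S \<alpha>)"
abbreviation TT :: "'e list \<Rightarrow> 'a" where "TT \<alpha> \<equiv> prod_list (map T (rev \<alpha>))"

lemma PP_same [simp]: "v \<in> verts E \<Longrightarrow> P v * P v = P v"
  by (simp add: PP)

lemma assoc_relations [simp]:
  "v \<in> verts E \<Longrightarrow> P v * (P v * x) = P v * x"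
  "e \<in> arcs E \<Longrightarrow> P (tail E e) * (S e * x) = S e * x"
  "e \<in> arcs E \<Longrightarrow> S e * (P (head E e) * x) = S e * x"
  "e \<in> arcs E \<Longrightarrow> P (head E e) * (T e * x) = T e * x"
  "e \<in> arcs E \<Longrightarrow> T e * (P (tail E e) * x) = T e * x"
  by (simp_all flip: mult.assoc)

lemma orthogonal:
  "v \<in> verts E \<Longrightarrow> w \<in> verts E \<Longrightarrow> v \<noteq> w \<Longrightarrow> P v * P w = 0"
  "e \<in> arcs E \<Longrightarrow> v \<in> verts E \<Longrightarrow> v \<noteq> tail E e \<Longrightarrow> P v * S e = 0"
  "e \<in> arcs E \<Longrightarrow> v \<in> verts E \<Longrightarrow> v \<noteq> head E e \<Longrightarrow> S e * P v = 0"
  "e \<in> arcs E \<Longrightarrow> v \<in> verts E \<Longrightarrow> v \<noteq> head E e \<Longrightarrow> P v * T e = 0"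
  "e \<in> arcs E \<Longrightarrow> v \<in> verts E \<Longrightarrow> v \<noteq> tail E e \<Longrightarrow> T e * P v = 0"
proof -
  show "v \<in> verts E \<Longrightarrow> w \<in> verts E \<Longrightarrow> v \<noteq> w \<Longrightarrow> P v * P w = 0"
    by (simp add: PP)
  assume *: "e \<in> arcs E" "v \<in> verts E"
  then have h: "tail E e \<in> verts E" "head E e \<in> verts E"
    by auto
  show "P v * S e = 0" if "v \<noteq> tail E e"
    using PS[OF *(1)] PP[OF *(2) h(1)] that by (metis mult.assoc mult_zero_left)
  show "S e * P v = 0" if "v \<noteq> head E e"
    using SP[OF *(1)] PP[OF h(2) *(2)] that by (metis mult.assoc mult_zero_right)
  show "P v * T e = 0" if "v \<noteq> head E e"
    using PT[OF *(1)] PP[OF *(2) h(2)] that by (metis mult.assoc mult_zero_left)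
  show "T e * P v = 0" if "v \<noteq> tail E e"
    using TP[OF *(1)] PP[OF h(1) *(2)] that by (metis mult.assoc mult_zero_right)
qed

lemma PP_assoc: "v \<in> verts E \<Longrightarrow> w \<in> verts E \<Longrightarrow> P v * (P w * x) = (if v = w then P v * x else 0)"
  using PP[of v w] by (metis mult.assoc mult_zero_left)

lemma TS_assoc: "e \<in> arcs E \<Longrightarrow> f \<in> arcs E \<Longrightarrow> T e * (S f * x) = (if e = f then P (head E e) * x else 0)"
  using TS[of e f] by (metis mult.assoc mult_zero_left)

lemma P_S_assoc:
  "e \<in> arcs E \<Longrightarrow> v \<in> verts E \<Longrightarrow> P v * (S e * x) = (if v = tail E e then S e * x else 0)"
  using orthogonal(2)[of e v] by (metis assoc_relations(2) mult.assoc mult_zero_left)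

lemma P_SS:
  assumes "awalk u \<alpha> w" "v \<in> verts E"
  shows "P v * (SS \<alpha> * (P w * x)) = (if v = u then SS \<alpha> * (P w * x) else 0)"
proof (cases \<alpha>)
  case Nil
  then show ?thesis
    using assms by (auto simp: awalk_simps PP_assoc)
next
  case (Cons e \<alpha>')
  then have "e \<in> arcs E" "tail E e = u"
    using assms(1) by (simp_all add: awalk_simps)
  then show ?thesis
    using assms(2) Cons by (simp add: mult.assoc P_S_assoc)
qed

lemma TT_P:
  assumes "awalk u \<beta> w" "v \<in> verts E"
  shows "P w * (TT \<beta> * P v) = (if v = u then P w * TT \<beta> else 0)"
  using assms
  by (cases \<beta>) (auto simp: awalk_simps PP mult.assoc orthogonal(5))

lemma TT_SS_prefix:
  assumes "awalk u \<alpha> v" "awalk v \<gamma> w"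
  shows "TT \<alpha> * (SS (\<alpha> @ \<gamma>) * P w) = SS \<gamma> * P w"
  using assms
proof (induction \<alpha> arbitrary: u)
  case (Cons e \<alpha>)
  then have e: "e \<in> arcs E" "awalk (head E e) (\<alpha> @ \<gamma>) w"
    by (auto simp: awalk_simps awalk_append_ex simp del: awalk_append_iff)
  then have "P (head E e) * (SS (\<alpha> @ \<gamma>) * P w) = SS (\<alpha> @ \<gamma>) * P w"
    using P_SS[OF e(2), of "head E e" 1] by auto
  moreover have "TT \<alpha> * (SS (\<alpha> @ \<gamma>) * P w) = SS \<gamma> * P w"
    using Cons by (auto simp: awalk_simps)
  ultimately show ?case
    using e(1) by (simp add: mult.assoc TS_assoc)
qed simp

text \<open>The common initial edges cancel in pairs until two different edges meet, whose product
  is 0.\<close>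

lemma TT_SS_incomparable:
  assumes "awalk u \<alpha> v" "awalk u' \<beta> v'" "\<nexists>\<gamma>. \<beta> = \<alpha> @ \<gamma>" "\<nexists>\<gamma>. \<alpha> = \<beta> @ \<gamma>"
  shows "TT \<alpha> * SS \<beta> = 0"
  using assms
proof (induction \<alpha> arbitrary: u u' \<beta>)
  case (Cons e \<alpha>)
  then obtain f \<beta>' where \<beta>: "\<beta> = f # \<beta>'"
    by (cases \<beta>) auto
  with Cons.prems have arcs: "e \<in> arcs E" "f \<in> arcs E"
    by (auto simp: awalk_simps)
  show ?case
  proof (cases "e = f")
    case True
    \<comment> \<open>The tail of \<beta> is nonempty, since otherwise \<beta> would be a prefix of
      the other path.\<close>
    with \<beta> Cons.prems obtain g \<beta>'' where \<beta>': "\<beta>' = g # \<beta>''"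
      by (cases \<beta>') auto
    have "TT \<alpha> * SS \<beta>' = 0"
      using Cons.prems True \<beta> by (intro Cons.IH) (auto simp: awalk_simps)
    moreover have "P (head E e) * SS \<beta>' = SS \<beta>'"
      using Cons.prems(2) True \<beta> \<beta>' by (auto simp: awalk_simps)
    ultimately show ?thesis
      using True \<beta> arcs by (simp add: mult.assoc TS_assoc)
  qed (use arcs \<beta> in \<open>simp add: mult.assoc TS_assoc\<close>)
qed simp

text \<open>The difference is the projection at \<open>u\<close> complementary to the edges in
  \<open>G\<close>, called a gap here. It erases the edges in \<open>G\<close> and is invisible to
  the other edges at \<open>u\<close>.\<close>

lemma T_gap:
  assumes "finite G" "G \<subseteq> out_arcs E u" "f \<in> out_arcs E u"
  shows "T f * (P u - (\<Sum>e\<in>G. S e * T e)) = (if f \<in> G then 0 else T f)"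
proof -
  have "T f * (\<Sum>e\<in>G. S e * T e) = (\<Sum>e\<in>G. if e = f then T f else 0)"
    unfolding sum_distrib_left using assms by (intro sum.cong) (auto simp: TS_assoc)
  then show ?thesis
    using assms by (auto simp: right_diff_distrib)
qed

lemma gap_S:
  assumes "finite G" "G \<subseteq> out_arcs E u" "f \<in> out_arcs E u"
  shows "(P u - (\<Sum>e\<in>G. S e * T e)) * S f = (if f \<in> G then 0 else S f)"
proof -
  have "(\<Sum>e\<in>G. S e * T e) * S f = (\<Sum>e\<in>G. if e = f then S f else 0)"
    unfolding sum_distrib_right using assms by (intro sum.cong) (auto simp: mult.assoc TS)
  then show ?thesis
    using assms by (auto simp: left_diff_distrib)
qed

end

text \<open>\<open>N\<close> absorbs the generators of the family, not the ambient ring, which may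
  be larger than the algebra. No grading of \<open>N\<close> is assumed: homogeneity is imposed on
  elements, so that one locale serves the given ideal and the kernel of the hedgehog map.\<close>

locale leavitt_ideal = leavitt_family E sc P S T
  for E :: "('v, 'e) pre_digraph" and sc :: "'k::field \<Rightarrow> 'a::ring_1" and P S T +
  fixes N :: "'a set"
  assumes N_add: "x \<in> N \<Longrightarrow> y \<in> N \<Longrightarrow> x + y \<in> N"
    and N_scale: "x \<in> N \<Longrightarrow> sc c * x \<in> N"
    and N_P: "x \<in> N \<Longrightarrow> v \<in> verts E \<Longrightarrow> P v * x \<in> N" "x \<in> N \<Longrightarrow> v \<in> verts E \<Longrightarrow> x * P v \<in> N"
    and N_S: "x \<in> N \<Longrightarrow> e \<in> arcs E \<Longrightarrow> S e * x \<in> N" "x \<in> N \<Longrightarrow> e \<in> arcs E \<Longrightarrow> x * S e \<in> N"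
    and N_T: "x \<in> N \<Longrightarrow> e \<in> arcs E \<Longrightarrow> T e * x \<in> N" "x \<in> N \<Longrightarrow> e \<in> arcs E \<Longrightarrow> x * T e \<in> N"
begin

lemma N_diff: "x \<in> N \<Longrightarrow> y \<in> N \<Longrightarrow> x - y \<in> N"
  using N_add[of x "- y"] N_scale[of y "- 1"] by (simp add: sc_uminus)

text \<open>The element \<open>x\<close> provides the value 0 of the empty sum, as \<open>N\<close>
  is not assumed to be nonempty.\<close>

lemma N_sum: "finite I \<Longrightarrow> x \<in> N \<Longrightarrow> (\<And>i. i \<in> I \<Longrightarrow> f i \<in> N) \<Longrightarrow> sum f I \<in> N"
proof (induction I rule: finite_induct)
  case empty
  then show ?case using N_diff[of x x] by simp
qed (auto intro: N_add)

lemma N_TT: "x \<in> N \<Longrightarrow> set \<alpha> \<subseteq> arcs E \<Longrightarrow> TT \<alpha> * x \<in> N"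
  by (induction \<alpha> arbitrary: x) (auto simp: mult.assoc N_T)

section \<open>The vertices of an ideal, its breaking vertices and their projections\<close>

definition H :: "'v set" where
  "H = {v \<in> verts E. P v \<in> N}"

definition exits :: "'v \<Rightarrow> 'e set" where
  "exits w = {e \<in> out_arcs E w. head E e \<notin> H}"

definition q :: "'v \<Rightarrow> 'a" where
  "q w = P w - (\<Sum>e\<in>exits w. S e * T e)"

text \<open>The infinite emitters outside \<open>H\<close> that occur here are breaking vertices:
  they have an exit, since otherwise \<open>q w = P w\<close> would put them into \<open>H\<close>.
  A regular vertex contributes nothing new, because its relation turns \<open>q w\<close> into a sum
  of products e e* over edges ending in \<open>H\<close>.\<close>

definition W :: "'v set" where
  "W = H \<union> {w \<in> verts E. infinite (out_arcs E w) \<and> finite (exits w) \<and> q w \<in> N}"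

definition J :: "'a set" where
  "J = lspan {SS \<alpha> * (q w * TT \<beta>) |\<alpha> w \<beta>. w \<in> W \<and> (\<exists>u. awalk u \<alpha> w) \<and> (\<exists>v. awalk v \<beta> w)}"

lemma hereditary: "e \<in> arcs E \<Longrightarrow> tail E e \<in> H \<Longrightarrow> head E e \<in> H"
proof -
  assume e: "e \<in> arcs E" "tail E e \<in> H"
  then have "T e * P (tail E e) * S e \<in> N"
    by (intro N_S(2) N_T(1)) (auto simp: H_def)
  then show ?thesis
    using e(1) by (simp add: TS H_def)
qed

lemma hereditary_awalk: "awalk u \<alpha> w \<Longrightarrow> u \<in> H \<Longrightarrow> w \<in> H"
  by (induction \<alpha> arbitrary: u) (auto simp: awalk_simps hereditary)

lemma exits_H: "w \<in> H \<Longrightarrow> exits w = {}"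
  by (auto simp: exits_def hereditary)

lemma q_H: "w \<in> H \<Longrightarrow> q w = P w"
  by (simp add: q_def exits_H)

lemma W_verts: "w \<in> W \<Longrightarrow> w \<in> verts E"
  by (auto simp: W_def H_def)

lemma finite_exits: "w \<in> W \<Longrightarrow> finite (exits w)"
  by (auto simp: W_def exits_H)

lemma exits_subset: "exits w \<subseteq> out_arcs E w"
  by (auto simp: exits_def)

lemma q_in_N: "w \<in> W \<Longrightarrow> q w \<in> N"
  using q_H by (auto simp: W_def H_def)

lemma P_q: "w \<in> W \<Longrightarrow> P w * q w = q w"
  using W_verts exits_subset
  by (fastforce simp: q_def right_diff_distrib sum_distrib_left intro!: sum.cong)

lemma q_P: "w \<in> W \<Longrightarrow> q w * P w = q w"
  using W_verts exits_subset
  by (fastforce simp: q_def left_diff_distrib sum_distrib_right mult.assoc intro!: sum.cong)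

lemma q_S: "w \<in> W \<Longrightarrow> e \<in> out_arcs E w \<Longrightarrow> q w * S e = (if head E e \<in> H then S e else 0)"
  unfolding q_def by (subst gap_S[OF finite_exits exits_subset]) (auto simp: exits_def)

lemma T_q: "w \<in> W \<Longrightarrow> e \<in> out_arcs E w \<Longrightarrow> T e * q w = (if head E e \<in> H then T e else 0)"
  unfolding q_def by (subst T_gap[OF finite_exits exits_subset]) (auto simp: exits_def)

lemma q_q: "w \<in> W \<Longrightarrow> q w * q w = q w"
proof -
  assume w: "w \<in> W"
  have "q w * (\<Sum>e\<in>exits w. S e * T e) = 0"
    unfolding sum_distrib_left
  proof (rule sum.neutral, rule ballI)
    fix e
    assume e: "e \<in> exits w"
    then have "q w * S e = 0"
      using q_S[OF w] by (auto simp: exits_def)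
    then show "q w * (S e * T e) = 0"
      by (metis mult.assoc mult_zero_left)
  qed
  then show ?thesis
    \<comment> \<open>Only the right factor is expanded, so that the left \<open>q w\<close> can
      annihilate each exit.\<close>
    unfolding q_def[of w, THEN arg_cong[of _ _ "\<lambda>y. q w * y"]] right_diff_distrib
    using q_P[OF w] by simp
qed

text \<open>Elements of weight \<open>d\<close> whose ghost paths all start at \<open>u\<close> and
  have length at most \<open>m\<close>; the bound \<open>m\<close> drives the induction. The weight
  of edges is a parameter: it is constantly 1 for the given ideal and the length of quills for the
  kernel.\<close>

definition hom :: "('e \<Rightarrow> int) \<Rightarrow> 'v \<Rightarrow> int \<Rightarrow> nat \<Rightarrow> 'a set" where
  "hom wt u d m = lspan {SS \<alpha> * (P w * TT \<beta>) |\<alpha> w \<beta>. (\<exists>v. awalk v \<alpha> w) \<and> awalk u \<beta> w \<and>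
     sum_list (map wt \<alpha>) - sum_list (map wt \<beta>) = d \<and> length \<beta> \<le> m}"

definition pure :: "('e \<Rightarrow> int) \<Rightarrow> 'v \<Rightarrow> int \<Rightarrow> 'a set" where
  "pure wt u d = lspan {SS \<alpha> * P u |\<alpha>. (\<exists>v. awalk v \<alpha> u) \<and> sum_list (map wt \<alpha>) = d}"

lemma hom_base:
  "awalk v \<alpha> w \<Longrightarrow> awalk u \<beta> w \<Longrightarrow> sum_list (map wt \<alpha>) - sum_list (map wt \<beta>) = d \<Longrightarrow>
     length \<beta> \<le> m \<Longrightarrow> SS \<alpha> * (P w * TT \<beta>) \<in> hom wt u d m"
  unfolding hom_def by (rule lspan_base) blast

lemma hom_P: "x \<in> hom wt u d m \<Longrightarrow> x * P u = x"
  unfolding hom_def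
proof (induction x rule: lspan.induct)
  case (step m y c)
  then show ?case
    using awalk_hd_in_verts by (auto simp: distrib_right mult.assoc TT_P)
qed simp

text \<open>The first edge of \<beta> is the last ghost factor. An edge on the right cancels it or
  meets a different one and gives 0; if \<beta> is empty, the edge extends the real path instead.
  The bound on ghost paths drops in each case.\<close>

lemma hom_S:
  assumes "x \<in> hom wt u d (Suc m)" "e \<in> out_arcs E u"
  shows "x * S e \<in> hom wt (head E e) (d + wt e) m"
  using assms(1) unfolding hom_def
proof (rule lspan_mult_right)
  fix a
  assume "a \<in> {SS \<alpha> * (P w * TT \<beta>) |\<alpha> w \<beta>. (\<exists>v. awalk v \<alpha> w) \<and> awalk u \<beta> w \<and>
     sum_list (map wt \<alpha>) - sum_list (map wt \<beta>) = d \<and> length \<beta> \<le> Suc m}"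
  then obtain \<alpha> w \<beta> v where a: "a = SS \<alpha> * (P w * TT \<beta>)" "awalk v \<alpha> w" "awalk u \<beta> w"
    "sum_list (map wt \<alpha>) - sum_list (map wt \<beta>) = d" "length \<beta> \<le> Suc m"
    by blast
  have e: "e \<in> arcs E" "tail E e = u" "head E e \<in> verts E"
    using assms(2) by auto
  have PuS: "P u * S e = S e"
    using PS[OF e(1)] e(2) by simp
  have "a * S e \<in> hom wt (head E e) (d + wt e) m"
  proof (cases \<beta>)
    case Nil
    then have w: "w = u" using a(3) by (auto simp: awalk_simps)
    have "a * S e = SS (\<alpha> @ [e]) * (P (head E e) * TT [])"
      using a(1) e(1) PuS Nil w by (simp add: mult.assoc)
    also have "\<dots> \<in> hom wt (head E e) (d + wt e) m"
    proof (rule hom_base)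
      show "awalk v (\<alpha> @ [e]) (head E e)"
        using a(2) e w by (auto simp: awalk_append_ex awalk_simps simp del: awalk_append_iff)
    qed (use e a(4) Nil in \<open>auto simp: awalk_simps\<close>)
    finally show ?thesis .
  next
    case (Cons f \<beta>')
    then have f: "f \<in> arcs E" "awalk (head E f) \<beta>' w"
      using a(3) by (auto simp: awalk_simps)
    show ?thesis
    proof (cases "f = e")
      case True
      have "a * S e = SS \<alpha> * (P w * (TT \<beta>' * P (head E e)))"
        using a(1) Cons f(1) True by (simp add: mult.assoc TS)
      also have "\<dots> = SS \<alpha> * (P w * TT \<beta>')"
        using TT_P[OF f(2), of "head E e"] e True by simp
      also have "\<dots> \<in> hom wt (head E e) (d + wt e) m"
        using a(2) f(2) True a(4,5) Cons by (intro hom_base) auto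
      finally show ?thesis .
    next
      case False
      then have "a * S e = 0"
        using a(1) Cons f(1) e(1) by (simp add: mult.assoc TS)
      then show ?thesis by (simp add: hom_def lspan.zero)
    qed
  qed
  then show "a * S e \<in> lspan {SS \<alpha> * (P w * TT \<beta>) |\<alpha> w \<beta>. (\<exists>v. awalk v \<alpha> w) \<and> awalk (head E e) \<beta> w \<and>
     sum_list (map wt \<alpha>) - sum_list (map wt \<beta>) = d + wt e \<and> length \<beta> \<le> m}"
    unfolding hom_def .
qed

text \<open>A gap kills a monomial as soon as its edge set contains the first edge of the ghost
  path, and only finitely many monomials occur. Larger sets \<open>G'\<close> are allowed because at
  a regular vertex all edges will be taken.\<close>

lemma hom_pure_part:
  assumes "x \<in> hom wt u d m"
  shows "\<exists>z\<in>pure wt u d. \<exists>G. finite G \<and> G \<subseteq> out_arcs E u \<and>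
    (\<forall>G'. finite G' \<longrightarrow> G \<subseteq> G' \<longrightarrow> G' \<subseteq> out_arcs E u \<longrightarrow>
       x * (P u - (\<Sum>e\<in>G'. S e * T e)) = z * (P u - (\<Sum>e\<in>G'. S e * T e)))"
  using assms unfolding hom_def
proof (induction x rule: lspan.induct)
  case zero
  then show ?case
    by (intro bexI[of _ 0] exI[of _ "{}"]) (auto simp: pure_def lspan.zero)
next
  case (step a y c)
  then obtain z G where z: "z \<in> pure wt u d" "finite G" "G \<subseteq> out_arcs E u"
    "\<And>G'. finite G' \<Longrightarrow> G \<subseteq> G' \<Longrightarrow> G' \<subseteq> out_arcs E u \<Longrightarrow>
       y * (P u - (\<Sum>e\<in>G'. S e * T e)) = z * (P u - (\<Sum>e\<in>G'. S e * T e))"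
    by blast
  from step.hyps(1) obtain \<alpha> w \<beta> v where a: "a = SS \<alpha> * (P w * TT \<beta>)" "awalk v \<alpha> w" "awalk u \<beta> w"
    "sum_list (map wt \<alpha>) - sum_list (map wt \<beta>) = d"
    by blast
  show ?case
  proof (cases \<beta>)
    case Nil
    then have "a = SS \<alpha> * P u" "awalk v \<alpha> u" "sum_list (map wt \<alpha>) = d"
      using a by (auto simp: awalk_simps)
    then have "sc c * a + z \<in> pure wt u d"
      using z(1) unfolding pure_def by (intro lspan.step) auto
    with z show ?thesis
      by (intro bexI[of _ "sc c * a + z"] exI[of _ G]) (auto simp: distrib_right)
  next
    case (Cons f \<beta>')
    then have f: "f \<in> out_arcs E u"
      using a(3) by (auto simp: awalk_simps)
    have "a * (P u - (\<Sum>e\<in>G'. S e * T e)) = 0" if "finite G'" "insert f G \<subseteq> G'" "G' \<subseteq> out_arcs E u" for G'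
      using T_gap[of G' u f] that f Cons a(1) by (simp add: mult.assoc)
    with z f show ?thesis
      by (intro bexI[of _ z] exI[of _ "insert f G"]) (auto simp: distrib_right mult.assoc)
  qed
qed

text \<open>Distinct paths of equal weight are incomparable when weights are positive, so the ghost
  of one path extracts its coefficient.\<close>

lemma pure_coefficient:
  assumes "z \<in> pure wt u d" "z \<noteq> 0" "\<And>e. e \<in> arcs E \<Longrightarrow> wt e > 0"
  obtains v \<alpha> c where "awalk v \<alpha> u" "c \<noteq> 0" "TT \<alpha> * z = sc c * P u"
proof -
  have "\<exists>A c. finite A \<and> (\<forall>\<alpha>\<in>A. (\<exists>v. awalk v \<alpha> u) \<and> sum_list (map wt \<alpha>) = d) \<and>
      z = (\<Sum>\<alpha>\<in>A. sc (c \<alpha>) * (SS \<alpha> * P u))"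
    using assms(1) unfolding pure_def
  proof (induction z rule: lspan.induct)
    case zero
    then show ?case by (intro exI[of _ "{}"]) auto
  next
    case (step a y b)
    then obtain A c where A: "finite A" "\<forall>\<alpha>\<in>A. (\<exists>v. awalk v \<alpha> u) \<and> sum_list (map wt \<alpha>) = d"
      "y = (\<Sum>\<alpha>\<in>A. sc (c \<alpha>) * (SS \<alpha> * P u))"
      by blast
    from step.hyps(1) obtain \<alpha> where \<alpha>: "a = SS \<alpha> * P u" "\<exists>v. awalk v \<alpha> u" "sum_list (map wt \<alpha>) = d"
      by blast
    \<comment> \<open>The path \<alpha> may already occur in \<open>A\<close>, in which case the two
      coefficients add up; \<open>c\<close> is read as 0 outside \<open>A\<close>.\<close>
    define c' where "c' \<beta> = (if \<beta> \<in> A then c \<beta> else 0) + (if \<beta> = \<alpha> then b else 0)" for \<beta>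
    have "(\<Sum>\<beta>\<in>insert \<alpha> A. sc (c' \<beta>) * (SS \<beta> * P u))
        = (\<Sum>\<beta>\<in>insert \<alpha> A. sc (if \<beta> \<in> A then c \<beta> else 0) * (SS \<beta> * P u))
        + (\<Sum>\<beta>\<in>insert \<alpha> A. if \<beta> = \<alpha> then sc b * (SS \<alpha> * P u) else 0)"
      unfolding sum.distrib[symmetric]
      by (intro sum.cong) (auto simp: c'_def sc_add distrib_right)
    also have "\<dots> = (\<Sum>\<beta>\<in>A. sc (if \<beta> \<in> A then c \<beta> else 0) * (SS \<beta> * P u)) + sc b * a"
      using A(1) by (auto simp: \<alpha>(1) insert_absorb sum.insert_if)
    also have "\<dots> = sc b * a + y"
      using A(3) by simp
    finally show ?case
      using A \<alpha> by (intro exI[of _ "insert \<alpha> A"] exI[of _ c']) auto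
  qed
  then obtain A c where A: "finite A" "\<And>\<alpha>. \<alpha> \<in> A \<Longrightarrow> \<exists>v. awalk v \<alpha> u"
    "\<And>\<alpha>. \<alpha> \<in> A \<Longrightarrow> sum_list (map wt \<alpha>) = d" "z = (\<Sum>\<alpha>\<in>A. sc (c \<alpha>) * (SS \<alpha> * P u))"
    by blast
  with \<open>z \<noteq> 0\<close> obtain \<alpha> where \<alpha>: "\<alpha> \<in> A" "c \<alpha> \<noteq> 0"
    by (metis (no_types, lifting) mult_zero_left sc_0 sum.neutral)
  then obtain v where v: "awalk v \<alpha> u"
    using A(2) by blast
  have pos: "\<gamma> = []" if "awalk v' \<gamma> w'" "sum_list (map wt \<gamma>) \<le> 0" for v' \<gamma> w'
  proof (rule ccontr)
    assume "\<gamma> \<noteq> []"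
    moreover have "\<forall>x\<in>set (map wt \<gamma>). 0 < x"
      using that(1) assms(3) by (auto simp: awalk_def)
    ultimately have "0 < sum_list (map wt \<gamma>)"
    proof (induction \<gamma>)
      case (Cons e \<gamma>)
      then show ?case
        by (cases "\<gamma> = []") auto
    qed simp
    with that(2) show False by simp
  qed
  have "TT \<alpha> * (sc (c \<beta>) * (SS \<beta> * P u)) = (if \<beta> = \<alpha> then sc (c \<alpha>) * P u else 0)" if \<beta>: "\<beta> \<in> A" for \<beta>
  proof -
    obtain v' where v': "awalk v' \<beta> u"
      using A(2) \<beta> by blast
    show ?thesis
    proof (cases "\<beta> = \<alpha>")
      case True
      have "TT \<alpha> * (SS \<alpha> * P u) = P u"
        using TT_SS_prefix[OF v, of "[]" u] v awalk_last_in_verts[OF v] by (simp add: awalk_simps)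
      with True show ?thesis
        by (simp add: sc_left_commute)
    next
      case False
      \<comment> \<open>If one path extends the other by \<gamma>, equal weights leave weight 0 for
        \<gamma>, and positivity makes \<gamma> empty.\<close>
      have "\<gamma> = []" if "\<beta> = \<alpha> @ \<gamma> \<or> \<alpha> = \<beta> @ \<gamma>" for \<gamma>
      proof -
        have "\<exists>v''. awalk v'' \<gamma> u"
          using that
        proof
          assume "\<beta> = \<alpha> @ \<gamma>"
          with v' show ?thesis by (simp only: awalk_append_ex) blast
        next
          assume "\<alpha> = \<beta> @ \<gamma>"
          with v show ?thesis by (simp only: awalk_append_ex) blast
        qed
        then show ?thesis
          using pos A(3)[OF \<alpha>(1)] A(3)[OF \<beta>] that by fastforce
      qed
      with False have "TT \<alpha> * SS \<beta> = 0"
        by (intro TT_SS_incomparable[OF v v']) auto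
      then have "TT \<alpha> * (SS \<beta> * P u) = 0"
        by (metis mult.assoc mult_zero_left)
      with False show ?thesis
        by (simp add: sc_left_commute)
    qed
  qed
  then have "TT \<alpha> * z = (\<Sum>\<beta>\<in>A. if \<beta> = \<alpha> then sc (c \<alpha>) * P u else 0)"
    unfolding A(4) sum_distrib_left by (rule sum.cong[OF refl])
  then have "TT \<alpha> * z = sc (c \<alpha>) * P u"
    using A(1) \<alpha>(1) by simp
  with v \<alpha>(2) that show thesis by blast
qed

end

definition gen_weight :: "('e \<Rightarrow> int) \<Rightarrow> ('v, 'e) lpa_gen \<Rightarrow> int" where
  "gen_weight wt g = (case g of Vertex v \<Rightarrow> 0 | Edge e \<Rightarrow> wt e | Ghost e \<Rightarrow> - wt e)"

section \<open>Reduction of homogeneous elements with a fixed right-hand vertex\<close>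

context leavitt_ideal
begin

lemma J_base: "w \<in> W \<Longrightarrow> awalk u \<alpha> w \<Longrightarrow> awalk v \<beta> w \<Longrightarrow> SS \<alpha> * (q w * TT \<beta>) \<in> J"
  unfolding J_def by (rule lspan_base) blast

lemmas lspan_mult_right_J = lspan_mult_right[where
  M' = "{SS \<alpha> * (q w * TT \<beta>) |\<alpha> w \<beta>. w \<in> W \<and> (\<exists>u. awalk u \<alpha> w) \<and> (\<exists>v. awalk v \<beta> w)}", folded J_def]

lemma J_0: "0 \<in> J"
  unfolding J_def by (rule lspan.zero)

lemma pure_q:
  assumes "z \<in> pure wt u d" "u \<in> W"
  shows "z * q u \<in> J"
proof (rule lspan_mult_right_J[OF assms(1)[unfolded pure_def]])
  fix a
  assume "a \<in> {SS \<alpha> * P u |\<alpha>. (\<exists>v. awalk v \<alpha> u) \<and> sum_list (map wt \<alpha>) = d}"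
  then obtain \<alpha> v where a: "a = SS \<alpha> * P u" "awalk v \<alpha> u"
    by blast
  have "awalk u [] u"
    using W_verts[OF assms(2)] by (simp add: awalk_simps)
  from J_base[OF assms(2) a(2) this] show "a * q u \<in> J"
    by (simp add: a(1) mult.assoc P_q[OF assms(2)])
qed

lemma pure_edge:
  assumes "z \<in> pure wt u d" "e \<in> out_arcs E u" "head E e \<in> H"
  shows "z * (S e * T e) \<in> J"
proof (rule lspan_mult_right_J[OF assms(1)[unfolded pure_def]])
  fix a
  assume "a \<in> {SS \<alpha> * P u |\<alpha>. (\<exists>v. awalk v \<alpha> u) \<and> sum_list (map wt \<alpha>) = d}"
  then obtain \<alpha> v where a: "a = SS \<alpha> * P u" "awalk v \<alpha> u"
    by blast
  have e: "e \<in> arcs E" "u = tail E e" "head E e \<in> verts E" "head E e \<in> W"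
    using assms(2,3) by (auto simp: W_def)
  have "awalk v (\<alpha> @ [e]) (head E e)" "awalk u [e] (head E e)"
    using a(2) e by (auto simp: awalk_append_ex awalk_simps simp del: awalk_append_iff)
  from J_base[OF e(4) this] show "a * (S e * T e) \<in> J"
    using e by (simp add: a(1) mult.assoc q_H[OF assms(3)])
qed

text \<open>Serves to pass from \<open>x * S e\<close> back to \<open>x * (S e * T e)\<close>: a
  ghost edge on the right either prolongs the ghost path or gives 0.\<close>

lemma J_T:
  assumes "x \<in> J" "e \<in> arcs E"
  shows "x * T e \<in> J"
proof (rule lspan_mult_right_J[OF assms(1)[unfolded J_def]])
  fix a
  assume "a \<in> {SS \<alpha> * (q w * TT \<beta>) |\<alpha> w \<beta>. w \<in> W \<and> (\<exists>u. awalk u \<alpha> w) \<and> (\<exists>v. awalk v \<beta> w)}"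
  then obtain \<alpha> w \<beta> v u where a: "a = SS \<alpha> * (q w * TT \<beta>)" "w \<in> W" "awalk u \<alpha> w" "awalk v \<beta> w"
    by blast
  have "a * T e = SS \<alpha> * (q w * (P w * (TT \<beta> * (P (head E e) * T e))))"
    using a(1) q_P[OF a(2)] assms(2) by (simp add: mult.assoc flip: mult.assoc[of "q w" "P w"])
  also have "\<dots> = SS \<alpha> * (q w * ((P w * (TT \<beta> * P (head E e))) * T e))"
    by (simp add: mult.assoc)
  also have "\<dots> = (if head E e = v then SS \<alpha> * (q w * TT (e # \<beta>)) else 0)"
    using TT_P[OF a(4), of "head E e"] assms(2) q_P[OF a(2)]
    by (auto simp: mult.assoc simp flip: mult.assoc[of "q w" "P w"])
  finally have eq: "a * T e = (if head E e = v then SS \<alpha> * (q w * TT (e # \<beta>)) else 0)" .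
  show "a * T e \<in> J"
  proof (cases "head E e = v")
    case True
    then have "awalk (tail E e) (e # \<beta>) w"
      using a(4) assms(2) by (simp add: awalk_simps)
    from J_base[OF a(2,3) this] True show ?thesis
      by (simp add: eq)
  qed (simp add: eq J_0)
qed

text \<open>A ghost path of \<open>x\<close> starts at \<open>u\<close>, so by heredity its end lies
  in \<open>H\<close>, where \<open>q w = P w\<close>. Every monomial is then a generator of
  \<open>J\<close>.\<close>

lemma hom_of_H:
  assumes "x \<in> hom wt u d m" "u \<in> H"
  shows "x \<in> J"
  using assms(1) unfolding hom_def J_def
proof (rule lspan_subset)
  fix a
  assume "a \<in> {SS \<alpha> * (P w * TT \<beta>) |\<alpha> w \<beta>. (\<exists>v. awalk v \<alpha> w) \<and> awalk u \<beta> w \<and>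
     sum_list (map wt \<alpha>) - sum_list (map wt \<beta>) = d \<and> length \<beta> \<le> m}"
  then obtain \<alpha> w \<beta> v where a: "a = SS \<alpha> * (P w * TT \<beta>)" "awalk v \<alpha> w" "awalk u \<beta> w"
    by blast
  then have "w \<in> H"
    using hereditary_awalk assms(2) by blast
  then have "w \<in> W" "a = SS \<alpha> * (q w * TT \<beta>)"
    using a by (auto simp: W_def q_H)
  then show "a \<in> lspan {SS \<alpha> * (q w * TT \<beta>) |\<alpha> w \<beta>. w \<in> W \<and> (\<exists>u. awalk u \<alpha> w) \<and> (\<exists>v. awalk v \<beta> w)}"
    using a by (intro lspan_base) blast
qed

lemma J_add: "x \<in> J \<Longrightarrow> y \<in> J \<Longrightarrow> x + y \<in> J"
  unfolding J_def by (rule lspan_add)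

lemma J_diff: "x \<in> J \<Longrightarrow> y \<in> J \<Longrightarrow> x - y \<in> J"
  unfolding J_def by (rule lspan_diff)

lemma J_sum: "(\<And>i. i \<in> A \<Longrightarrow> f i \<in> J) \<Longrightarrow> sum f A \<in> J"
  unfolding J_def by (rule lspan_sum)

text \<open>
  The key step: multiplying by the projection complementary to finitely many edges leaves only
  the part without ghost edges, and a nonzero such part puts the complementary projection itself
  into the ideal.
\<close>

lemma pure_gap:
  assumes z: "z \<in> pure wt u d" and wt: "\<And>e. e \<in> arcs E \<Longrightarrow> wt e > 0"
    and u: "u \<in> verts E" "u \<notin> H"
    and G: "finite G" "G \<subseteq> out_arcs E u" and "u \<in> regular_verts E \<Longrightarrow> G = out_arcs E u"
    and N: "z * (P u - (\<Sum>e\<in>G. S e * T e)) \<in> N"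
  shows "z * (P u - (\<Sum>e\<in>G. S e * T e)) \<in> J"
proof (cases "z = 0 \<or> u \<in> regular_verts E")
  case True
  \<comment> \<open>At a regular vertex \<open>G\<close> consists of all edges, and the gap is 0 by
    the relation at \<open>u\<close>.\<close>
  then have "z * (P u - (\<Sum>e\<in>G. S e * T e)) = 0"
    using assms(7) CK by auto
  then show ?thesis by (simp add: J_0)
next
  case False
  let ?g = "P u - (\<Sum>e\<in>G. S e * T e)"
  obtain v \<alpha> c where \<alpha>: "awalk v \<alpha> u" "c \<noteq> 0" "TT \<alpha> * z = sc c * P u"
    using pure_coefficient[OF z _ wt] False by blast
  have Pg: "P u * ?g = ?g"
  proof -
    have "P u * (\<Sum>e\<in>G. S e * T e) = (\<Sum>e\<in>G. S e * T e)"
      unfolding sum_distrib_left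
    proof (rule sum.cong[OF refl])
      fix e
      assume "e \<in> G"
      with G(2) have "e \<in> arcs E" "u = tail E e"
        by auto
      then show "P u * (S e * T e) = S e * T e"
        by simp
    qed
    then show ?thesis using u(1) by (simp add: right_diff_distrib)
  qed
  have "TT \<alpha> * (z * ?g) \<in> N"
    using N \<alpha>(1) by (intro N_TT) auto
  moreover have "TT \<alpha> * (z * ?g) = sc c * ?g"
    using \<alpha>(3) Pg by (metis mult.assoc)
  ultimately have "sc (inverse c) * (sc c * ?g) \<in> N"
    by (simp add: N_scale)
  then have g: "?g \<in> N"
    using \<alpha>(2) by (simp add: sc_inverse_left)
  \<comment> \<open>The gap fixes an edge outside \<open>G\<close> from the left, so the edge lies
    in \<open>N\<close>, and so does its range \<open>T e * S e\<close>. All exits are therefore in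
    the finite set \<open>G\<close>.\<close>
  have H: "head E e \<in> H" if "e \<in> out_arcs E u - G" for e
  proof -
    have e: "e \<in> arcs E"
      using that by auto
    have "?g * S e \<in> N"
      using g e by (rule N_S)
    then have "S e \<in> N"
      using gap_S[OF G, of e] that by simp
    then have "T e * S e \<in> N"
      using e by (intro N_T)
    then show ?thesis
      using e by (simp add: TS H_def)
  qed
  then have exits: "exits u \<subseteq> G"
    by (auto simp: exits_def)
  \<comment> \<open>Since \<open>G\<close> contains all exits, the gap differs from
    \<open>q u\<close> only by finitely many products e e* with range in \<open>H\<close>, which lie
    in \<open>N\<close>.\<close>
  then have split: "(\<Sum>e\<in>G. S e * T e) = (\<Sum>e\<in>exits u. S e * T e) + (\<Sum>e\<in>G - exits u. S e * T e)"
    using G(1) by (simp add: sum.subset_diff add.commute)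
  have GH: "head E e \<in> H" if "e \<in> G - exits u" for e
    using that G(2) by (auto simp: exits_def)
  have "S e * T e \<in> N" if "e \<in> G - exits u" for e
  proof -
    have "P (head E e) \<in> N" "e \<in> arcs E"
      using GH[OF that] that G(2) by (auto simp: H_def)
    then have "S e * P (head E e) * T e \<in> N"
      by (intro N_S N_T)
    with \<open>e \<in> arcs E\<close> show ?thesis by simp
  qed
  then have "(\<Sum>e\<in>G - exits u. S e * T e) \<in> N"
    using G(1) g by (intro N_sum[of _ ?g]) auto
  moreover have q: "?g = q u - (\<Sum>e\<in>G - exits u. S e * T e)"
    by (simp add: q_def split)
  ultimately have "q u \<in> N"
    using N_add[OF g] by (metis diff_add_cancel)
  \<comment> \<open>A finite emitter that is not regular is a sink; there the gap is
    \<open>P u\<close> itself, which would put \<open>u\<close> into \<open>H\<close>.\<close>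
  have "infinite (out_arcs E u)"
  proof
    assume "finite (out_arcs E u)"
    with False u(1) have "out_arcs E u = {}"
      by (auto simp: regular_verts_def)
    with G(2) g u show False
      by (simp add: H_def)
  qed
  with \<open>q u \<in> N\<close> u(1) have "u \<in> W"
    using exits G(1) finite_subset by (auto simp: W_def)
  have "z * ?g = z * q u - (\<Sum>e\<in>G - exits u. z * (S e * T e))"
    unfolding q right_diff_distrib sum_distrib_left ..
  moreover have "z * (S e * T e) \<in> J" if "e \<in> G - exits u" for e
    using that GH G(2) by (intro pure_edge[OF z]) auto
  ultimately show ?thesis
    using pure_q[OF z \<open>u \<in> W\<close>] by (auto intro: J_diff J_sum)
qed

text \<open>An element is split into its products with e e* for finitely many edges and its product
  with the gap. The former reduce to shorter ghost paths at other vertices and weights, hence the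
  generalisation over \<open>u\<close> and \<open>d\<close>; the latter is covered by
  \<open>pure_gap\<close>.\<close>

lemma hom_in_J:
  assumes "\<And>e. e \<in> arcs E \<Longrightarrow> wt e > 0" "u \<in> verts E" "x \<in> hom wt u d m" "x \<in> N"
  shows "x \<in> J"
  using assms(2-)
proof (induction m arbitrary: u d x)
  case 0
  show ?case
  proof (cases "u \<in> H")
    case True
    then show ?thesis using hom_of_H 0 by blast
  next
    case False
    have "x \<in> pure wt u d"
      using "0.prems"(2) unfolding hom_def pure_def
    proof (rule lspan_subset)
      fix a
      assume "a \<in> {SS \<alpha> * (P w * TT \<beta>) |\<alpha> w \<beta>. (\<exists>v. awalk v \<alpha> w) \<and> awalk u \<beta> w \<and>
        sum_list (map wt \<alpha>) - sum_list (map wt \<beta>) = d \<and> length \<beta> \<le> 0}"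
      then have "a \<in> {SS \<alpha> * P u |\<alpha>. (\<exists>v. awalk v \<alpha> u) \<and> sum_list (map wt \<alpha>) = d}"
        by (auto simp: awalk_simps)
      then show "a \<in> lspan {SS \<alpha> * P u |\<alpha>. (\<exists>v. awalk v \<alpha> u) \<and> sum_list (map wt \<alpha>) = d}"
        by (rule lspan_base)
    qed
    \<comment> \<open>Without ghost edges, a nonzero element would yield a nonzero multiple of
      \<open>P u\<close> in \<open>N\<close>, against \<open>u \<notin> H\<close>.\<close>
    have "x = 0"
    proof (rule ccontr)
      assume "x \<noteq> 0"
      then obtain v \<alpha> c where \<alpha>: "awalk v \<alpha> u" "c \<noteq> 0" "TT \<alpha> * x = sc c * P u"
        using pure_coefficient[OF \<open>x \<in> pure wt u d\<close> _ assms(1)] by blast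
      have "TT \<alpha> * x \<in> N"
        using \<alpha>(1) 0 by (intro N_TT) auto
      then have "sc (inverse c) * (sc c * P u) \<in> N"
        unfolding \<alpha>(3) by (rule N_scale)
      with \<alpha>(2) False 0 show False
        by (simp add: sc_inverse_left H_def)
    qed
    then show ?thesis by (simp add: J_0)
  qed
next
  case (Suc m)
  show ?case
  proof (cases "u \<in> H")
    case True
    then show ?thesis using hom_of_H Suc.prems by blast
  next
    case False
    obtain z G0 where z: "z \<in> pure wt u d" and G0: "finite G0" "G0 \<subseteq> out_arcs E u"
      and eq: "\<And>G'. finite G' \<Longrightarrow> G0 \<subseteq> G' \<Longrightarrow> G' \<subseteq> out_arcs E u \<Longrightarrow>
        x * (P u - (\<Sum>e\<in>G'. S e * T e)) = z * (P u - (\<Sum>e\<in>G'. S e * T e))"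
      using hom_pure_part[OF Suc.prems(2)] by blast
    \<comment> \<open>At a regular vertex all edges are taken, which makes the gap vanish. Elsewhere
      the finite set from \<open>hom_pure_part\<close> suffices.\<close>
    define G where "G = (if u \<in> regular_verts E then out_arcs E u else G0)"
    have G: "finite G" "G0 \<subseteq> G" "G \<subseteq> out_arcs E u"
      using G0 by (auto simp: G_def regular_verts_def)
    have edge: "x * (S e * T e) \<in> J \<and> x * (S e * T e) \<in> N" if "e \<in> G" for e
    proof -
      have e: "e \<in> arcs E" "head E e \<in> verts E" "e \<in> out_arcs E u"
        using that G(3) by auto
      have "x * S e \<in> N"
        using Suc.prems e by (intro N_S)
      then have "x * S e \<in> J"
        using Suc.IH hom_S[OF Suc.prems(2) e(3)] e(2) by blast
      then have "x * S e * T e \<in> J" "x * S e * T e \<in> N"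
        using J_T e(1) N_T \<open>x * S e \<in> N\<close> by blast+
      then show ?thesis by (simp add: mult.assoc)
    qed
    have sumJ: "(\<Sum>e\<in>G. x * (S e * T e)) \<in> J"
      using edge by (intro J_sum) blast
    have sumN: "(\<Sum>e\<in>G. x * (S e * T e)) \<in> N"
      using edge Suc.prems(3) G(1) by (intro N_sum[of _ x]) blast+
    have decomp: "x = x * (P u - (\<Sum>e\<in>G. S e * T e)) + (\<Sum>e\<in>G. x * (S e * T e))"
      using hom_P[OF Suc.prems(2)] by (simp add: right_diff_distrib sum_distrib_left)
    then have "x * (P u - (\<Sum>e\<in>G. S e * T e)) \<in> N"
      using N_diff[OF Suc.prems(3) sumN] by (metis add_diff_cancel_right')
    then have "x * (P u - (\<Sum>e\<in>G. S e * T e)) \<in> J"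
      unfolding eq[OF G] using z False Suc.prems(1) G assms(1)
      by (intro pure_gap) (auto simp: G_def)
    then show ?thesis
      using decomp J_add[OF _ sumJ] by metis
  qed
qed

section \<open>Homogeneous elements with arbitrary right-hand vertices\<close>

definition homog :: "('e \<Rightarrow> int) \<Rightarrow> int \<Rightarrow> 'a set" where
  "homog wt d = lspan {SS \<alpha> * (P w * TT \<beta>) |\<alpha> w \<beta>. (\<exists>u. awalk u \<alpha> w) \<and> (\<exists>v. awalk v \<beta> w) \<and>
     sum_list (map wt \<alpha>) - sum_list (map wt \<beta>) = d}"

lemma hom_mono: "x \<in> hom wt u d m \<Longrightarrow> m \<le> m' \<Longrightarrow> x \<in> hom wt u d m'"
proof -
  assume "x \<in> hom wt u d m" "m \<le> m'"
  then have "x \<in> lspan {SS \<alpha> * (P w * TT \<beta>) |\<alpha> w \<beta>. (\<exists>v. awalk v \<alpha> w) \<and> awalk u \<beta> w \<and>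
     sum_list (map wt \<alpha>) - sum_list (map wt \<beta>) = d \<and> length \<beta> \<le> m}"
    by (simp add: hom_def)
  then have "x \<in> lspan {SS \<alpha> * (P w * TT \<beta>) |\<alpha> w \<beta>. (\<exists>v. awalk v \<alpha> w) \<and> awalk u \<beta> w \<and>
     sum_list (map wt \<alpha>) - sum_list (map wt \<beta>) = d \<and> length \<beta> \<le> m'}"
  proof (rule lspan_subset)
    fix a
    assume "a \<in> {SS \<alpha> * (P w * TT \<beta>) |\<alpha> w \<beta>. (\<exists>v. awalk v \<alpha> w) \<and> awalk u \<beta> w \<and>
     sum_list (map wt \<alpha>) - sum_list (map wt \<beta>) = d \<and> length \<beta> \<le> m}"
    then obtain \<alpha> w \<beta> v where "a = SS \<alpha> * (P w * TT \<beta>)" "awalk v \<alpha> w" "awalk u \<beta> w"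
      "sum_list (map wt \<alpha>) - sum_list (map wt \<beta>) = d" "length \<beta> \<le> m'"
      using \<open>m \<le> m'\<close> le_trans by blast
    then show "a \<in> lspan {SS \<alpha> * (P w * TT \<beta>) |\<alpha> w \<beta>. (\<exists>v. awalk v \<alpha> w) \<and> awalk u \<beta> w \<and>
     sum_list (map wt \<alpha>) - sum_list (map wt \<beta>) = d \<and> length \<beta> \<le> m'}"
      using hom_base unfolding hom_def by simp
  qed
  then show "x \<in> hom wt u d m'"
    by (simp add: hom_def)
qed

text \<open>There is no unit, but the finitely many vertices at which the ghost paths of
  \<open>x\<close> start act as a local unit on the right. Enlarging \<open>U\<close> is allowed so
  that the sets of two summands can be merged.\<close>

lemma homog_split:
  assumes "x \<in> homog wt d"
  shows "\<exists>m U. finite U \<and> U \<subseteq> verts E \<and> (\<forall>u\<in>verts E. x * P u \<in> hom wt u d m) \<and>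
    (\<forall>U'. finite U' \<longrightarrow> U \<subseteq> U' \<longrightarrow> U' \<subseteq> verts E \<longrightarrow> x = (\<Sum>u\<in>U'. x * P u))"
  using assms unfolding homog_def
proof (induction x rule: lspan.induct)
  case zero
  then show ?case
    by (intro exI[of _ 0] exI[of _ "{}"]) (auto simp: hom_def lspan.zero)
next
  case (step a y c)
  then obtain m U where U: "finite U" "U \<subseteq> verts E" "\<And>u. u \<in> verts E \<Longrightarrow> y * P u \<in> hom wt u d m"
    "\<And>U'. finite U' \<Longrightarrow> U \<subseteq> U' \<Longrightarrow> U' \<subseteq> verts E \<Longrightarrow> y = (\<Sum>u\<in>U'. y * P u)"
    by blast
  from step.hyps(1) obtain \<alpha> w \<beta> u v where a: "a = SS \<alpha> * (P w * TT \<beta>)" "awalk u \<alpha> w" "awalk v \<beta> w"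
    "sum_list (map wt \<alpha>) - sum_list (map wt \<beta>) = d"
    by blast
  have aP: "a * P v' = (if v' = v then a else 0)" if "v' \<in> verts E" for v'
    using TT_P[OF a(3) that] by (simp add: a(1) mult.assoc)
  have v: "v \<in> verts E"
    using a(3) by auto
  let ?m = "max m (length \<beta>)"
  have "a \<in> hom wt v d ?m"
    using a by (auto intro: hom_base)
  then have "a * P v' \<in> hom wt v' d ?m" if "v' \<in> verts E" for v'
    using aP[OF that] by (auto simp: hom_def lspan.zero)
  then have "(sc c * a + y) * P v' \<in> hom wt v' d ?m" if "v' \<in> verts E" for v'
    using hom_mono[OF U(3)[OF that], of ?m] that unfolding hom_def
    by (simp add: distrib_right mult.assoc lspan_add lspan_scale)
  moreover have "sc c * a + y = (\<Sum>u\<in>U'. (sc c * a + y) * P u)"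
    if U': "finite U'" "insert v U \<subseteq> U'" "U' \<subseteq> verts E" for U'
  proof -
    have "(\<Sum>u\<in>U'. sc c * (a * P u)) = (\<Sum>u\<in>U'. if u = v then sc c * a else 0)"
      using aP U'(3) by (intro sum.cong) auto
    also have "\<dots> = sc c * a"
      using U' by simp
    finally have "(\<Sum>u\<in>U'. sc c * (a * P u)) = sc c * a" .
    moreover have "(\<Sum>u\<in>U'. y * P u) = y"
      using U(4)[of U'] U' by simp
    ultimately show ?thesis
      by (simp add: distrib_right sum.distrib mult.assoc)
  qed
  ultimately show ?case
    using U(1,2) v by (intro exI[of _ ?m] exI[of _ "insert v U"]) auto
qed

text \<open>The reduction in the form in which it is applied twice: to the given ideal, to find
  generators, and to the kernel of the hedgehog map, to see that it vanishes.\<close>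

theorem homog_in_J:
  assumes "\<And>e. e \<in> arcs E \<Longrightarrow> wt e > 0" "x \<in> homog wt d" "x \<in> N"
  shows "x \<in> J"
proof -
  obtain m U where U: "finite U" "U \<subseteq> verts E" "\<And>u. u \<in> verts E \<Longrightarrow> x * P u \<in> hom wt u d m"
    "x = (\<Sum>u\<in>U. x * P u)"
    using homog_split[OF assms(2)] by blast
  have "x * P u \<in> J" if "u \<in> U" for u
    using that U(2) assms(3) by (intro hom_in_J[OF assms(1) _ U(3)] N_P) auto
  then show ?thesis
    using U(4) J_sum by metis
qed

section \<open>Words in the generators as combinations of path monomials\<close>

lemma homog_base:
  "awalk u \<alpha> w \<Longrightarrow> awalk v \<beta> w \<Longrightarrow> sum_list (map wt \<alpha>) - sum_list (map wt \<beta>) = d \<Longrightarrow>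
     SS \<alpha> * (P w * TT \<beta>) \<in> homog wt d"
  unfolding homog_def by (rule lspan_base) blast

lemma homog_0: "0 \<in> homog wt d"
  unfolding homog_def by (rule lspan.zero)

lemma homog_mult_left:
  assumes "x \<in> homog wt d"
    and "\<And>\<alpha> w \<beta> u v. awalk u \<alpha> w \<Longrightarrow> awalk v \<beta> w \<Longrightarrow> sum_list (map wt \<alpha>) - sum_list (map wt \<beta>) = d \<Longrightarrow>
      a * (SS \<alpha> * (P w * TT \<beta>)) \<in> homog wt d'"
  shows "a * x \<in> homog wt d'"
  using assms(1) unfolding homog_def
  by (rule lspan_mult_left) (use assms(2)[unfolded homog_def] in blast)

lemma homog_P:
  assumes "x \<in> homog wt d" "v \<in> verts E"
  shows "P v * x \<in> homog wt d"
  using assms(1)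
proof (rule homog_mult_left)
  fix \<alpha> w \<beta> u v'
  assume "awalk u \<alpha> w" "awalk v' \<beta> w" "sum_list (map wt \<alpha>) - sum_list (map wt \<beta>) = d"
  then show "P v * (SS \<alpha> * (P w * TT \<beta>)) \<in> homog wt d"
    using assms(2) by (simp add: P_SS homog_base homog_0)
qed

lemma homog_S:
  assumes "x \<in> homog wt d" "e \<in> arcs E"
  shows "S e * x \<in> homog wt (d + wt e)"
  using assms(1)
proof (rule homog_mult_left)
  fix \<alpha> w \<beta> u v
  assume *: "awalk u \<alpha> w" "awalk v \<beta> w" "sum_list (map wt \<alpha>) - sum_list (map wt \<beta>) = d"
  have "S e * (SS \<alpha> * (P w * TT \<beta>)) = S e * (P (head E e) * (SS \<alpha> * (P w * TT \<beta>)))"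
    using assms(2) by simp
  also have "\<dots> = (if head E e = u then SS (e # \<alpha>) * (P w * TT \<beta>) else 0)"
    using P_SS[OF *(1)] assms(2) by (simp add: mult.assoc)
  also have "\<dots> \<in> homog wt (d + wt e)"
  proof (cases "head E e = u")
    case True
    then have "awalk (tail E e) (e # \<alpha>) w"
      using *(1) assms(2) by (simp add: awalk_simps)
    from homog_base[OF this *(2), of wt "d + wt e"] True *(3) show ?thesis
      by simp
  qed (simp add: homog_0)
  finally show "S e * (SS \<alpha> * (P w * TT \<beta>)) \<in> homog wt (d + wt e)" .
qed

lemma homog_T:
  assumes "x \<in> homog wt d" "e \<in> arcs E"
  shows "T e * x \<in> homog wt (d - wt e)"
  using assms(1)
proof (rule homog_mult_left)
  fix \<alpha> w \<beta> u v
  assume *: "awalk u \<alpha> w" "awalk v \<beta> w" "sum_list (map wt \<alpha>) - sum_list (map wt \<beta>) = d"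
  show "T e * (SS \<alpha> * (P w * TT \<beta>)) \<in> homog wt (d - wt e)"
  proof (cases \<alpha>)
    case Nil
    then have w: "w \<in> verts E"
      using *(1) by (auto simp: awalk_simps)
    have eq: "T e * (SS \<alpha> * (P w * TT \<beta>)) = (if w = tail E e then SS [] * (P (head E e) * (TT (\<beta> @ [e]))) else 0)"
    proof (cases "w = tail E e")
      case True
      then show ?thesis using Nil assms(2) by simp
    next
      case False
      then have "T e * P w = 0"
        using orthogonal(5)[OF assms(2) w] by simp
      then have "T e * (P w * TT \<beta>) = 0"
        by (metis mult.assoc mult_zero_left)
      with False Nil show ?thesis by simp
    qed
    have "SS [] * (P (head E e) * (TT (\<beta> @ [e]))) \<in> homog wt (d - wt e)" if "w = tail E e"
    proof (rule homog_base)
      show "awalk v (\<beta> @ [e]) (head E e)"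
        using *(2) that assms(2) by (auto simp: awalk_append_ex awalk_simps simp del: awalk_append_iff)
    qed (use * Nil assms(2) in \<open>auto simp: awalk_simps\<close>)
    then show ?thesis
      unfolding eq by (simp only: homog_0 split: if_split) blast
  next
    case (Cons f \<alpha>')
    then have f: "f \<in> arcs E" "awalk (head E f) \<alpha>' w"
      using *(1) by (auto simp: awalk_simps)
    show ?thesis
    proof (cases "e = f")
      case True
      then have "T e * (SS \<alpha> * (P w * TT \<beta>)) = P (head E e) * (SS \<alpha>' * (P w * TT \<beta>))"
        using Cons f(1) by (simp add: mult.assoc TS_assoc)
      also have "\<dots> = SS \<alpha>' * (P w * TT \<beta>)"
        using P_SS[OF f(2), of "head E e"] f(1) True by simp
      finally show ?thesis
        using homog_base[OF f(2) *(2), of wt "d - wt e"] *(3) Cons True by simp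
    qed (use Cons f(1) assms(2) in \<open>simp add: mult.assoc TS_assoc homog_0\<close>)
  qed
qed

text \<open>Left multiplication by a generator sends path monomials to path monomials or 0 and
  shifts the weight. The empty word is excluded because its value 1 need not be of this
  form.\<close>

lemma word_homog:
  "w \<noteq> [] \<Longrightarrow> set w \<subseteq> lpa_gens E \<Longrightarrow> prod_list (map gen w) \<in> homog wt (sum_list (map (gen_weight wt) w))"
proof (induction w)
  case (Cons g w)
  show ?case
  proof (cases "w = []")
    case True
    have "gen g \<in> homog wt (gen_weight wt g)"
    proof (cases g)
      case (Vertex v)
      then have "v \<in> verts E"
        using Cons.prems by (auto simp: lpa_gens_def)
      then have "SS [] * (P v * TT []) \<in> homog wt (gen_weight wt g)"
        by (intro homog_base) (auto simp: awalk_simps gen_weight_def Vertex)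
      then show ?thesis by (simp add: Vertex)
    next
      case (Edge e)
      then have "e \<in> arcs E"
        using Cons.prems by (auto simp: lpa_gens_def)
      then have "SS [e] * (P (head E e) * TT []) \<in> homog wt (gen_weight wt g)"
        by (intro homog_base) (auto simp: awalk_simps gen_weight_def Edge)
      then show ?thesis using \<open>e \<in> arcs E\<close> by (simp add: Edge)
    next
      case (Ghost e)
      then have "e \<in> arcs E"
        using Cons.prems by (auto simp: lpa_gens_def)
      then have "SS [] * (P (head E e) * TT [e]) \<in> homog wt (gen_weight wt g)"
        by (intro homog_base) (auto simp: awalk_simps gen_weight_def Ghost)
      then show ?thesis using \<open>e \<in> arcs E\<close> by (simp add: Ghost)
    qed
    with True show ?thesis by simp
  next
    case False
    with Cons have w: "prod_list (map gen w) \<in> homog wt (sum_list (map (gen_weight wt) w))"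
      by auto
    have "g \<in> lpa_gens E"
      using Cons.prems by simp
    then have "gen g * prod_list (map gen w) \<in> homog wt (sum_list (map (gen_weight wt) w) + gen_weight wt g)"
      using homog_P[OF w] homog_S[OF w] homog_T[OF w]
      by (auto simp: lpa_gens_def gen_weight_def)
    then show ?thesis by (simp add: add.commute)
  qed
qed simp

lemma ev_homog:
  assumes "p \<in> carrier (free_algebra (lpa_gens E))"
    and "\<And>w. w \<in> Poly_Mapping.keys p \<Longrightarrow> sum_list (map (gen_weight wt) w) = d"
  shows "ev gen p \<in> homog wt d"
  unfolding ev_def homog_def
  by (intro lspan_sum lspan_scale) (use assms word_homog in \<open>fastforce simp: homog_def\<close>)

end

section \<open>The hedgehog graph of an ideal\<close>

context leavitt_ideal
begin

lemma TT_SS_same: "awalk u \<alpha> w \<Longrightarrow> TT \<alpha> * (SS \<alpha> * P w) = P w"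
  using TT_SS_prefix[of u \<alpha> w "[]" w] by (auto simp: awalk_Nil_iff)

definition internal :: "'e \<Rightarrow> bool" where
  "internal e \<longleftrightarrow> tail E e \<in> W \<and> head E e \<in> H"

definition target :: "'e list \<Rightarrow> 'v" where
  "target \<alpha> = head E (last \<alpha>)"

text \<open>
  Every path that ends in \<open>W\<close> is uniquely a vertex of \<open>W\<close> or a quill whose last edge is not internal,
  followed by internal edges. The internal edges are quills as well because they are edges of the
  hedgehog too.
\<close>

definition quills :: "'e list set" where
  "quills = {\<alpha>. \<alpha> \<noteq> [] \<and> (\<exists>u. awalk u \<alpha> (target \<alpha>)) \<and> target \<alpha> \<in> W \<and> (internal (last \<alpha>) \<longrightarrow> length \<alpha> = 1)}"

text \<open>One type serves vertices and edges. A vertex of \<open>W\<close> is a singleton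
  \<open>[Inl w]\<close>, and \<open>map Inr \<alpha>\<close> names both the edge of a quill and,
  unless its last edge is internal, the private vertex where that edge starts. The one-edge internal
  quills keep their source in \<open>W\<close>.\<close>

definition hedgehog :: "(('v + 'e) list, ('v + 'e) list) pre_digraph" where
  "hedgehog =
     \<lparr>verts = (\<lambda>w. [Inl w]) ` W \<union> map Inr ` {\<alpha> \<in> quills. \<not> internal (last \<alpha>)},
      arcs = map Inr ` quills,
      tail = (\<lambda>x. if internal (projr (last x)) then [Inl (tail E (projr (last x)))] else x),
      head = (\<lambda>x. [Inl (head E (projr (last x)))])\<rparr>"

text \<open>An edge \<alpha> is sent to \<alpha> q with q taken at its target. The two products of
  this element with its ghost are q and \<alpha> q \<alpha>*, which gives the value at a private
  vertex.\<close>

definition FP :: "('v + 'e) list \<Rightarrow> 'a" where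
  "FP x = (case hd x of Inl w \<Rightarrow> q w
     | Inr e \<Rightarrow> SS (map projr x) * (q (target (map projr x)) * TT (map projr x)))"

definition FS :: "('v + 'e) list \<Rightarrow> 'a" where
  "FS x = SS (map projr x) * q (target (map projr x))"

definition FT :: "('v + 'e) list \<Rightarrow> 'a" where
  "FT x = q (target (map projr x)) * TT (map projr x)"

lemma quills_ne [simp]: "[] \<notin> quills"
  by (simp add: quills_def)

lemma quill_awalk:
  assumes "\<alpha> \<in> quills"
  obtains u where "awalk u \<alpha> (target \<alpha>)"
  using assms by (auto simp: quills_def)

lemma quill_target: "\<alpha> \<in> quills \<Longrightarrow> target \<alpha> \<in> W"
  by (simp add: quills_def)

lemma quill_internal: "\<alpha> \<in> quills \<Longrightarrow> internal (last \<alpha>) \<Longrightarrow> \<alpha> = [last \<alpha>]"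
proof -
  assume "\<alpha> \<in> quills" "internal (last \<alpha>)"
  then have "length \<alpha> = 1"
    by (simp add: quills_def)
  then obtain e where "\<alpha> = [e]"
    by (auto simp: length_Suc_conv)
  then show "\<alpha> = [last \<alpha>]"
    by simp
qed

lemma quill_last: "\<alpha> \<in> quills \<Longrightarrow> last \<alpha> \<in> arcs E"
  by (auto simp: quills_def awalk_def)

lemma map_Inr [simp]: "map (projr \<circ> Inr) \<alpha> = \<alpha>"
  by (induction \<alpha>) auto

lemma F_gens [simp]:
  "FP [Inl w] = q w"
  "\<alpha> \<noteq> [] \<Longrightarrow> FP (map Inr \<alpha>) = SS \<alpha> * (q (target \<alpha>) * TT \<alpha>)"
  "FS (map Inr \<alpha>) = SS \<alpha> * q (target \<alpha>)"
  "FT (map Inr \<alpha>) = q (target \<alpha>) * TT \<alpha>"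
  by (simp_all add: FP_def FS_def FT_def hd_map)

lemma hedgehog_simps:
  "x \<in> verts hedgehog \<longleftrightarrow> (\<exists>w\<in>W. x = [Inl w]) \<or> (\<exists>\<alpha>\<in>quills. \<not> internal (last \<alpha>) \<and> x = map Inr \<alpha>)"
  "x \<in> arcs hedgehog \<longleftrightarrow> (\<exists>\<alpha>\<in>quills. x = map Inr \<alpha>)"
  "\<alpha> \<noteq> [] \<Longrightarrow> tail hedgehog (map Inr \<alpha>) = (if internal (last \<alpha>) then [Inl (tail E (last \<alpha>))] else map Inr \<alpha>)"
  "\<alpha> \<noteq> [] \<Longrightarrow> head hedgehog (map Inr \<alpha>) = [Inl (target \<alpha>)]"
  by (auto simp: hedgehog_def last_map target_def)

lemma wf_hedgehog: "wf_digraph hedgehog"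
proof
  fix x
  assume "x \<in> arcs hedgehog"
  then obtain \<alpha> where \<alpha>: "\<alpha> \<in> quills" "x = map Inr \<alpha>"
    by (auto simp: hedgehog_simps)
  then have "\<alpha> \<noteq> []"
    by auto
  with \<alpha> show "tail hedgehog x \<in> verts hedgehog" "head hedgehog x \<in> verts hedgehog"
    by (auto simp: hedgehog_simps quill_target internal_def)
qed

section \<open>Orthogonality of quills\<close>

lemma hereditary_walk_internal:
  assumes "awalk u (\<gamma> @ [f]) v" "u \<in> H"
  shows "internal f"
proof -
  have "awalk u \<gamma> (tail E f)" "f \<in> arcs E"
    using assms(1) by (auto simp: awalk_append_ex awalk_simps simp del: awalk_append_iff)
  then have "tail E f \<in> H"
    using hereditary_awalk assms(2) by blast
  with \<open>f \<in> arcs E\<close> show ?thesis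
    by (auto simp: internal_def hereditary W_def)
qed

text \<open>If the first edge of \<gamma> ended in \<open>H\<close>, it would be internal and so
  would all later edges by heredity. Hence it is an exit of \<open>w\<close>, and \<open>q w\<close>
  annihilates exits.\<close>

lemma q_block:
  assumes "w \<in> W" "awalk w \<gamma> v" "\<gamma> \<noteq> []" "\<not> internal (last \<gamma>)"
  shows "q w * SS \<gamma> = 0" "TT \<gamma> * q w = 0"
proof -
  obtain e \<gamma>' where \<gamma>: "\<gamma> = e # \<gamma>'"
    using assms(3) by (cases \<gamma>) auto
  then have e: "e \<in> out_arcs E w" "e \<in> arcs E" "tail E e = w" "awalk (head E e) \<gamma>' v"
    using assms(2) by (auto simp: awalk_simps)
  have "head E e \<notin> H"
  proof
    assume h: "head E e \<in> H"
    then show False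
      using assms(1,4) e \<gamma> hereditary_walk_internal[OF _ h]
      by (cases \<gamma>' rule: rev_cases) (auto simp: internal_def)
  qed
  then have "q w * S e = 0" "T e * q w = 0"
    using q_S[OF assms(1) e(1)] T_q[OF assms(1) e(1)] by auto
  then show "q w * SS \<gamma> = 0" "TT \<gamma> * q w = 0"
    using \<gamma> by (simp_all add: mult.assoc[symmetric], simp add: mult.assoc)
qed

lemma q_orth: "w \<in> W \<Longrightarrow> w' \<in> W \<Longrightarrow> q w * q w' = (if w = w' then q w else 0)"
proof -
  assume w: "w \<in> W" "w' \<in> W"
  have "q w * q w' = q w * P w * (P w' * q w')"
    using w by (simp add: P_q q_P)
  also have "\<dots> = q w * (P w * P w' * q w')"
    by (simp add: mult.assoc)
  finally show ?thesis
    using w by (auto simp: PP W_verts q_q)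
qed

lemma q_SS_other:
  assumes "w \<in> W" "awalk u \<gamma> v" "\<gamma> \<noteq> []" "u \<noteq> w"
  shows "q w * SS \<gamma> = 0" "TT \<gamma> * q w = 0"
proof -
  obtain e \<gamma>' where \<gamma>: "\<gamma> = e # \<gamma>'"
    using assms(3) by (cases \<gamma>) auto
  then have e: "e \<in> arcs E" "tail E e = u"
    using assms(2) by (auto simp: awalk_simps)
  have "q w * S e = q w * (P w * S e)" "T e * q w = T e * P w * q w"
    using assms(1) by (simp_all add: q_P P_q mult.assoc flip: mult.assoc[of "q w" "P w"])
  then have "q w * S e = 0" "T e * q w = 0"
    using orthogonal(2,5)[OF e(1) W_verts[OF assms(1)]] e(2) assms(4) by auto
  then show "q w * SS \<gamma> = 0" "TT \<gamma> * q w = 0"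
    using \<gamma> by (simp_all add: mult.assoc[symmetric], simp add: mult.assoc)
qed

lemma quill_q:
  assumes "w \<in> W" "\<alpha> \<in> quills" "\<not> internal (last \<alpha>)"
  shows "q w * SS \<alpha> = 0" "TT \<alpha> * q w = 0"
proof -
  obtain u where u: "awalk u \<alpha> (target \<alpha>)" and "\<alpha> \<noteq> []"
    using assms(2) by (auto simp: quills_def)
  then show "q w * SS \<alpha> = 0" "TT \<alpha> * q w = 0"
    using q_block[OF assms(1)] q_SS_other[OF assms(1)] assms(3) by metis+
qed

text \<open>The case that decides the definition of quills is a proper prefix: the longer quill has
  more than one edge, so its last edge is not internal, and \<open>q_block\<close> kills the
  remaining path. Incomparable quills are orthogonal as paths.\<close>

lemma quill_orth:
  assumes "\<alpha> \<in> quills" "\<beta> \<in> quills"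
  shows "q (target \<alpha>) * (TT \<alpha> * (SS \<beta> * q (target \<beta>))) = (if \<alpha> = \<beta> then q (target \<alpha>) else 0)"
proof -
  obtain u where u: "awalk u \<alpha> (target \<alpha>)"
    using assms(1) by (rule quill_awalk)
  obtain v where v: "awalk v \<beta> (target \<beta>)"
    using assms(2) by (rule quill_awalk)
  have W: "target \<alpha> \<in> W" "target \<beta> \<in> W"
    using assms by (simp_all add: quill_target)
  have ne: "\<alpha> \<noteq> []" "\<beta> \<noteq> []"
    using assms by auto
  consider "\<alpha> = \<beta>" | \<gamma> where "\<beta> = \<alpha> @ \<gamma>" "\<gamma> \<noteq> []" | \<gamma> where "\<alpha> = \<beta> @ \<gamma>" "\<gamma> \<noteq> []"
    | "\<nexists>\<gamma>. \<beta> = \<alpha> @ \<gamma>" "\<nexists>\<gamma>. \<alpha> = \<beta> @ \<gamma>"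
    by (metis append_Nil2)
  then show ?thesis
  proof cases
    case 1
    have "TT \<alpha> * (SS \<alpha> * q (target \<alpha>)) = TT \<alpha> * (SS \<alpha> * P (target \<alpha>)) * q (target \<alpha>)"
      using P_q[OF W(1)] by (simp add: mult.assoc)
    also have "\<dots> = q (target \<alpha>)"
      using TT_SS_same[OF u] P_q[OF W(1)] by simp
    finally show ?thesis
      using 1 q_q[OF W(1)] by simp
  next
    case 2
    then have \<gamma>: "awalk (target \<alpha>) \<gamma> (target \<beta>)"
      using u v ne by (metis awalk_append_iff awalk_ends_eqD awlast_of_awalk awalk_append_ex awalk_ends)
    have "length \<beta> \<noteq> 1" "last \<beta> = last \<gamma>"
      using 2 ne by (auto simp: neq_Nil_conv)
    then have "\<not> internal (last \<gamma>)"
      using assms(2) by (auto simp: quills_def)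
    then have block: "q (target \<alpha>) * SS \<gamma> = 0"
      using q_block(1)[OF W(1) \<gamma> 2(2)] by simp
    have "TT \<alpha> * (SS \<beta> * q (target \<beta>)) = TT \<alpha> * (SS (\<alpha> @ \<gamma>) * P (target \<beta>)) * q (target \<beta>)"
      using P_q[OF W(2)] 2(1) by (simp add: mult.assoc)
    also have "\<dots> = SS \<gamma> * q (target \<beta>)"
      unfolding TT_SS_prefix[OF u \<gamma>] using P_q[OF W(2)] by (simp add: mult.assoc)
    finally have "q (target \<alpha>) * (TT \<alpha> * (SS \<beta> * q (target \<beta>))) = q (target \<alpha>) * SS \<gamma> * q (target \<beta>)"
      by (simp add: mult.assoc)
    with block 2 show ?thesis by simp
  next
    case 3
    then have \<gamma>: "awalk (target \<beta>) \<gamma> (target \<alpha>)"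
      using u v ne by (metis awalk_append_iff awalk_ends_eqD awlast_of_awalk awalk_append_ex awalk_ends)
    have "length \<alpha> \<noteq> 1" "last \<alpha> = last \<gamma>"
      using 3 ne by (auto simp: neq_Nil_conv)
    then have "\<not> internal (last \<gamma>)"
      using assms(1) by (auto simp: quills_def)
    then have block: "TT \<gamma> * q (target \<beta>) = 0"
      using q_block(2)[OF W(2) \<gamma> 3(2)] by simp
    have "TT \<beta> * (SS \<beta> * q (target \<beta>)) = TT \<beta> * (SS \<beta> * P (target \<beta>)) * q (target \<beta>)"
      using P_q[OF W(2)] by (simp add: mult.assoc)
    also have "\<dots> = q (target \<beta>)"
      using TT_SS_same[OF v] P_q[OF W(2)] by simp
    finally have "TT \<alpha> * (SS \<beta> * q (target \<beta>)) = TT \<gamma> * q (target \<beta>)"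
      using 3(1) by (simp add: mult.assoc)
    with block 3 show ?thesis by simp
  next
    case 4
    have "TT \<alpha> * SS \<beta> = 0"
      using TT_SS_incomparable[OF u v 4] .
    moreover have "\<alpha> \<noteq> \<beta>"
      using 4 by (metis append_Nil2)
    ultimately show ?thesis
      by (metis mult.assoc mult_zero_left mult_zero_right)
  qed
qed

lemma quill_orth_assoc:
  assumes "\<alpha> \<in> quills" "\<beta> \<in> quills"
  shows "q (target \<alpha>) * (TT \<alpha> * (SS \<beta> * (q (target \<beta>) * x))) = (if \<alpha> = \<beta> then q (target \<alpha>) * x else 0)"
proof -
  have "q (target \<alpha>) * (TT \<alpha> * (SS \<beta> * (q (target \<beta>) * x)))
      = q (target \<alpha>) * (TT \<alpha> * (SS \<beta> * q (target \<beta>))) * x"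
    by (simp add: mult.assoc)
  then show ?thesis
    by (simp add: quill_orth[OF assms])
qed

lemma q_q_assoc: "w \<in> W \<Longrightarrow> q w * (q w * x) = q w * x"
  by (simp add: q_q flip: mult.assoc)

section \<open>The hedgehog elements satisfy the Leavitt relations\<close>

lemma hedgehog_out_quill:
  "\<alpha> \<in> quills \<Longrightarrow> \<not> internal (last \<alpha>) \<Longrightarrow> out_arcs hedgehog (map Inr \<alpha>) = {map Inr \<alpha>}"
proof (intro equalityI subsetI)
  assume \<alpha>: "\<alpha> \<in> quills" "\<not> internal (last \<alpha>)"
  then have ne: "\<alpha> \<noteq> []"
    by auto
  show "x \<in> {map Inr \<alpha>}" if x: "x \<in> out_arcs hedgehog (map Inr \<alpha>)" for x
  proof -
    obtain \<beta> where \<beta>: "\<beta> \<in> quills" "x = map Inr \<beta>" "tail hedgehog x = map Inr \<alpha>"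
      using x by (auto simp: hedgehog_simps)
    moreover from this have "\<beta> \<noteq> []"
      by auto
    ultimately show ?thesis
      by (auto simp: hedgehog_simps Cons_eq_map_conv split: if_splits)
  qed
  show "x \<in> out_arcs hedgehog (map Inr \<alpha>)" if "x \<in> {map Inr \<alpha>}" for x
    using that \<alpha> ne by (auto simp: hedgehog_simps)
qed

lemma hedgehog_out_W:
  assumes "w \<in> W"
  shows "out_arcs hedgehog [Inl w] = (\<lambda>e. [Inr e]) ` {e \<in> out_arcs E w. head E e \<in> H}"
proof (intro equalityI subsetI)
  fix x
  assume "x \<in> out_arcs hedgehog [Inl w]"
  then obtain \<beta> where \<beta>: "\<beta> \<in> quills" "x = map Inr \<beta>" "tail hedgehog x = [Inl w]"
    by (auto simp: hedgehog_simps)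
  moreover from this have "\<beta> \<noteq> []"
    by auto
  ultimately have "internal (last \<beta>)" "tail E (last \<beta>) = w"
    by (auto simp: hedgehog_simps map_eq_Cons_conv split: if_splits)
  moreover from this(1) obtain e where "\<beta> = [e]"
    using quill_internal[OF \<beta>(1)] by blast
  ultimately show "x \<in> (\<lambda>e. [Inr e]) ` {e \<in> out_arcs E w. head E e \<in> H}"
    using \<beta>(2) quill_last[OF \<beta>(1)] by (auto simp: internal_def)
next
  fix x :: "('v + 'e) list"
  assume "x \<in> (\<lambda>e. [Inr e]) ` {e \<in> out_arcs E w. head E e \<in> H}"
  then obtain e where e: "x = map Inr [e]" "e \<in> arcs E" "tail E e = w" "head E e \<in> H"
    by auto
  then have int: "internal e"
    using assms by (simp add: internal_def)
  have "awalk w [e] (head E e)"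
    using e by (auto simp: awalk_simps)
  then have "[e] \<in> quills"
    using e by (auto simp: quills_def target_def W_def)
  then have "x \<in> arcs hedgehog"
    unfolding hedgehog_simps(2) using e(1) by blast
  then show "x \<in> out_arcs hedgehog [Inl w]"
    using int e hedgehog_simps(3)[of "[e]"] \<open>x \<in> arcs hedgehog\<close> by auto
qed

text \<open>The delicate relation is the one at regular vertices. A private vertex emits only its
  own edge, where the relation is the definition of \<open>FP\<close>; a vertex of \<open>W\<close>
  that is regular in the hedgehog has to be regular in \<open>E\<close>.\<close>

lemma hedgehog_family: "leavitt_family hedgehog sc FP FS FT"
proof (intro leavitt_family.intro leavitt_family_axioms.intro wf_hedgehog central_scalars_axioms)
  fix x y
  show "FP x * FP y = (if x = y then FP x else 0)" if xy: "x \<in> verts hedgehog" "y \<in> verts hedgehog"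
  proof -
    from xy consider w w' where "x = [Inl w]" "y = [Inl w']" "w \<in> W" "w' \<in> W"
      | w \<alpha> where "x = [Inl w]" "w \<in> W" "y = map Inr \<alpha>" "\<alpha> \<in> quills" "\<not> internal (last \<alpha>)"
      | w \<alpha> where "y = [Inl w]" "w \<in> W" "x = map Inr \<alpha>" "\<alpha> \<in> quills" "\<not> internal (last \<alpha>)"
      | \<alpha> \<beta> where "x = map Inr \<alpha>" "\<alpha> \<in> quills" "y = map Inr \<beta>" "\<beta> \<in> quills"
      unfolding hedgehog_simps by blast
    then show ?thesis
    proof cases
      case 1
      then show ?thesis by (simp add: q_orth)
    next
      case 2
      then have "\<alpha> \<noteq> []" by auto
      have "FP x * FP y = q w * SS \<alpha> * (q (target \<alpha>) * TT \<alpha>)"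
        using 2 \<open>\<alpha> \<noteq> []\<close> by (simp add: mult.assoc)
      with 2 \<open>\<alpha> \<noteq> []\<close> show ?thesis
        by (auto simp: quill_q map_eq_Cons_conv)
    next
      case 3
      then have "\<alpha> \<noteq> []" by auto
      have "FP x * FP y = SS \<alpha> * (q (target \<alpha>) * (TT \<alpha> * q w))"
        using 3 \<open>\<alpha> \<noteq> []\<close> by (simp add: mult.assoc)
      with 3 \<open>\<alpha> \<noteq> []\<close> show ?thesis
        by (auto simp: quill_q map_eq_Cons_conv)
    next
      case 4
      then have "\<alpha> \<noteq> []" "\<beta> \<noteq> []" by auto
      with 4 show ?thesis
        by (auto simp: mult.assoc quill_orth_assoc inj_map_eq_map)
    qed
  qed
  show "FT x * FS y = (if x = y then FP (head hedgehog x) else 0)" if "x \<in> arcs hedgehog" "y \<in> arcs hedgehog"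
  proof -
    obtain \<alpha> \<beta> where "x = map Inr \<alpha>" "\<alpha> \<in> quills" "y = map Inr \<beta>" "\<beta> \<in> quills"
      using \<open>x \<in> arcs hedgehog\<close> \<open>y \<in> arcs hedgehog\<close> by (auto simp: hedgehog_simps)
    moreover from this have "\<alpha> \<noteq> []" by auto
    ultimately show ?thesis
      by (auto simp: mult.assoc quill_orth inj_map_eq_map hedgehog_simps)
  qed
  show "FP x = (\<Sum>e\<in>out_arcs hedgehog x. FS e * FT e)" if x: "x \<in> regular_verts hedgehog"
  proof -
    have "x \<in> verts hedgehog" and fin: "finite (out_arcs hedgehog x)" and ne: "out_arcs hedgehog x \<noteq> {}"
      using x by (auto simp: regular_verts_def)
    then consider w where "x = [Inl w]" "w \<in> W"
      | \<alpha> where "x = map Inr \<alpha>" "\<alpha> \<in> quills" "\<not> internal (last \<alpha>)"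
      unfolding hedgehog_simps by blast
    then show ?thesis
    proof cases
      case 1
      let ?D = "{e \<in> out_arcs E w. head E e \<in> H}"
      have inj: "inj_on (\<lambda>e. [Inr e :: 'v + 'e]) ?D"
        by (auto simp: inj_on_def)
      have D: "finite ?D" "?D \<noteq> {}"
        using fin ne inj by (auto simp: 1 hedgehog_out_W finite_image_iff)
      \<comment> \<open>Finitely many edges into \<open>H\<close> and finitely many exits exclude
        the infinite emitters of \<open>W\<close>. So \<open>w\<close> is in \<open>H\<close>, all
        its edges end in \<open>H\<close>, and the relation of \<open>E\<close> applies.\<close>
      have "out_arcs E w = ?D \<union> exits w"
        by (auto simp: exits_def)
      with D(1) finite_exits[OF 1(2)] have "finite (out_arcs E w)"
        by simp
      with 1(2) have "w \<in> H"
        by (auto simp: W_def)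
      then have out: "?D = out_arcs E w"
        by (auto simp: hereditary)
      then have "w \<in> regular_verts E"
        using D W_verts[OF 1(2)] by (simp add: regular_verts_def)
      then have "FP x = (\<Sum>e\<in>?D. S e * T e)"
        using CK out \<open>w \<in> H\<close> 1(1) by (simp add: q_H)
      also have "\<dots> = (\<Sum>e\<in>?D. FS [Inr e] * FT [Inr e])"
      proof (rule sum.cong[OF refl])
        fix e
        assume e: "e \<in> ?D"
        then have "FS (map Inr [e]) * FT (map Inr [e]) = S e * P (head E e) * (P (head E e) * T e)"
          by (simp only: F_gens target_def last.simps q_H) (simp add: q_H)
        then show "S e * T e = FS [Inr e] * FT [Inr e]"
          using e by simp
      qed
      also have "\<dots> = (\<Sum>e\<in>out_arcs hedgehog x. FS e * FT e)"
        unfolding 1(1) hedgehog_out_W[OF 1(2)] sum.reindex[OF inj] by (simp add: o_def)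
      finally show ?thesis .
    next
      case 2
      then have "\<alpha> \<noteq> []" by auto
      with 2 show ?thesis
        by (simp add: hedgehog_out_quill mult.assoc q_q_assoc quill_target)
    qed
  qed
  assume "x \<in> arcs hedgehog"
  then obtain \<alpha> where \<alpha>: "\<alpha> \<in> quills" "x = map Inr \<alpha>"
    by (auto simp: hedgehog_simps)
  then have ne: "\<alpha> \<noteq> []" by auto
  have Wt: "target \<alpha> \<in> W"
    using \<alpha>(1) by (rule quill_target)
  show "FS x * FP (head hedgehog x) = FS x" "FP (head hedgehog x) * FT x = FT x"
    using \<alpha> ne Wt by (simp_all add: hedgehog_simps q_q q_q_assoc mult.assoc)
  \<comment> \<open>An internal edge ends in \<open>H\<close>, so it is not among the edges that
    \<open>q (tail E e)\<close> removes.\<close>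
  have int: "q (tail E e) * S e = S e \<and> T e * q (tail E e) = T e" if "internal e" "\<alpha> = [e]" for e
    using q_S[of "tail E e" e] T_q[of "tail E e" e] that quill_last[OF \<alpha>(1)] by (auto simp: internal_def)
  show "FP (tail hedgehog x) * FS x = FS x"
  proof (cases "internal (last \<alpha>)")
    case True
    then have "\<alpha> = [last \<alpha>]"
      using \<alpha>(1) quill_internal by blast
    then obtain e where e: "\<alpha> = [e]" by blast
    have "FP (tail hedgehog x) * FS x = q (tail E e) * S e * q (target \<alpha>)"
      using \<alpha>(2) e True hedgehog_simps(3)[of "[e]"] F_gens(3)[of "[e]"] by (simp add: mult.assoc)
    then show ?thesis
      using int[of e] True e \<alpha>(2) F_gens(3)[of "[e]"] by simp
  qed (use \<alpha> ne Wt in \<open>simp add: hedgehog_simps mult.assoc quill_orth q_q\<close>)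
  show "FT x * FP (tail hedgehog x) = FT x"
  proof (cases "internal (last \<alpha>)")
    case True
    then have "\<alpha> = [last \<alpha>]"
      using \<alpha>(1) quill_internal by blast
    then obtain e where e: "\<alpha> = [e]" by blast
    have "FT x * FP (tail hedgehog x) = q (target \<alpha>) * (T e * q (tail E e))"
      using \<alpha>(2) e True hedgehog_simps(3)[of "[e]"] F_gens(4)[of "[e]"] by (simp add: mult.assoc)
    then show ?thesis
      using int[of e] True e \<alpha>(2) F_gens(4)[of "[e]"] by simp
  qed (use \<alpha> ne Wt in \<open>simp add: hedgehog_simps mult.assoc quill_orth_assoc q_q_assoc\<close>)
qed

end

section \<open>Nonvanishing of the hedgehog vertices, and the image of the hedgehog algebra\<close>

context leavitt_ideal
begin

sublocale F: leavitt_family hedgehog sc FP FS FT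
  by (rule hedgehog_family)

text \<open>At a breaking vertex, infinitely many edges and finitely many exits leave an edge into
  \<open>H\<close>. It is fixed by \<open>q w\<close> and is nonzero because its range is.\<close>

lemma q_nonzero:
  assumes "\<And>v. v \<in> verts E \<Longrightarrow> P v \<noteq> 0" "w \<in> W"
  shows "q w \<noteq> 0"
proof (cases "w \<in> H")
  case True
  then show ?thesis
    using assms W_verts q_H by simp
next
  case False
  with assms(2) have "infinite (out_arcs E w)" "finite (exits w)"
    by (auto simp: W_def)
  then have "out_arcs E w - exits w \<noteq> {}"
    by (metis Diff_infinite_finite finite.emptyI)
  then obtain e where "e \<in> out_arcs E w" "e \<notin> exits w"
    by blast
  then have e: "e \<in> out_arcs E w" "head E e \<in> H" "e \<in> arcs E"
    by (auto simp: exits_def)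
  show ?thesis
  proof
    assume "q w = 0"
    then have "S e = 0"
      using q_S[OF assms(2) e(1)] e(2) by simp
    then have "P (head E e) = 0"
      using TS[OF e(3) e(3)] by simp
    then show False
      using assms(1)[of "head E e"] e(3) by auto
  qed
qed

text \<open>Multiplying \<alpha> q \<alpha>* by the ghost of \<alpha> q on the left and by \<alpha>
  q on the right recovers q, which is nonzero.\<close>

lemma FP_nonzero:
  assumes "\<And>v. v \<in> verts E \<Longrightarrow> P v \<noteq> 0" "x \<in> verts hedgehog"
  shows "FP x \<noteq> 0"
proof -
  consider w where "x = [Inl w]" "w \<in> W"
    | \<alpha> where "x = map Inr \<alpha>" "\<alpha> \<in> quills" "\<alpha> \<noteq> []"
    using assms(2) unfolding hedgehog_simps by fastforce
  then show ?thesis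
  proof cases
    case 1
    then show ?thesis using q_nonzero[OF assms(1)] by simp
  next
    case 2
    show ?thesis
    proof
      assume "FP x = 0"
      then have "SS \<alpha> * (q (target \<alpha>) * TT \<alpha>) = 0"
        using 2 by simp
      then have "q (target \<alpha>) * (TT \<alpha> * ((SS \<alpha> * (q (target \<alpha>) * TT \<alpha>)) * (SS \<alpha> * q (target \<alpha>)))) = 0"
        by simp
      then have "q (target \<alpha>) = 0"
        using 2 by (simp add: mult.assoc quill_orth_assoc quill_orth)
      then show False
        using q_nonzero[OF assms(1)] quill_target[OF 2(2)] by blast
    qed
  qed
qed

text \<open>Induction from the end of the path. If the last edge is not internal, the whole path is
  one quill. Otherwise that edge is a quill by itself and the rest ends in \<open>W\<close>; the
  factor \<open>q (tail E e)\<close> between the two is absorbed by the edge.\<close>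

lemma awalk_q_product:
  assumes "w \<in> W" "awalk u \<alpha> w"
  shows "\<exists>ws. ws \<noteq> [] \<and> set ws \<subseteq> lpa_gens hedgehog \<and> prod_list (map F.gen ws) = SS \<alpha> * q w"
    and "\<exists>ws. ws \<noteq> [] \<and> set ws \<subseteq> lpa_gens hedgehog \<and> prod_list (map F.gen ws) = q w * TT \<alpha>"
proof -
  have "(\<exists>ws. ws \<noteq> [] \<and> set ws \<subseteq> lpa_gens hedgehog \<and> prod_list (map F.gen ws) = SS \<alpha> * q w) \<and>
    (\<exists>ws. ws \<noteq> [] \<and> set ws \<subseteq> lpa_gens hedgehog \<and> prod_list (map F.gen ws) = q w * TT \<alpha>)"
    using assms
  proof (induction \<alpha> arbitrary: w rule: rev_induct)
    case Nil
    then have "Vertex [Inl w] \<in> lpa_gens hedgehog"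
      by (auto simp: lpa_gens_def hedgehog_simps)
    moreover have "F.gen (Vertex [Inl w]) = q w"
      by simp
    ultimately show ?case
      by (intro conjI exI[of _ "[Vertex [Inl w]]"]) auto
  next
    case (snoc e \<alpha>)
    then have e: "e \<in> arcs E" "awalk u \<alpha> (tail E e)" "w = head E e" "target (\<alpha> @ [e]) = w"
      by (auto simp: awalk_append_ex awalk_simps target_def simp del: awalk_append_iff)
    show ?case
    proof (cases "internal e")
      case False
      then have "\<alpha> @ [e] \<in> quills"
        using snoc.prems e(4) by (auto simp: quills_def simp del: awalk_append_iff)
      then have "map Inr (\<alpha> @ [e]) \<in> arcs hedgehog"
        unfolding hedgehog_simps by blast
      then have "Edge (map Inr (\<alpha> @ [e])) \<in> lpa_gens hedgehog" "Ghost (map Inr (\<alpha> @ [e])) \<in> lpa_gens hedgehog"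
        by (auto simp: lpa_gens_def simp del: map_append)
      moreover have "F.gen (Edge (map Inr (\<alpha> @ [e]))) = SS (\<alpha> @ [e]) * q w"
        "F.gen (Ghost (map Inr (\<alpha> @ [e]))) = q w * TT (\<alpha> @ [e])"
        unfolding F.gen.simps F_gens e(4) by simp_all
      ultimately show ?thesis
        by (intro conjI exI[of _ "[Edge (map Inr (\<alpha> @ [e]))]"] exI[of _ "[Ghost (map Inr (\<alpha> @ [e]))]"])
          (simp_all del: map_append)
    next
      case True
      then have W: "tail E e \<in> W" "w \<in> H"
        using e(3) by (auto simp: internal_def)
      have "awalk (tail E e) [e] w"
        using e by (auto simp: awalk_simps)
      then have "[e] \<in> quills"
        using snoc.prems(1) e(3) by (auto simp: quills_def target_def)
      then have gens: "Edge (map Inr [e]) \<in> lpa_gens hedgehog" "Ghost (map Inr [e]) \<in> lpa_gens hedgehog"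
        unfolding lpa_gens_def hedgehog_simps using hedgehog_simps(2) by blast+
      have gen_e: "F.gen (Edge (map Inr [e])) = S e * q w" "F.gen (Ghost (map Inr [e])) = q w * T e"
        unfolding F.gen.simps F_gens using e(3) by (simp_all add: target_def)
      obtain vs ws where vs: "vs \<noteq> []" "set vs \<subseteq> lpa_gens hedgehog"
          "prod_list (map F.gen vs) = SS \<alpha> * q (tail E e)"
        and ws: "ws \<noteq> []" "set ws \<subseteq> lpa_gens hedgehog" "prod_list (map F.gen ws) = q (tail E e) * TT \<alpha>"
        using snoc.IH[OF W(1) e(2)] by blast
      have "q (tail E e) * S e = S e" "T e * q (tail E e) = T e"
        using q_S[OF W(1), of e] T_q[OF W(1), of e] e W(2) by auto
      then have "q (tail E e) * (S e * x) = S e * x" "T e * (q (tail E e) * x) = T e * x" for x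
        by (simp_all flip: mult.assoc)
      then have "prod_list (map F.gen (vs @ [Edge (map Inr [e])])) = SS (\<alpha> @ [e]) * q w"
        "prod_list (map F.gen (Ghost (map Inr [e]) # ws)) = q w * TT (\<alpha> @ [e])"
        unfolding map_append list.map(2)[of F.gen] gen_e prod_list.append prod_list.Cons vs(3) ws(3)
        by (simp_all add: mult.assoc)
      then show ?thesis
        using vs(1,2) ws(1,2) gens
        by (intro conjI exI[of _ "vs @ [Edge (map Inr [e])]"] exI[of _ "Ghost (map Inr [e]) # ws"])
          (simp_all only: set_append list.set Un_subset_iff insert_subset empty_subsetI, auto)
    qed
  qed
  then show "\<exists>ws. ws \<noteq> [] \<and> set ws \<subseteq> lpa_gens hedgehog \<and> prod_list (map F.gen ws) = SS \<alpha> * q w"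
    "\<exists>ws. ws \<noteq> [] \<and> set ws \<subseteq> lpa_gens hedgehog \<and> prod_list (map F.gen ws) = q w * TT \<alpha>"
    by blast+
qed

lemma J_subset_image: "J \<subseteq> ev F.gen ` carrier (free_algebra (lpa_gens hedgehog))"
proof
  fix x
  assume "x \<in> J"
  then show "x \<in> ev F.gen ` carrier (free_algebra (lpa_gens hedgehog))"
    unfolding J_def
  proof (induction x rule: lspan.induct)
    case zero
    show ?case
      by (rule image_eqI[of _ _ 0]) simp_all
  next
    case (step a y c)
    then obtain p where p: "p \<in> carrier (free_algebra (lpa_gens hedgehog))" "y = ev F.gen p"
      by blast
    from step obtain \<alpha> w \<beta> u v where a: "a = SS \<alpha> * (q w * TT \<beta>)" "w \<in> W" "awalk u \<alpha> w" "awalk v \<beta> w"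
      by blast
    obtain us where us: "us \<noteq> []" "set us \<subseteq> lpa_gens hedgehog" "prod_list (map F.gen us) = SS \<alpha> * q w"
      using awalk_q_product(1)[OF a(2,3)] by blast
    obtain vs where vs: "vs \<noteq> []" "set vs \<subseteq> lpa_gens hedgehog" "prod_list (map F.gen vs) = q w * TT \<beta>"
      using awalk_q_product(2)[OF a(2,4)] by blast
    \<comment> \<open>The projection \<open>q w\<close> is idempotent, so one copy can be given to
      each half.\<close>
    have "a = prod_list (map F.gen (us @ vs))"
      using us vs a by (simp add: mult.assoc q_q_assoc)
    then have "sc c * a + y = ev F.gen (Poly_Mapping.single (us @ vs) c + p)"
      using p by (simp add: ev_add)
    moreover have "Poly_Mapping.single (us @ vs) c \<in> carrier (free_algebra (lpa_gens hedgehog))"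
      using us vs by auto
    ultimately show ?case
      using free_algebra_carrier_closed(1) p(1) by blast
  qed
qed

end

section \<open>Graded ideals\<close>

lemma lpa_gensE:
  assumes "g \<in> lpa_gens E"
  obtains v where "g = Vertex v" "v \<in> verts E"
    | e where "g = Edge e" "e \<in> arcs E"
    | e where "g = Ghost e" "e \<in> arcs E"
  using assms by (auto simp: lpa_gens_def)

section \<open>The grading carried over to operators\<close>

context leavitt_algebra
begin

definition grade :: "int \<Rightarrow> (('v, 'e) lpa_gen list, 'k) linop set" where
  "grade d = {rep p |p. p \<in> carrier A \<and> homogeneous d p}"

lemma gens_carrier:
  "v \<in> verts E \<Longrightarrow> (vx v :: _ \<Rightarrow>\<^sub>0 'k) \<in> carrier A"
  "e \<in> arcs E \<Longrightarrow> (ed e :: _ \<Rightarrow>\<^sub>0 'k) \<in> carrier A"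
  "e \<in> arcs E \<Longrightarrow> (gh e :: _ \<Rightarrow>\<^sub>0 'k) \<in> carrier A"
  by (auto simp: lpa_gens_def)

lemma gradeI: "p \<in> carrier A \<Longrightarrow> homogeneous d p \<Longrightarrow> rep p \<in> grade d"
  by (auto simp: grade_def simp del: free_algebra_simps(1))

lemma gradeE:
  assumes "x \<in> grade d"
  obtains p where "p \<in> carrier A" "homogeneous d p" "x = rep p"
  using assms by (auto simp: grade_def simp del: free_algebra_simps(1))

lemma grade_gens:
  "v \<in> verts E \<Longrightarrow> rep (vx v) \<in> grade 0"
  "e \<in> arcs E \<Longrightarrow> rep (ed e) \<in> grade 1"
  "e \<in> arcs E \<Longrightarrow> rep (gh e) \<in> grade (- 1)"
  by (intro gradeI gens_carrier homogeneous_single; simp)+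

lemma grade_mult: "x \<in> grade a \<Longrightarrow> y \<in> grade b \<Longrightarrow> x * y \<in> grade (a + b)"
  by (elim gradeE) (simp add: rep_mult[symmetric] gradeI homogeneous_mult free_algebra_carrier_closed del: free_algebra_simps(1))

lemma grade_add: "x \<in> grade a \<Longrightarrow> y \<in> grade a \<Longrightarrow> x + y \<in> grade a"
  by (elim gradeE) (simp add: rep_add[symmetric] gradeI homogeneous_add free_algebra_carrier_closed del: free_algebra_simps(1))

lemma grade_diff: "x \<in> grade a \<Longrightarrow> y \<in> grade a \<Longrightarrow> x - y \<in> grade a"
  by (elim gradeE) (simp add: rep_diff[symmetric] gradeI homogeneous_diff free_algebra_carrier_closed del: free_algebra_simps(1))

lemma grade_0: "0 \<in> grade a"
  using gradeI[of 0 a] by (simp add: rep_0)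

lemma grade_scale: "x \<in> grade a \<Longrightarrow> scalar_op c * x \<in> grade a"
proof (elim gradeE)
  fix p
  assume p: "p \<in> carrier A" "homogeneous a p" "x = rep p"
  have "homogeneous a (Poly_Mapping.single [] c * p)"
    using homogeneous_mult[OF homogeneous_single[of "[]" 0 c] p(2)] by simp
  then show "scalar_op c * x \<in> grade a"
    using gradeI free_algebra_carrier_closed(3)[OF p(1)] p(3) by (metis rep_mult rep_scalar)
qed

lemma grade_sum: "(\<And>n. n \<in> D \<Longrightarrow> f n \<in> grade a) \<Longrightarrow> sum f D \<in> grade a"
  by (induction D rule: infinite_finite_induct) (auto intro: grade_add grade_0)

text \<open>A sum of homogeneous polynomials that lies in the ideal of relations has each of its
  parts there, since that ideal is graded.\<close>

lemma grade_independent: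
  assumes "finite D" "\<And>d. d \<in> D \<Longrightarrow> x d \<in> grade d" "(\<Sum>d\<in>D. x d) = 0" "n \<in> D"
  shows "x n = 0"
proof -
  have "\<forall>d\<in>D. \<exists>p. p \<in> carrier A \<and> homogeneous d p \<and> x d = rep p"
    using assms(2) gradeE by metis
  then obtain p where p: "\<And>d. d \<in> D \<Longrightarrow> p d \<in> carrier A" "\<And>d. d \<in> D \<Longrightarrow> homogeneous d (p d)"
    "\<And>d. d \<in> D \<Longrightarrow> x d = rep (p d)"
    by metis
  have "(\<Sum>d\<in>D'. p d) \<in> carrier A" if "D' \<subseteq> D" for D'
    using that
    by (induction D' rule: infinite_finite_induct)
      (auto intro!: free_algebra_carrier_closed(1) p(1) simp del: free_algebra_simps(1), simp_all)
  then have "(\<Sum>d\<in>D. p d) \<in> lpa_ideal E"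
    using assms(3) p(3) by (simp add: rep_eq_0_iff[symmetric] rep_sum del: free_algebra_simps(1))
  then have "degree_part n (\<Sum>d\<in>D. p d) \<in> lpa_ideal E"
    by (rule degree_part_lpa_ideal)
  also have "degree_part n (\<Sum>d\<in>D. p d) = (\<Sum>d\<in>D. if d = n then p n else 0)"
    unfolding restrict_keys_sum by (intro sum.cong) (auto simp: degree_part_homogeneous[OF p(2)])
  also have "\<dots> = p n"
    using assms(1,4) by simp
  finally show ?thesis
    using assms(4) p by (simp add: rep_eq_0_iff del: free_algebra_simps(1))
qed

end

section \<open>The graded ideal as a set of operators\<close>

locale lpa_graded_ideal = leavitt_algebra E scalar_type
  for E :: "('v, 'e) pre_digraph" and scalar_type :: "'k::field itself" +
  fixes I :: "(('v, 'e) lpa_gen list \<Rightarrow>\<^sub>0 'k) set set"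
  assumes graded: "graded_ideal E I"
begin

lemma I_ideal: "algebra_ideal Q I"
  using graded by (simp add: graded_ideal_def leavitt_path_algebra_eq)

lemma I_carrier: "x \<in> I \<Longrightarrow> \<exists>p\<in>carrier A. x = cls p"
proof -
  have "I \<subseteq> carrier Q"
    using additive_subgroup.a_subset[of I Q] I_ideal by (simp add: algebra_ideal_def del: free_algebra_simps(1))
  then show "x \<in> I \<Longrightarrow> \<exists>p\<in>carrier A. x = cls p"
    unfolding quotient_carrier by (auto simp del: free_algebra_simps(1))
qed

lemma I_add: "cls p \<in> I \<Longrightarrow> cls p' \<in> I \<Longrightarrow> cls (p + p') \<in> I"
  using additive_subgroup.a_closed[of I Q] I_ideal unfolding algebra_ideal_def quotient_add[symmetric] by blast

lemma I_0: "cls 0 \<in> I"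
  using additive_subgroup.zero_closed[of I Q] I_ideal unfolding algebra_ideal_def quotient_zero by blast

lemma I_scale: "cls p \<in> I \<Longrightarrow> cls (Poly_Mapping.single [] c * p) \<in> I"
  using I_ideal unfolding algebra_ideal_def quotient_smult[symmetric] by blast

lemma I_mult:
  assumes "a \<in> carrier A" "p \<in> carrier A" "cls p \<in> I"
  shows "cls (a * p) \<in> I" "cls (p * a) \<in> I"
  using I_ideal assms unfolding algebra_ideal_def
  by (auto simp add: quotient_mult[symmetric] quotient_carrier simp del: free_algebra_simps(1))

definition ideal_polys :: "(('v, 'e) lpa_gen list \<Rightarrow>\<^sub>0 'k) set" where
  "ideal_polys = {p \<in> carrier A. cls p \<in> I}"

lemma ideal_polys:
  "0 \<in> ideal_polys" "p \<in> ideal_polys \<Longrightarrow> p' \<in> ideal_polys \<Longrightarrow> p + p' \<in> ideal_polys" "p \<in> ideal_polys \<Longrightarrow> Poly_Mapping.single [] c * p \<in> ideal_polys"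
  "p \<in> ideal_polys \<Longrightarrow> a \<in> carrier A \<Longrightarrow> a * p \<in> ideal_polys" "p \<in> ideal_polys \<Longrightarrow> a \<in> carrier A \<Longrightarrow> p * a \<in> ideal_polys"
  unfolding ideal_polys_def
  by (simp_all add: I_0 I_add I_scale I_mult free_algebra_carrier_closed del: free_algebra_simps(1)) simp

abbreviation ideal_ops :: "(('v, 'e) lpa_gen list, 'k) linop set" where
  "ideal_ops \<equiv> rep ` ideal_polys"

lemma ideal_ops_mult: "x \<in> ideal_ops \<Longrightarrow> y \<in> ideal_ops \<Longrightarrow> x * y \<in> ideal_ops"
  using ideal_polys(4) unfolding image_iff by (metis (no_types, lifting) mem_Collect_eq ideal_polys_def rep_mult)

sublocale leavitt_ideal E "scalar_op :: 'k \<Rightarrow> _" "\<lambda>v. rep (vx v)" "\<lambda>e. rep (ed e)" "\<lambda>e. rep (gh e)" ideal_ops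
proof
  fix x y c v e
  assume "x \<in> ideal_ops"
  then obtain p where p: "p \<in> ideal_polys" "x = rep p"
    by blast
  show "x + y \<in> ideal_ops" if "y \<in> ideal_ops"
    using that p ideal_polys(2) by (auto simp flip: rep_add)
  show "scalar_op c * x \<in> ideal_ops"
    using p ideal_polys(3) by (auto simp flip: rep_mult rep_scalar)
  show "rep (vx v) * x \<in> ideal_ops" "x * rep (vx v) \<in> ideal_ops" if "v \<in> verts E"
    using that p ideal_polys(4,5) gens_carrier by (auto simp flip: rep_mult simp del: free_algebra_simps(1))
  show "rep (ed e) * x \<in> ideal_ops" "x * rep (ed e) \<in> ideal_ops" if "e \<in> arcs E"
    using that p ideal_polys(4,5) gens_carrier by (auto simp flip: rep_mult simp del: free_algebra_simps(1))
  show "rep (gh e) * x \<in> ideal_ops" "x * rep (gh e) \<in> ideal_ops" if "e \<in> arcs E"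
    using that p ideal_polys(4,5) gens_carrier by (auto simp flip: rep_mult simp del: free_algebra_simps(1))
qed

text \<open>The grading hypothesis enters here, through surjectivity of the summation map: every
  element of \<open>I\<close> is a finite sum of homogeneous elements of \<open>I\<close>, and
  \<open>homog_in_J\<close> handles each of them.\<close>

lemma ideal_ops_subset_J: "ideal_ops \<subseteq> J"
proof
  fix x
  assume "x \<in> ideal_ops"
  then obtain p where p: "p \<in> carrier A" "cls p \<in> I" "x = rep p"
    by (auto simp: ideal_polys_def)
  have "direct_sum_of Q (\<lambda>n. I \<inter> lpa_component E n) I"
    using graded by (simp add: graded_ideal_def leavitt_path_algebra_eq)
  then have "I = (\<lambda>f. \<Oplus>\<^bsub>Q\<^esub>n\<in>{n. f n \<noteq> \<zero>\<^bsub>Q\<^esub>}. f n) `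
      {f. (\<forall>n. f n \<in> I \<inter> lpa_component E n) \<and> finite {n. f n \<noteq> \<zero>\<^bsub>Q\<^esub>}}"
    unfolding direct_sum_of_def bij_betw_def by simp
  from subsetD[OF equalityD1[OF this] p(2)]
  obtain f where f: "\<And>n. f n \<in> I" "\<And>n. f n \<in> lpa_component E n"
    "finite {n. f n \<noteq> \<zero>\<^bsub>Q\<^esub>}" "(\<Oplus>\<^bsub>Q\<^esub>n\<in>{n. f n \<noteq> \<zero>\<^bsub>Q\<^esub>}. f n) = cls p"
    by (elim imageE CollectE conjE) blast
  have "\<forall>n. \<exists>r. f n = cls r \<and> r \<in> carrier A \<and> homogeneous n r"
    using f(2) unfolding lpa_component_def homogeneous_def by blast
  then obtain r where r: "f = (\<lambda>n. cls (r n))" "\<And>n. r n \<in> carrier A" "\<And>n. homogeneous n (r n)"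
    by metis
  let ?D = "{n. f n \<noteq> \<zero>\<^bsub>Q\<^esub>}"
  have sum: "cls (\<Sum>n\<in>?D. r n) = cls p"
    using f(4) quotient_finsum[OF f(3), of r] r(2) unfolding r(1) by simp
  have "(\<Sum>n\<in>D. r n) \<in> carrier A" for D
    by (induction D rule: infinite_finite_induct)
      (auto intro!: free_algebra_carrier_closed(1) r(2) simp del: free_algebra_simps(1), simp_all)
  then have "x = (\<Sum>n\<in>?D. rep (r n))"
    using sum rep_eq_iff[of p "\<Sum>n\<in>?D. r n"] p(1,3) by (simp add: rep_sum del: free_algebra_simps(1))
  moreover have "rep (r n) \<in> J" for n
  proof (rule homog_in_J)
    \<comment> \<open>Weight 1 on every edge reproduces the grading of the Leavitt path
      algebra.\<close>
    have "gen_weight (\<lambda>_. 1) g = gen_degree g" for g :: "('v, 'e) lpa_gen"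
      by (cases g) (simp_all add: gen_weight_def)
    then have "gen_weight (\<lambda>_. 1) = (gen_degree :: ('v, 'e) lpa_gen \<Rightarrow> int)"
      by (rule ext)
    then have "linop.ev gen (r n) \<in> homog (\<lambda>_. 1) n"
      using r(2,3) by (intro ev_homog) (simp_all add: homogeneous_def word_degree_def del: free_algebra_simps(1))
    then show "rep (r n) \<in> homog (\<lambda>_. 1) n"
      by (simp only: rep_eq_ev_gen[of "r n"])
    show "rep (r n) \<in> ideal_ops"
      using f(1) r by (auto simp: ideal_polys_def simp del: free_algebra_simps(1))
  qed simp
  then have "(\<Sum>n\<in>?D. rep (r n)) \<in> J"
    by (rule J_sum)
  ultimately show "x \<in> J"
    by (simp only:)
qed

section \<open>The map from the hedgehog algebra into the ideal\<close>

abbreviation B :: "('k, (('v + 'e) list, ('v + 'e) list) lpa_gen list \<Rightarrow>\<^sub>0 'k) module" where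
  "B \<equiv> free_algebra (lpa_gens hedgehog)"

definition h :: "((('v + 'e) list, ('v + 'e) list) lpa_gen list \<Rightarrow>\<^sub>0 'k) \<Rightarrow> (('v, 'e) lpa_gen list, 'k) linop" where
  "h = linop.ev F.gen"

lemma ideal_ops_0: "0 \<in> ideal_ops"
  using ideal_polys(1) rep_0 by (metis image_eqI)

lemma N_SS: "x \<in> ideal_ops \<Longrightarrow> set \<alpha> \<subseteq> arcs E \<Longrightarrow> SS \<alpha> * x \<in> ideal_ops"
  by (induction \<alpha>) (auto simp: mult.assoc N_S)

lemma N_TT_right: "x \<in> ideal_ops \<Longrightarrow> set \<alpha> \<subseteq> arcs E \<Longrightarrow> x * TT \<alpha> \<in> ideal_ops"
  by (induction \<alpha>) (auto simp: N_T simp flip: mult.assoc)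

lemma quill_products_in_ideal_ops:
  assumes "\<alpha> \<in> quills"
  shows "FS (map Inr \<alpha>) \<in> ideal_ops" "FT (map Inr \<alpha>) \<in> ideal_ops" "FP (map Inr \<alpha>) \<in> ideal_ops"
proof -
  have "set \<alpha> \<subseteq> arcs E" "\<alpha> \<noteq> []"
    using assms by (auto simp: quills_def awalk_def)
  moreover have "q (target \<alpha>) \<in> ideal_ops"
    using quill_target[OF assms] by (rule q_in_N)
  ultimately show "FS (map Inr \<alpha>) \<in> ideal_ops" "FT (map Inr \<alpha>) \<in> ideal_ops" "FP (map Inr \<alpha>) \<in> ideal_ops"
    unfolding F_gens F_gens(2)[OF \<open>\<alpha> \<noteq> []\<close>] by (simp_all only: N_SS N_TT_right)
qed

lemma F_gen_in_ideal_ops: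
  assumes "g \<in> lpa_gens hedgehog"
  shows "F.gen g \<in> ideal_ops"
  using assms
proof (cases rule: lpa_gensE)
  case (1 v)
  then consider w where "w \<in> W" "v = [Inl w]" | \<alpha> where "\<alpha> \<in> quills" "v = map Inr \<alpha>"
    unfolding hedgehog_simps(1) by blast
  then have "FP v \<in> ideal_ops"
    by cases (simp_all only: F_gens(1) q_in_N quill_products_in_ideal_ops)
  with 1 show ?thesis
    by (simp only: F.gen.simps)
next
  case (2 e)
  then obtain \<alpha> where "\<alpha> \<in> quills" "e = map Inr \<alpha>"
    unfolding hedgehog_simps(2) by blast
  with 2 show ?thesis
    by (simp only: F.gen.simps quill_products_in_ideal_ops)
next
  case (3 e)
  then obtain \<alpha> where "\<alpha> \<in> quills" "e = map Inr \<alpha>"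
    unfolding hedgehog_simps(2) by blast
  with 3 show ?thesis
    by (simp only: F.gen.simps quill_products_in_ideal_ops)
qed

lemma h_in_ideal_ops:
  assumes "y \<in> carrier B"
  shows "h y \<in> ideal_ops"
proof -
  have "prod_list (map F.gen w) \<in> ideal_ops" if "w \<noteq> []" "set w \<subseteq> lpa_gens hedgehog" for w
    using that
  proof (induction w)
    case (Cons g w)
    then show ?case
      using F_gen_in_ideal_ops[of g] ideal_ops_mult[of "F.gen g" "prod_list (map F.gen w)"] by (cases "w = []") auto
  qed simp
  then show ?thesis
    unfolding h_def linop.ev_def using assms
    by (intro N_sum[OF _ ideal_ops_0] N_scale) auto
qed

text \<open>With this weight \<open>h\<close> preserves degrees, because the edge of a quill is sent
  to a path of that length times an element of degree 0. It is positive since quills are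
  nonempty.\<close>

abbreviation path_weight :: "('v + 'e) list \<Rightarrow> int" where
  "path_weight x \<equiv> int (length x)"

lemma grade_SS: "x \<in> grade d \<Longrightarrow> set \<alpha> \<subseteq> arcs E \<Longrightarrow> SS \<alpha> * x \<in> grade (int (length \<alpha>) + d)"
proof (induction \<alpha>)
  case (Cons e \<alpha>)
  then have "rep (ed e) * (SS \<alpha> * x) \<in> grade (1 + (int (length \<alpha>) + d))"
    by (intro grade_mult[OF grade_gens(2)]) auto
  then show ?case
    by (simp add: mult.assoc algebra_simps)
qed simp

lemma grade_TT: "x \<in> grade d \<Longrightarrow> set \<alpha> \<subseteq> arcs E \<Longrightarrow> x * TT \<alpha> \<in> grade (d - int (length \<alpha>))"
proof (induction \<alpha>)
  case (Cons e \<alpha>)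
  then have "x * TT \<alpha> * rep (gh e) \<in> grade (d - int (length \<alpha>) + - 1)"
    by (intro grade_mult[OF _ grade_gens(3)]) auto
  then show ?case
    by (simp add: mult.assoc algebra_simps)
qed simp

lemma grade_q: "w \<in> W \<Longrightarrow> q w \<in> grade 0"
proof -
  assume w: "w \<in> W"
  have "rep (ed e) * rep (gh e) \<in> grade 0" if "e \<in> exits w" for e
  proof -
    have "e \<in> out_arcs E w"
      using that exits_subset by blast
    then have e: "e \<in> arcs E"
      by simp
    show ?thesis
      using grade_mult[OF grade_gens(2)[OF e] grade_gens(3)[OF e]] by simp
  qed
  then show ?thesis
    unfolding q_def by (intro grade_diff grade_sum grade_gens W_verts w)
qed

lemma grade_F_gen:
  assumes "g \<in> lpa_gens hedgehog"
  shows "F.gen g \<in> grade (gen_weight path_weight g)"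
proof -
  have quill: "FS (map Inr \<alpha>) \<in> grade (int (length \<alpha>)) \<and> FT (map Inr \<alpha>) \<in> grade (- int (length \<alpha>)) \<and>
      FP (map Inr \<alpha>) \<in> grade 0" if "\<alpha> \<in> quills" for \<alpha>
  proof -
    have \<alpha>: "set \<alpha> \<subseteq> arcs E" "q (target \<alpha>) \<in> grade 0" "\<alpha> \<noteq> []"
      using that grade_q[OF quill_target[OF that]] by (auto simp: quills_def awalk_def)
    then show ?thesis
      unfolding F_gens F_gens(2)[OF \<alpha>(3)]
      using grade_SS[OF \<alpha>(2,1)] grade_TT[OF \<alpha>(2,1)] grade_SS[OF grade_TT[OF \<alpha>(2,1)] \<alpha>(1)] by simp
  qed
  show ?thesis
    using assms
  proof (cases rule: lpa_gensE)
    case (1 v)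
    then consider w where "w \<in> W" "v = [Inl w]" | \<alpha> where "\<alpha> \<in> quills" "v = map Inr \<alpha>"
      unfolding hedgehog_simps(1) by blast
    then have "FP v \<in> grade 0"
      by cases (simp_all only: F_gens(1) grade_q quill)
    with 1 show ?thesis
      by (simp add: gen_weight_def)
  next
    case (2 e)
    then obtain \<alpha> where "\<alpha> \<in> quills" "e = map Inr \<alpha>"
      unfolding hedgehog_simps(2) by blast
    with 2 quill[of \<alpha>] show ?thesis
      by (simp add: gen_weight_def del: F_gens)
  next
    case (3 e)
    then obtain \<alpha> where "\<alpha> \<in> quills" "e = map Inr \<alpha>"
      unfolding hedgehog_simps(2) by blast
    with 3 quill[of \<alpha>] show ?thesis
      by (simp add: gen_weight_def del: F_gens)
  qed
qed

lemma grade_h: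
  assumes "y \<in> carrier B" "\<And>w. w \<in> Poly_Mapping.keys y \<Longrightarrow> sum_list (map (gen_weight path_weight) w) = d"
  shows "h y \<in> grade d"
proof -
  have "prod_list (map F.gen w) \<in> grade (sum_list (map (gen_weight path_weight) w))"
    if "w \<noteq> []" "set w \<subseteq> lpa_gens hedgehog" for w
    using that
  proof (induction w)
    case (Cons g w)
    then show ?case
      using grade_F_gen[of g] grade_mult[OF grade_F_gen[of g], of "prod_list (map F.gen w)"] by (cases "w = []") auto
  qed simp
  then show ?thesis
    unfolding h_def linop.ev_def using assms
    by (intro grade_sum grade_scale) fastforce
qed

lemma h_add: "h (y + y') = h y + h y'"
  and h_mult: "h (y * y') = h y * h y'"
  and h_scale: "h (Poly_Mapping.single [] c * y) = scalar_op c * h y"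
  and h_diff: "h (y - y') = h y - h y'"
  and h_sum: "h (sum f D) = (\<Sum>d\<in>D. h (f d))"
  by (simp_all add: h_def linop.ev_add linop.ev_mult linop.ev_diff linop.ev_sum)

section \<open>The kernel of the map\<close>

sublocale LF: leavitt_algebra hedgehog scalar_type
  by (intro leavitt_algebra.intro wf_hedgehog)

lemma h_lpa_ideal: "y \<in> lpa_ideal hedgehog \<Longrightarrow> h y = 0"
  unfolding h_def by (rule F.ev_gen_lpa_ideal)

lemma vertex_nonzero: "v \<in> verts E \<Longrightarrow> rep (vx v) \<noteq> 0"
  using rep_eq_0_iff[OF gens_carrier(1)] vertex_notin_lpa_ideal by blast

text \<open>The reduction is applied to the kernel inside the hedgehog algebra. As the kernel
  contains no vertex, it has no generators of the form allowed by \<open>J\<close>, and a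
  homogeneous element is 0.\<close>

lemma h_kernel_homogeneous:
  assumes "y \<in> carrier B" "h y = 0"
    and "\<And>w. w \<in> Poly_Mapping.keys y \<Longrightarrow> sum_list (map (gen_weight path_weight) w) = d"
  shows "y \<in> lpa_ideal hedgehog"
proof -
  let ?K = "LF.rep ` {y \<in> carrier B. h y = 0}"
  interpret K: leavitt_ideal hedgehog "scalar_op :: 'k \<Rightarrow> _" "\<lambda>v. LF.rep (vx v)" "\<lambda>e. LF.rep (ed e)"
    "\<lambda>e. LF.rep (gh e)" ?K
  proof
    fix x x' c v e
    assume "x \<in> ?K"
    then obtain p where p: "p \<in> carrier B" "h p = 0" "x = LF.rep p"
      by blast
    have mult: "LF.rep a * x \<in> ?K" "x * LF.rep a \<in> ?K" if "a \<in> carrier B" for a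
      using p that by (auto simp: h_mult free_algebra_carrier_closed simp flip: LF.rep_mult
          simp del: free_algebra_simps(1) intro!: imageI)
    show "x + x' \<in> ?K" if "x' \<in> ?K"
      using that p by (auto simp: h_add free_algebra_carrier_closed simp flip: LF.rep_add
          simp del: free_algebra_simps(1) intro!: imageI)
    show "scalar_op c * x \<in> ?K"
      using p by (auto simp: h_scale free_algebra_carrier_closed simp flip: LF.rep_mult LF.rep_scalar
          simp del: free_algebra_simps(1) intro!: imageI)
    show "LF.rep (vx v) * x \<in> ?K" "x * LF.rep (vx v) \<in> ?K" if "v \<in> verts hedgehog"
      using mult LF.gens_carrier(1)[OF that] by blast+
    show "LF.rep (ed e) * x \<in> ?K" "x * LF.rep (ed e) \<in> ?K" if "e \<in> arcs hedgehog"
      using mult LF.gens_carrier(2)[OF that] by blast+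
    show "LF.rep (gh e) * x \<in> ?K" "x * LF.rep (gh e) \<in> ?K" if "e \<in> arcs hedgehog"
      using mult LF.gens_carrier(3)[OF that] by blast+
  qed
  \<comment> \<open>\<open>h\<close> vanishes on the relations, so a vertex whose class lies in the
    kernel would itself be killed, contrary to \<open>FP_nonzero\<close>.\<close>
  have "K.H = {}"
  proof (rule ccontr)
    assume "K.H \<noteq> {}"
    then obtain v p where v: "v \<in> verts hedgehog" "LF.rep (vx v) = LF.rep p" "p \<in> carrier B" "h p = 0"
      unfolding K.H_def by blast
    then have "vx v - p \<in> lpa_ideal hedgehog"
      using LF.rep_eq_iff[OF LF.gens_carrier(1)] LF.cls_eq_iff by blast
    then have "h (vx v - p) = 0"
      by (rule h_lpa_ideal)
    then have "h (vx v) = 0"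
      by (simp add: h_diff v(4))
    then have "FP v = 0"
      by (simp add: h_def)
    then show False
      using FP_nonzero[OF vertex_nonzero v(1)] by blast
  qed
  \<comment> \<open>With no vertex to end in, every edge is an exit, so no infinite emitter has
    finitely many exits.\<close>
  then have "K.exits w = out_arcs hedgehog w" for w
    by (simp only: K.exits_def \<open>K.H = {}\<close>) auto
  with \<open>K.H = {}\<close> have "K.W = {}"
    by (simp only: K.W_def) auto
  have "LF.rep y \<in> K.homog path_weight d"
    using K.ev_homog[OF assms(1,3)] by (simp only: LF.rep_eq_ev_gen[of y])
  moreover have "path_weight e > 0" if "e \<in> arcs hedgehog" for e
    using that by (auto simp: hedgehog_simps)
  ultimately have "LF.rep y \<in> K.J"
    using assms(1,2) by (intro K.homog_in_J) blast+
  moreover have "K.J = {0}"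
    unfolding K.J_def using \<open>K.W = {}\<close> by (auto elim: linop.lspan.cases intro: linop.lspan.zero)
  ultimately show ?thesis
    using LF.rep_eq_0_iff[OF assms(1)] by blast
qed

text \<open>The weight components of \<open>y\<close> have images of different degrees, and these
  are linearly independent. So each component lies in the kernel by itself.\<close>

lemma h_kernel:
  assumes y: "y \<in> carrier B" and "h y = 0"
  shows "y \<in> lpa_ideal hedgehog"
proof -
  let ?wt = "\<lambda>w. sum_list (map (gen_weight path_weight) w)"
  define yd where "yd d = restrict_keys {w. ?wt w = d} y" for d
  have y_sum: "y = (\<Sum>d\<in>?wt ` Poly_Mapping.keys y. yd d)"
    unfolding yd_def by (rule sum_restrict_keys)
  have yd: "yd d \<in> carrier B" "\<And>w. w \<in> Poly_Mapping.keys (yd d) \<Longrightarrow> ?wt w = d" for d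
    unfolding yd_def using restrict_keys_carrier[OF y] by (blast, simp add: keys_restrict_keys)
  have "(\<Sum>d\<in>?wt ` Poly_Mapping.keys y. h (yd d)) = 0"
    using y_sum \<open>h y = 0\<close> by (metis h_sum)
  then have "h (yd d) = 0" if "d \<in> ?wt ` Poly_Mapping.keys y" for d
    using grade_independent[OF _ _ _ that, of "\<lambda>d. h (yd d)"] grade_h[OF yd] by simp
  then have "yd d \<in> lpa_ideal hedgehog" if "d \<in> ?wt ` Poly_Mapping.keys y" for d
    using h_kernel_homogeneous[OF yd(1) _ yd(2)] that by blast
  then have "(\<Sum>d\<in>D. yd d) \<in> lpa_ideal hedgehog" if "D \<subseteq> ?wt ` Poly_Mapping.keys y" for D
    using that by (induction D rule: infinite_finite_induct) (auto intro: LF.R_add LF.R_0)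
  from this[OF subset_refl] show ?thesis
    by (simp only: y_sum[symmetric])
qed

section \<open>The isomorphism on cosets\<close>

definition lift :: "((('v + 'e) list, ('v + 'e) list) lpa_gen list \<Rightarrow>\<^sub>0 'k) \<Rightarrow> (('v, 'e) lpa_gen list \<Rightarrow>\<^sub>0 'k)" where
  "lift y = (SOME p. p \<in> ideal_polys \<and> rep p = h y)"

lemma lift:
  assumes "y \<in> carrier B"
  shows "lift y \<in> carrier A" "cls (lift y) \<in> I" "rep (lift y) = h y"
proof -
  have "\<exists>p. p \<in> ideal_polys \<and> rep p = h y"
    using h_in_ideal_ops[OF assms] by force
  then have "lift y \<in> ideal_polys \<and> rep (lift y) = h y"
    unfolding lift_def by (rule someI_ex)
  then show "lift y \<in> carrier A" "cls (lift y) \<in> I" "rep (lift y) = h y"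
    by (auto simp: ideal_polys_def simp del: free_algebra_simps(1))
qed

definition iso :: "((('v + 'e) list, ('v + 'e) list) lpa_gen list \<Rightarrow>\<^sub>0 'k) set \<Rightarrow> (('v, 'e) lpa_gen list \<Rightarrow>\<^sub>0 'k) set" where
  "iso Y = cls (lift (SOME y. y \<in> carrier B \<and> Y = LF.cls y))"

text \<open>Both choices are harmless: representatives of one coset have the same image under
  \<open>h\<close>, and \<open>rep\<close> separates cosets. Since any \<open>p\<close> with the
  right operator may be used, the homomorphism laws follow without knowing
  \<open>lift\<close>.\<close>

lemma iso_cls:
  assumes "y \<in> carrier B" "p \<in> carrier A" "rep p = h y"
  shows "iso (LF.cls y) = cls p"
proof -
  define y' where "y' = (SOME y'. y' \<in> carrier B \<and> LF.cls y = LF.cls y')"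
  have "\<exists>y'. y' \<in> carrier B \<and> LF.cls y = LF.cls y'"
    using assms(1) by blast
  then have y': "y' \<in> carrier B" "LF.cls y = LF.cls y'"
    unfolding y'_def by (rule someI2_ex, blast)+
  then have "h (y - y') = 0"
    by (intro h_lpa_ideal) (simp add: LF.cls_eq_iff)
  then have "rep (lift y') = rep p"
    using lift(3)[OF y'(1)] assms(3) by (simp add: h_diff)
  then have "cls (lift y') = cls p"
    using rep_eq_iff lift(1)[OF y'(1)] assms(2) by blast
  then show ?thesis
    by (simp add: iso_def y'_def)
qed

text \<open>Injectivity is \<open>h_kernel\<close>. Surjectivity combines the reduction, which puts
  the ideal inside \<open>J\<close>, with the fact that \<open>J\<close> is in the image of the
  hedgehog algebra.\<close>

theorem algebra_iso_hedgehog: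
  "algebra_iso (leavitt_path_algebra E\<lparr>carrier := I\<rparr>) (leavitt_path_algebra hedgehog :: ('k, _) module)"
  unfolding leavitt_path_algebra_eq LF.leavitt_path_algebra_eq
proof (rule algebra_isoI)
  note closed = free_algebra_carrier_closed
  have iso_lift: "iso (LF.cls y) = cls (lift y)" if "y \<in> carrier B" for y
    using iso_cls[OF that] lift[OF that] by blast
  show "bij_betw iso (carrier LF.Q) (carrier (Q\<lparr>carrier := I\<rparr>))"
  proof (rule bij_betw_imageI[OF inj_onI])
    fix X Y
    assume "X \<in> carrier LF.Q" "Y \<in> carrier LF.Q" and eq: "iso X = iso Y"
    then obtain x y where xy: "x \<in> carrier B" "y \<in> carrier B" "X = LF.cls x" "Y = LF.cls y"
      unfolding LF.quotient_carrier by blast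
    then have "cls (lift x) = cls (lift y)"
      using eq iso_lift by simp
    then have "h x = h y"
      using rep_eq_iff lift xy(1,2) by metis
    then have "x - y \<in> lpa_ideal hedgehog"
      using xy by (intro h_kernel closed(5)) (simp_all add: h_diff del: free_algebra_simps(1))
    then show "X = Y"
      using xy by (simp add: LF.cls_eq_iff)
  next
    have "iso X \<in> I" if "X \<in> carrier LF.Q" for X
      using that unfolding LF.quotient_carrier by (elim imageE) (simp only: iso_lift lift(2))
    moreover have "X \<in> iso ` carrier LF.Q" if "X \<in> I" for X
    proof -
      obtain p where p: "p \<in> carrier A" "X = cls p" "cls p \<in> I"
        using I_carrier[OF \<open>X \<in> I\<close>] \<open>X \<in> I\<close> by blast
      then have "p \<in> ideal_polys"
        by (simp only: ideal_polys_def mem_Collect_eq)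
      then obtain y where y: "y \<in> carrier B" "rep p = h y"
        using ideal_ops_subset_J J_subset_image unfolding h_def by blast
      have "LF.cls y \<in> carrier LF.Q"
        unfolding LF.quotient_carrier using y(1) by (rule imageI)
      moreover have "X = iso (LF.cls y)"
        using iso_cls[OF y(1) p(1) y(2)] p(2) by (simp only:)
      ultimately show ?thesis
        by (rule rev_image_eqI)
    qed
    moreover have "carrier (Q\<lparr>carrier := I\<rparr>) = I"
      by simp
    ultimately show "iso ` carrier LF.Q = carrier (Q\<lparr>carrier := I\<rparr>)"
      by blast
  qed
  fix X
  assume "X \<in> carrier LF.Q"
  then obtain x where x: "x \<in> carrier B" "X = LF.cls x"
    unfolding LF.quotient_carrier by blast
  note lx = lift[OF x(1)]
  show "c \<odot>\<^bsub>LF.Q\<^esub> X \<in> carrier LF.Q \<and> iso (c \<odot>\<^bsub>LF.Q\<^esub> X) = c \<odot>\<^bsub>Q\<lparr>carrier := I\<rparr>\<^esub> iso X" for c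
  proof
    show "c \<odot>\<^bsub>LF.Q\<^esub> X \<in> carrier LF.Q"
      unfolding x(2) LF.quotient_smult LF.quotient_carrier by (intro imageI closed x)
    have "iso (LF.cls (Poly_Mapping.single [] c * x)) = cls (Poly_Mapping.single [] c * lift x)"
      by (intro iso_cls closed x lx) (simp add: rep_mult rep_scalar h_scale lx)
    then show "iso (c \<odot>\<^bsub>LF.Q\<^esub> X) = c \<odot>\<^bsub>Q\<lparr>carrier := I\<rparr>\<^esub> iso X"
      by (simp add: x(2) LF.quotient_smult iso_lift[OF x(1)] quotient_smult)
  qed
  fix Y
  assume "Y \<in> carrier LF.Q"
  then obtain y where y: "y \<in> carrier B" "Y = LF.cls y"
    unfolding LF.quotient_carrier by blast
  note ly = lift[OF y(1)]
  show "X \<oplus>\<^bsub>LF.Q\<^esub> Y \<in> carrier LF.Q \<and> iso (X \<oplus>\<^bsub>LF.Q\<^esub> Y) = iso X \<oplus>\<^bsub>Q\<lparr>carrier := I\<rparr>\<^esub> iso Y"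
  proof
    show "X \<oplus>\<^bsub>LF.Q\<^esub> Y \<in> carrier LF.Q"
      unfolding x(2) y(2) LF.quotient_add LF.quotient_carrier by (intro imageI closed x y)
    have "iso (LF.cls (x + y)) = cls (lift x + lift y)"
      by (intro iso_cls closed x y lx ly) (simp add: rep_add h_add lx ly)
    then show "iso (X \<oplus>\<^bsub>LF.Q\<^esub> Y) = iso X \<oplus>\<^bsub>Q\<lparr>carrier := I\<rparr>\<^esub> iso Y"
      by (simp add: x(2) y(2) LF.quotient_add iso_lift[OF x(1)] iso_lift[OF y(1)] quotient_add)
  qed
  show "X \<otimes>\<^bsub>LF.Q\<^esub> Y \<in> carrier LF.Q \<and> iso (X \<otimes>\<^bsub>LF.Q\<^esub> Y) = iso X \<otimes>\<^bsub>Q\<lparr>carrier := I\<rparr>\<^esub> iso Y"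
  proof
    show "X \<otimes>\<^bsub>LF.Q\<^esub> Y \<in> carrier LF.Q"
      unfolding x(2) y(2) LF.quotient_mult[OF x(1) y(1)] LF.quotient_carrier by (intro imageI closed x y)
    have "iso (LF.cls (x * y)) = cls (lift x * lift y)"
      by (intro iso_cls closed x y lx ly) (simp add: rep_mult h_mult lx ly)
    then show "iso (X \<otimes>\<^bsub>LF.Q\<^esub> Y) = iso X \<otimes>\<^bsub>Q\<lparr>carrier := I\<rparr>\<^esub> iso Y"
      using lx ly by (simp add: x(2) y(2) LF.quotient_mult[OF x(1) y(1)] iso_lift[OF x(1)] iso_lift[OF y(1)]
          quotient_mult del: free_algebra_simps(1))
  qed
qed

end

theorem corollary6p2:
  fixes E :: "('v, 'e) pre_digraph"
    and I :: "(('v, 'e) lpa_gen list \<Rightarrow>\<^sub>0 'k::field) set set"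
  assumes "wf_digraph E"
    and "graded_ideal E I"
  shows "\<exists>F :: (('v + 'e) list, ('v + 'e) list) pre_digraph.
           wf_digraph F \<and>
           algebra_iso ((leavitt_path_algebra E)\<lparr>carrier := I\<rparr>)
             (leavitt_path_algebra F :: ('k, _) module)"
proof -
  interpret lpa_graded_ideal E "TYPE('k)" I
    using assms by (intro lpa_graded_ideal.intro leavitt_algebra.intro lpa_graded_ideal_axioms.intro)
  show ?thesis
    using wf_hedgehog algebra_iso_hedgehog by blast
qed

end
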